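(* For every compact convex set $\Omega\subset\mathbb{C}$ with non-empty interior, the analytic configuration constant satisfies the strict inequality $a(\Omega)<1$.
   Context: Let $\Omega\subset\mathbb{C}$ be a compact convex set with non-empty interior. Its boundary $\partial\Omega$ is a rectifiable simple closed curve, oriented counter-clockwise; $s$ denotes arclength measure on $\partial\Omega$. At every $\zeta\in\partial\Omega$ the one-sided tangent angles $\alpha_-(\zeta)\le\alpha_+(\zeta)$ (incoming and outgoing, with branches chosen so that $0\le\alpha_+(\zeta)-\alpha_-(\zeta)<\pi$) exist; $\zeta$ is called a corner if $\alpha_-(\zeta)<\alpha_+(\zeta)$, and there are at most countably many corners. Put $\theta_\zeta:=\pi-\alpha_+(\zeta)+\alpha_-(\zeta)\in(0,\pi]$ (the interior angle at $\zeta$; it equals $\pi$ if $\zeta$ is not a corner). At a non-corner $\sigma$ let $T(\sigma)$ be the unit tangent (in the positive direction) and $N(\sigma)=-iT(\sigma)$ the outward unit normal. For $\zeta\in\partial\Omega$ let $\mu_\zeta$ be the Borel probability measure on $\partial\Omega$ given by $d\mu_\zeta=(1-\theta_\zeta/\pi)\,d\delta_\zeta+\rho_\zeta\,ds$, where $\delta_\zeta$ is the unit point mass at $\zeta$ and $\rho_\zeta(\sigma)=\frac1\pi\operatorname{Re}\Big(\frac{N(\sigma)}{\sigma-\zeta}\Big)$ for non-corners $\sigma\ne\zeta$. Let $C(\partial\Omega)$ be the space of complex-valued continuous functions on $\partial\Omega$. The Neumann–Poincaré operator $K_\Omega:C(\partial\Omega)\to C(\partial\Omega)$ is $K_\Omega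 f(\zeta):=\int_{\partial\Omega}f\,d\mu_\zeta$, $\zeta\in\partial\Omega$; it fixes the constant function $\mathbf{1}$, so it acts on $C(\partial\Omega)/\mathbb{C}\mathbf{1}$, which has the quotient norm $\|g+\mathbb{C}\mathbf{1}\|_{\partial\Omega}=\min_{\lambda\in\mathbb{C}}\max_{\zeta\in\partial\Omega}|g(\zeta)-\lambda|$. Let $\mathcal{A}(\Omega)$ be the space of functions continuous on $\Omega$ and analytic in the interior of $\Omega$, regarded as a subspace of $C(\partial\Omega)$ by restriction to $\partial\Omega$. The analytic configuration constant is the operator norm $a(\Omega):=\|K_\Omega:\mathcal{A}(\Omega)/\mathbb{C}\mathbf{1}\to C(\partial\Omega)/\mathbb{C}\mathbf{1}\|$. *)

theory Defs
  imports "HOL-Complex_Analysis.Complex_Analysis"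
begin

definition curve_length :: "(real \<Rightarrow> complex) \<Rightarrow> real \<Rightarrow> real \<Rightarrow> ennreal" where
  "curve_length \<gamma> a b =
     (SUP ts \<in> {ts. sorted ts \<and> set ts \<subseteq> {a..b}}.
        ennreal (\<Sum>i<length ts - 1. dist (\<gamma> (ts ! i)) (\<gamma> (ts ! Suc i))))"

text \<open>
  A counter-clockwise arclength parametrization of the boundary, extended periodically to the
  whole line so that one-sided derivatives make sense at every parameter, including the one of
  the base point.
\<close>

definition ccw_arclength_param :: "complex set \<Rightarrow> real \<Rightarrow> (real \<Rightarrow> complex) \<Rightarrow> bool" where
  "ccw_arclength_param \<Omega> L \<gamma> \<longleftrightarrow>
     0 < L \<and> (\<forall>t. \<gamma> (t + L) = \<gamma> t) \<and>
     simple_path (\<lambda>u. \<gamma> (L * u)) \<and>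
     path_image (\<lambda>u. \<gamma> (L * u)) = frontier \<Omega> \<and>
     (\<forall>z\<in>interior \<Omega>. winding_number (\<lambda>u. \<gamma> (L * u)) z = 1) \<and>
     (\<forall>a b. a \<le> b \<longrightarrow> curve_length \<gamma> a b = ennreal (b - a))"

text \<open>
  For a compact convex set with non-empty interior such a parametrization exists, and any two
  differ only by a translation of the parameter.  Hence nothing defined below depends on the
  choice.
\<close>

definition boundary_param :: "complex set \<Rightarrow> real \<times> (real \<Rightarrow> complex)" where
  "boundary_param \<Omega> = (SOME p. ccw_arclength_param \<Omega> (fst p) (snd p))"

definition perimeter :: "complex set \<Rightarrow> real" where
  "perimeter \<Omega> = fst (boundary_param \<Omega>)"

definition boundary_curve :: "complex set \<Rightarrow> real \<Rightarrow> complex" where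
  "boundary_curve \<Omega> = snd (boundary_param \<Omega>)"

definition arclength_measure :: "complex set \<Rightarrow> complex measure" where
  "arclength_measure \<Omega> =
     distr (restrict_space lborel {0..<perimeter \<Omega>}) (restrict_space borel (frontier \<Omega>))
       (boundary_curve \<Omega>)"

definition boundary_time :: "complex set \<Rightarrow> complex \<Rightarrow> real" where
  "boundary_time \<Omega> = the_inv_into {0..<perimeter \<Omega>} (boundary_curve \<Omega>)"

definition incoming_tangent :: "complex set \<Rightarrow> complex \<Rightarrow> complex" where
  "incoming_tangent \<Omega> \<zeta> =
     vector_derivative (boundary_curve \<Omega>) (at_left (boundary_time \<Omega> \<zeta>))"

definition outgoing_tangent :: "complex set \<Rightarrow> complex \<Rightarrow> complex" where
  "outgoing_tangent \<Omega> \<zeta> =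
     vector_derivative (boundary_curve \<Omega>) (at_right (boundary_time \<Omega> \<zeta>))"

text \<open>
  The jump \<open>\<alpha>\<^sub>+ - \<alpha>\<^sub>-\<close> of the tangent angle.  With \<open>cis \<alpha>\<^sub>-\<close> and \<open>cis \<alpha>\<^sub>+\<close> the incoming and
  outgoing unit tangents and \<open>0 \<le> \<alpha>\<^sub>+ - \<alpha>\<^sub>- < pi\<close>, it is the principal argument of their
  quotient.
\<close>

definition tangent_jump :: "complex set \<Rightarrow> complex \<Rightarrow> real" where
  "tangent_jump \<Omega> \<zeta> = Arg (outgoing_tangent \<Omega> \<zeta> / incoming_tangent \<Omega> \<zeta>)"

definition corner :: "complex set \<Rightarrow> complex \<Rightarrow> bool" where
  "corner \<Omega> \<zeta> \<longleftrightarrow> 0 < tangent_jump \<Omega> \<zeta>"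

definition interior_angle :: "complex set \<Rightarrow> complex \<Rightarrow> real" where
  "interior_angle \<Omega> \<zeta> = pi - tangent_jump \<Omega> \<zeta>"

text \<open>Only meaningful away from corners, where the two one-sided tangents agree.\<close>

definition outward_normal :: "complex set \<Rightarrow> complex \<Rightarrow> complex" where
  "outward_normal \<Omega> \<sigma> = - \<i> * outgoing_tangent \<Omega> \<sigma>"

text \<open>
  The density is only prescribed off the countable, hence arclength-null, set consisting of
  \<open>\<zeta>\<close> and the corners; it is extended by zero.
\<close>

definition np_density :: "complex set \<Rightarrow> complex \<Rightarrow> complex \<Rightarrow> real" where
  "np_density \<Omega> \<zeta> \<sigma> =
     (if corner \<Omega> \<sigma> \<or> \<sigma> = \<zeta> then 0 else Re (outward_normal \<Omega> \<sigma> / (\<sigma> - \<zeta>)) / pi)"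

definition np_measure :: "complex set \<Rightarrow> complex \<Rightarrow> complex measure" where
  "np_measure \<Omega> \<zeta> =
     measure_of (frontier \<Omega>) (sets (restrict_space borel (frontier \<Omega>)))
       (\<lambda>A. ennreal (1 - interior_angle \<Omega> \<zeta> / pi) * indicator A \<zeta>
          + (\<integral>\<^sup>+\<sigma>\<in>A. ennreal (np_density \<Omega> \<zeta> \<sigma>) \<partial>arclength_measure \<Omega>))"

definition neumann_poincare :: "complex set \<Rightarrow> (complex \<Rightarrow> complex) \<Rightarrow> complex \<Rightarrow> complex" where
  "neumann_poincare \<Omega> f \<zeta> = (LINT \<sigma>|np_measure \<Omega> \<zeta>. f \<sigma>)"

text \<open>The norm of the class of \<open>g\<close> in the quotient of \<open>C(\<partial>\<Omega>)\<close> by the constants.\<close>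

definition quotient_norm :: "complex set \<Rightarrow> (complex \<Rightarrow> complex) \<Rightarrow> real" where
  "quotient_norm \<Omega> g = (INF c. SUP \<zeta>\<in>frontier \<Omega>. norm (g \<zeta> - c))"

definition analytic_algebra :: "complex set \<Rightarrow> (complex \<Rightarrow> complex) set" where
  "analytic_algebra \<Omega> = {g. continuous_on \<Omega> g \<and> g holomorphic_on interior \<Omega>}"

text \<open>
  The operator norm between the quotient spaces, as the supremum over the closed unit ball of
  the domain.  It suffices to let \<open>g\<close> range over representatives, since both the operator and
  the quotient norm only involve the values of \<open>g\<close> on the boundary.
\<close>

definition analytic_config_const :: "complex set \<Rightarrow> real" where
  "analytic_config_const \<Omega> =
     (SUP g \<in> {g \<in> analytic_algebra \<Omega>. quotient_norm \<Omega> g \<le> 1}.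
        quotient_norm \<Omega> (neumann_poincare \<Omega> g))"

end

theory Submission
  imports Defs
begin

text \<open>
  Seen from \<open>\<zeta>\<close>, the measure \<open>\<mu>\<^sub>\<zeta>\<close> is normalised angle, together with an atom at \<open>\<zeta>\<close> that makes it a
  probability measure.  Let \<open>g\<close> be analytic with \<open>|g| \<le> 1\<close> and put \<open>w = K g(\<zeta>)\<close>.  If \<open>|w|\<close> is close to
  1, the mean \<open>w\<close> of \<open>g\<close> can only be that large if \<open>g\<close> is close to \<open>w\<close> in \<open>L\<^sup>1(\<mu>\<^sub>\<zeta>)\<close>.  A thin cone with
  apex \<open>\<zeta>\<close> around a fixed interior point \<open>p\<close> cuts out a boundary arc on which the density of \<open>\<mu>\<^sub>\<zeta>\<close> is
  bounded below uniformly in \<open>\<zeta>\<close>.  Applying Cauchy's formula on the part of \<open>\<Omega>\<close> inside the cone to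
  \<open>(g - w) exp (N ((z - \<zeta>) / (p - \<zeta>))^k)\<close>, whose exponential factor has modulus 1 on the two straight
  edges and \<open>exp N\<close> at \<open>p\<close>, shows that \<open>g(p)\<close> is close to \<open>w\<close>.  So every value of \<open>K g\<close> either has
  modulus at most \<open>1 - \<delta>\<close> or is close to the single number \<open>g(p)\<close>; such values fit in a disc of
  radius less than 1 that does not depend on \<open>g\<close>.
\<close>

section \<open>Calculus with one-sided derivatives\<close>

text \<open>Without analyticity the bound fails: the measures of two vertices of a triangle are
  mutually singular, so a continuous function with values between -1 and 1 can have mean near 1 at
  one vertex and near -1 at another. For analytic g the number g(p) excludes this, since every mean
  close to the unit circle has to agree with it. The estimate must be uniform in the boundary point,
  whatever corners or flat pieces occur there, so all constants are built from the radius r of an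
  inscribed disc about p and the diameter. They are fixed in the order k, N, \<eta>, \<delta>: a
  large N lets the weight exp N at p outweigh the two edges, where g - w is only known to be at most
  2, and then the mean deviation is made small enough to pay for the weight on the arc. The other
  burden is regularity. The boundary parametrization is an unspecified choice, known only through
  its specification; one-sided tangents, supporting lines and the total mass 1 all have to be
  derived from convexity and arclength.\<close>

lemma has_vector_derivative_iff_slope:
  "(f has_vector_derivative d) (at x within S) \<longleftrightarrow>
     ((\<lambda>y. (f y - f x) /\<^sub>R (y - x)) \<longlongrightarrow> d) (at x within S)"
proof -
  have "norm (f y - f x - (y - x) *\<^sub>R d) / norm (y - x) = norm ((f y - f x) /\<^sub>R (y - x) - d)"
    if "y \<noteq> x" for y
  proof -
    have "(f y - f x) /\<^sub>R (y - x) - d = (f y - f x - (y - x) *\<^sub>R d) /\<^sub>R (y - x)"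
      using that by (simp add: scaleR_diff_right)
    then show ?thesis by (simp add: divide_inverse_commute)
  qed
  then have "((\<lambda>y. norm (f y - f x - (y - x) *\<^sub>R d) / norm (y - x)) \<longlongrightarrow> 0) (at x within S) \<longleftrightarrow>
     ((\<lambda>y. norm ((f y - f x) /\<^sub>R (y - x) - d)) \<longlongrightarrow> 0) (at x within S)"
    by (intro Lim_cong_within) auto
  then show ?thesis
    unfolding has_vector_derivative_def has_derivative_iff_norm
    by (simp add: bounded_linear_scaleR_left tendsto_norm_zero_iff Lim_null[of _ d])
qed

text \<open>
  The library's fundamental theorem needs two-sided derivatives off a finite set.  Here the forward
  difference quotients are dominated by the Lipschitz constant, and their integrals telescope.
\<close>

lemma has_integral_right_derivative:
  fixes F :: "real \<Rightarrow> complex"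
  assumes "a \<le> b"
    and lip: "\<And>x y. \<lbrakk>a \<le> x; x \<le> b; a \<le> y; y \<le> b\<rbrakk> \<Longrightarrow> norm (F x - F y) \<le> C * \<bar>x - y\<bar>"
    and der: "\<And>x. \<lbrakk>a \<le> x; x < b\<rbrakk> \<Longrightarrow> (F has_vector_derivative f x) (at_right x)"
  shows "(f has_integral F b - F a) {a..b}"
proof (cases "a = b")
  case False
  then have ab: "a < b" using assms by simp
  \<comment> \<open>Clamping the argument to [a, b] makes G Lipschitz on the whole line, so the
    shifts below never leave its domain.\<close>
  define G where "G x = F (max a (min x b))" for x
  have C0: "0 \<le> C" using lip[of a b] ab by (smt (verit, best) norm_ge_zero mult_less_0_iff)
  have Glip: "norm (G x - G y) \<le> C * \<bar>x - y\<bar>" for x y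
  proof -
    have "norm (G x - G y) \<le> C * \<bar>max a (min x b) - max a (min y b)\<bar>"
      unfolding G_def using ab by (intro lip) auto
    also have "\<dots> \<le> C * \<bar>x - y\<bar>" using C0 by (intro mult_left_mono) auto
    finally show ?thesis .
  qed
  have Gcont: "continuous_on S G" for S
  proof (rule continuous_on_subset[OF _ subset_UNIV])
    show "continuous_on UNIV G"
      by (rule lipschitz_on_continuous_on[where L=C]) (auto simp: lipschitz_on_def dist_norm Glip C0)
  qed
  define Q where "Q n x = (real (Suc n)) *\<^sub>R (G (x + 1 / real (Suc n)) - G x)" for n x
  have Gint: "G integrable_on {c..d}" for c d
    by (rule integrable_continuous_real) (rule Gcont)
  have Qint: "(Q n) integrable_on {a..b}" for n
    unfolding Q_def by (rule integrable_continuous_real)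
      (intro continuous_intros continuous_on_compose2[OF Gcont[of UNIV]], auto)
  have Qbd: "norm (Q n x) \<le> C" for n x
  proof -
    have "norm (Q n x) = real (Suc n) * norm (G (x + 1 / real (Suc n)) - G x)"
      by (simp add: Q_def)
    also have "\<dots> \<le> real (Suc n) * (C * \<bar>x + 1 / real (Suc n) - x\<bar>)"
      by (intro mult_left_mono Glip) auto
    also have "\<dots> = C" by (simp del: of_nat_Suc)
    finally show ?thesis .
  qed
  have inv0: "(\<lambda>n. 1 / real (Suc n)) \<longlonglongrightarrow> 0"
    using LIMSEQ_inverse_real_of_nat by (simp add: inverse_eq_divide)
  \<comment> \<open>G is constant beyond b, so \<open>Q n b = 0\<close> whatever \<open>f b\<close>
    is; this one point is corrected at the end.\<close>
  define f' where "f' x = (if x = b then 0 else f x)" for x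
  have Qlim: "(\<lambda>n. Q n x) \<longlonglongrightarrow> f' x" if x: "x \<in> {a..b}" for x
  proof (cases "x = b")
    case True
    then show ?thesis using ab by (simp add: Q_def G_def f'_def)
  next
    case False
    then have xb: "x < b" "a \<le> x" using x by auto
    have "((\<lambda>y. (F y - F x) /\<^sub>R (y - x)) \<longlongrightarrow> f x) (at_right x)"
      using der[OF xb(2,1)] by (simp add: has_vector_derivative_iff_slope)
    moreover have "filterlim (\<lambda>n. x + 1 / real (Suc n)) (at_right x) sequentially"
      unfolding filterlim_at using tendsto_add[OF tendsto_const[of x] inv0] by auto
    ultimately have "(\<lambda>n. (F (x + 1 / real (Suc n)) - F x) /\<^sub>R (x + 1 / real (Suc n) - x)) \<longlonglongrightarrow> f x"
      by (rule filterlim_compose)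
    moreover have "\<forall>\<^sub>F n in sequentially. 1 / real (Suc n) < b - x"
      using order_tendstoD(2)[OF inv0] xb by simp
    then have "\<forall>\<^sub>F n in sequentially. (F (x + 1 / real (Suc n)) - F x) /\<^sub>R (x + 1 / real (Suc n) - x) = Q n x"
    proof eventually_elim
      case (elim n)
      have "0 \<le> 1 / real (Suc n)" by simp
      with elim xb have "max a (min (x + 1 / real (Suc n)) b) = x + 1 / real (Suc n)" by linarith
      with xb show ?case by (simp add: Q_def G_def)
    qed
    ultimately show ?thesis using False by (simp add: f'_def Lim_transform_eventually)
  qed
  have dc: "f' integrable_on {a..b} \<and> (\<lambda>n. integral {a..b} (Q n)) \<longlonglongrightarrow> integral {a..b} f'"
    using dominated_convergence[of Q "{a..b}" "\<lambda>_. C" f'] Qint Qbd Qlim by auto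
  have avg: "norm (real (Suc n) *\<^sub>R integral {c..c + 1 / real (Suc n)} G - G c) \<le> C / real (Suc n)" for n c
  proof -
    define e where "e = 1 / real (Suc n)"
    have e: "e > 0" "real (Suc n) * e = 1" by (simp_all add: e_def)
    have "norm (integral {c..c+e} (\<lambda>x. G x - G c)) \<le> (C * e) * (c + e - c)"
    proof (rule integral_bound)
      fix t assume "t \<in> {c..c+e}"
      then have "C * \<bar>t - c\<bar> \<le> C * e" using C0 by (intro mult_left_mono) auto
      then show "norm (G t - G c) \<le> C * e" using Glip[of t c] by linarith
    next
      show "continuous_on {c..c + e} (\<lambda>x. G x - G c)"
        by (rule continuous_on_diff[OF Gcont continuous_on_const])
    qed (use e(1) in simp)
    moreover have "integral {c..c+e} (\<lambda>x. G x - G c) = integral {c..c+e} G - e *\<^sub>R G c"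
    proof (rule integral_unique)
      have "((\<lambda>x. G c) has_integral e *\<^sub>R G c) {c..c+e}"
        using has_integral_const_real[of "G c" c "c+e"] e(1) by simp
      then show "((\<lambda>x. G x - G c) has_integral integral {c..c+e} G - e *\<^sub>R G c) {c..c+e}"
        by (intro has_integral_diff integrable_integral Gint)
    qed
    ultimately have le: "norm (integral {c..c+e} G - e *\<^sub>R G c) \<le> C * e * e"
      by (simp only: add_diff_cancel_left')
    have "real (Suc n) *\<^sub>R (integral {c..c+e} G - e *\<^sub>R G c) = real (Suc n) *\<^sub>R integral {c..c+e} G - G c"
      by (simp only: scaleR_diff_right scaleR_scaleR e scaleR_one)
    then have "norm (real (Suc n) *\<^sub>R integral {c..c+e} G - G c)
        = real (Suc n) * norm (integral {c..c+e} G - e *\<^sub>R G c)"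
      by (metis abs_of_nat norm_scaleR)
    also have "\<dots> \<le> real (Suc n) * (C * e * e)"
      using le by (rule mult_left_mono) (rule of_nat_0_le_iff)
    also have "\<dots> = C * e * (real (Suc n) * e)" by (simp only: mult_ac)
    also have "\<dots> = C / real (Suc n)" by (simp only: e(2) mult_1_right) (simp add: e_def)
    finally show ?thesis by (simp only: e_def)
  qed
  have avglim: "(\<lambda>n. real (Suc n) *\<^sub>R integral {c..c + 1 / real (Suc n)} G) \<longlonglongrightarrow> G c" for c
  proof (rule Lim_null[THEN iffD2], rule Lim_null_comparison)
    show "\<forall>\<^sub>F n in sequentially. norm (real (Suc n) *\<^sub>R integral {c..c + 1 / real (Suc n)} G - G c) \<le> C / real (Suc n)"
      using avg by simp
    show "(\<lambda>n. C / real (Suc n)) \<longlonglongrightarrow> 0"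
      using tendsto_mult[OF tendsto_const[of C] inv0] by simp
  qed
  have Qval: "integral {a..b} (Q n) = real (Suc n) *\<^sub>R integral {b..b + 1 / real (Suc n)} G
      - real (Suc n) *\<^sub>R integral {a..a + 1 / real (Suc n)} G" for n
  proof -
    define e where "e = 1 / real (Suc n)"
    have e: "e > 0" by (simp add: e_def)
    have sh: "((\<lambda>x. G (x + e)) has_integral integral {a+e..b+e} G) {a..b}"
      using has_integral_affinity'[of G "integral {a+e..b+e} G" "a+e" "b+e" 1 e] integrable_integral[OF Gint]
      by simp
    have "integral {a..b} (Q n) = real (Suc n) *\<^sub>R (integral {a+e..b+e} G - integral {a..b} G)"
      unfolding Q_def e_def[symmetric]
      by (rule integral_unique, intro has_integral_cmul has_integral_diff sh integrable_integral Gint)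
    moreover have "integral {a..a+e} G + integral {a+e..b+e} G = integral {a..b+e} G"
      using e ab by (intro Henstock_Kurzweil_Integration.integral_combine Gint) auto
    moreover have "integral {a..b} G + integral {b..b+e} G = integral {a..b+e} G"
      using e ab by (intro Henstock_Kurzweil_Integration.integral_combine Gint) auto
    ultimately have "integral {a+e..b+e} G - integral {a..b} G = integral {b..b+e} G - integral {a..a+e} G"
      by (simp add: algebra_simps)
    then show ?thesis unfolding e_def[symmetric]
      using \<open>integral {a..b} (Q n) = _\<close> by (simp only: scaleR_diff_right)
  qed
  have "(\<lambda>n. integral {a..b} (Q n)) \<longlonglongrightarrow> G b - G a"
    unfolding Qval by (intro tendsto_diff avglim)
  then have "integral {a..b} f' = G b - G a" using dc LIMSEQ_unique by blast
  then have "(f' has_integral F b - F a) {a..b}"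
    using dc ab integrable_integral[of f' "{a..b}"] by (simp add: G_def)
  then show ?thesis
    by (rule has_integral_spike[of "{b}", rotated 2]) (auto simp: f'_def)
next
  case True
  then show ?thesis using has_integral_refl(2)[of f a] by simp
qed

text \<open>The chain rule gives the right derivative of G along c, and
  \<open>has_integral_right_derivative\<close> then needs a Lipschitz constant. It comes from a
  bound on g over a small closed disc around a point of the curve, hence only for short intervals;
  Bolzano's bisection glues them.\<close>

lemma has_integral_holomorphic_along_curve:
  fixes c c' :: "real \<Rightarrow> complex"
  assumes "a \<le> b" and U: "open U" and G: "\<And>z. z \<in> U \<Longrightarrow> (G has_field_derivative g z) (at z)"
    and lip: "\<And>x y. \<lbrakk>a \<le> x; x \<le> b; a \<le> y; y \<le> b\<rbrakk> \<Longrightarrow> norm (c x - c y) \<le> C * \<bar>x - y\<bar>"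
    and der: "\<And>x. \<lbrakk>a \<le> x; x < b\<rbrakk> \<Longrightarrow> (c has_vector_derivative c' x) (at_right x)"
    and mem: "\<And>x. \<lbrakk>a \<le> x; x \<le> b\<rbrakk> \<Longrightarrow> c x \<in> U"
  shows "((\<lambda>x. g (c x) * c' x) has_integral G (c b) - G (c a)) {a..b}"
proof -
  have C0: "0 \<le> C \<or> a = b" using lip[of a b] \<open>a \<le> b\<close>
    by (smt (verit, best) norm_ge_zero mult_less_0_iff)
  have gh: "g holomorphic_on U"
  proof -
    have "G holomorphic_on U" using G holomorphic_on_open U by blast
    then have "deriv G holomorphic_on U" using U holomorphic_deriv by blast
    then show ?thesis by (rule holomorphic_transform) (use G DERIV_imp_deriv in blast)
  qed
  let ?P = "\<lambda>c1 d1. a \<le> c1 \<longrightarrow> d1 \<le> b \<longrightarrow> c1 \<le> d1 \<longrightarrow>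
      ((\<lambda>x. g (c x) * c' x) has_integral G (c d1) - G (c c1)) {c1..d1}"
  have "?P a b"
  proof (rule Bolzano[of a b ?P])
    fix x y z assume *: "?P x y" "?P y z" "x \<le> y" "y \<le> z"
    show "?P x z"
    proof (intro impI)
      assume "a \<le> x" "z \<le> b" "x \<le> z"
      have "((\<lambda>x. g (c x) * c' x) has_integral (G (c y) - G (c x)) + (G (c z) - G (c y))) {x..z}"
        using * \<open>a \<le> x\<close> \<open>z \<le> b\<close> by (intro has_integral_combine[of x y z]) auto
      then show "((\<lambda>x. g (c x) * c' x) has_integral G (c z) - G (c x)) {x..z}" by simp
    qed
  next
    fix x assume x: "a \<le> x" "x \<le> b"
    then have "c x \<in> U" using mem by auto
    then obtain e where e: "e > 0" "cball (c x) e \<subseteq> U" using U open_contains_cball by blast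
    have "compact (g ` cball (c x) e)"
      using e gh by (intro compact_continuous_image holomorphic_on_imp_continuous_on)
        (auto intro: holomorphic_on_subset)
    then obtain B where B: "\<And>z. z \<in> cball (c x) e \<Longrightarrow> norm (g z) \<le> B"
      using compact_imp_bounded bounded_iff by (metis imageI)
    have B0: "0 \<le> B" using B[of "c x"] e norm_ge_zero order_trans by (metis centre_in_cball less_imp_le)
    show "\<exists>d>0. \<forall>y z. y \<le> x \<and> x \<le> z \<and> z - y < d \<longrightarrow> ?P y z"
    proof (intro exI conjI allI impI)
      show "0 < e / (\<bar>C\<bar> + 1)" using e by simp
      fix y z assume yz: "y \<le> x \<and> x \<le> z \<and> z - y < e / (\<bar>C\<bar> + 1)" "a \<le> y" "z \<le> b" "y \<le> z"
      have near: "c w \<in> cball (c x) e" if "y \<le> w" "w \<le> z" for w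
      proof -
        have "norm (c w - c x) \<le> C * \<bar>w - x\<bar>" using lip that yz by auto
        also have "\<dots> \<le> (\<bar>C\<bar> + 1) * (z - y)" using that yz by (intro mult_mono) auto
        also have "\<dots> \<le> e" using yz
          by (smt (verit, best) mult.commute pos_less_divide_eq)
        finally show ?thesis by (simp add: dist_norm norm_minus_commute)
      qed
      show "((\<lambda>x. g (c x) * c' x) has_integral G (c z) - G (c y)) {y..z}"
      proof (rule has_integral_right_derivative[where C="B * \<bar>C\<bar>"])
        fix u v assume uv: "y \<le> u" "u \<le> z" "y \<le> v" "v \<le> z"
        have "norm (G (c u) - G (c v)) \<le> B * norm (c u - c v)"
        proof (rule field_differentiable_bound[of "cball (c x) e"])
          show "(G has_field_derivative g w) (at w within cball (c x) e)" if "w \<in> cball (c x) e" for w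
            using G e that has_field_derivative_at_within by blast
        qed (use near uv B in auto)
        also have "\<dots> \<le> B * (\<bar>C\<bar> * \<bar>u - v\<bar>)"
        proof (rule mult_left_mono[OF _ B0])
          have "norm (c u - c v) \<le> C * \<bar>u - v\<bar>" using lip[of u v] uv yz by auto
          also have "\<dots> \<le> \<bar>C\<bar> * \<bar>u - v\<bar>" by (intro mult_right_mono) auto
          finally show "norm (c u - c v) \<le> \<bar>C\<bar> * \<bar>u - v\<bar>" .
        qed
        finally show "norm (G (c u) - G (c v)) \<le> B * \<bar>C\<bar> * \<bar>u - v\<bar>" by (simp add: mult.assoc)
      next
        fix u assume u: "y \<le> u" "u < z"
        have "(G has_field_derivative g (c u)) (at (c u))" using G near[of u] u e by auto
        then have "((G \<circ> c) has_vector_derivative c' u * g (c u)) (at_right u)"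
          using der[of u] u yz
          by (intro field_vector_diff_chain_within[OF _ has_field_derivative_at_within]) auto
        then show "((\<lambda>x. G (c x)) has_vector_derivative g (c u) * c' u) (at_right u)"
          by (simp add: o_def mult.commute)
      qed (use yz in auto)
    qed
  qed (fact \<open>a \<le> b\<close>)
  then show ?thesis using \<open>a \<le> b\<close> by blast
qed

text \<open>If the rational q lies strictly between the two slopes, f(s) - q s has a strict local
  minimum at t. For fixed q and fixed radius 1/(n+1), two such minima are at least 1/(n+1) apart, so
  there are only countably many.\<close>

lemma countable_one_sided_derivative_jump_real:
  fixes f :: "real \<Rightarrow> real"
  assumes l: "\<And>t. (f has_real_derivative l t) (at_left t)"
    and r: "\<And>t. (f has_real_derivative r t) (at_right t)"
  shows "countable {t. l t < r t}"
proof -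
  define S where "S q n = {t. \<forall>s. s \<noteq> t \<and> \<bar>s - t\<bar> < 1 / real (Suc n) \<longrightarrow> f t - q * t < f s - q * s}" for q n
  have cS: "countable (S q n)" for q n
  proof -
    have sep: "1 / real (Suc n) \<le> dist s t" if "s \<in> S q n" "t \<in> S q n" "s \<noteq> t" for s t
      using that unfolding S_def dist_real_def by (smt (verit, best) mem_Collect_eq)
    have "inj_on (\<lambda>t. \<lfloor>t * real (Suc n)\<rfloor>) (S q n)"
    proof (rule inj_onI, rule ccontr)
      fix s t assume st: "s \<in> S q n" "t \<in> S q n" "\<lfloor>s * real (Suc n)\<rfloor> = \<lfloor>t * real (Suc n)\<rfloor>" "s \<noteq> t"
      then have "\<bar>s * real (Suc n) - t * real (Suc n)\<bar> < 1"
        by linarith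
      then have "\<bar>s - t\<bar> * real (Suc n) < 1"
        using abs_mult[of "s - t" "real (Suc n)"] by (simp only: left_diff_distrib abs_of_nat)
      moreover have "1 / real (Suc n) \<le> \<bar>s - t\<bar>" using sep st by (simp add: dist_real_def)
      then have "1 \<le> \<bar>s - t\<bar> * real (Suc n)" by (simp add: pos_divide_le_eq del: of_nat_Suc)
      ultimately show False by simp
    qed
    then show ?thesis by (rule countableI')
  qed
  have "{t. l t < r t} \<subseteq> (\<Union>q\<in>\<rat>. \<Union>n. S q n)"
  proof
    fix t assume "t \<in> {t. l t < r t}"
    then obtain q where q: "q \<in> \<rat>" "l t < q" "q < r t" using Rats_dense_in_real by blast
    have L: "((\<lambda>y. (f y - f t) / (y - t)) \<longlongrightarrow> l t) (at_left t)"
      using l[of t] by (simp add: has_field_derivative_iff)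
    have R: "((\<lambda>y. (f y - f t) / (y - t)) \<longlongrightarrow> r t) (at_right t)"
      using r[of t] by (simp add: has_field_derivative_iff)
    obtain a where a: "a < t" "\<And>y. a < y \<Longrightarrow> y < t \<Longrightarrow> (f y - f t) / (y - t) < q"
      using order_tendstoD(2)[OF L q(2)] unfolding eventually_at_left_field by blast
    obtain b where b: "t < b" "\<And>y. t < y \<Longrightarrow> y < b \<Longrightarrow> q < (f y - f t) / (y - t)"
      using order_tendstoD(1)[OF R q(3)] unfolding eventually_at_right_field by blast
    obtain n where n: "1 / real (Suc n) < min (t - a) (b - t)"
      using a b nat_approx_posE[of "min (t - a) (b - t)"] by auto
    have "f t - q * t < f s - q * s" if "s \<noteq> t" "\<bar>s - t\<bar> < 1 / real (Suc n)" for s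
    proof (cases "s < t")
      case True
      then have "(f s - f t) / (s - t) < q" using a n that by auto
      then show ?thesis using True by (simp add: neg_divide_less_eq algebra_simps)
    next
      case False
      then have st: "t < s" "s < b" using that n by auto
      then have "q < (f s - f t) / (s - t)" using b by auto
      then show ?thesis using st by (simp add: pos_less_divide_eq algebra_simps)
    qed
    then have "t \<in> S q n" by (auto simp: S_def)
    then show "t \<in> (\<Union>q\<in>\<rat>. \<Union>n. S q n)" using q by blast
  qed
  then show ?thesis
    by (rule countable_subset) (use cS countable_rat in auto)
qed

lemma countable_one_sided_derivative_neq:
  fixes f :: "real \<Rightarrow> complex"
  assumes l: "\<And>t. (f has_vector_derivative l t) (at_left t)"
    and r: "\<And>t. (f has_vector_derivative r t) (at_right t)"
  shows "countable {t. l t \<noteq> r t}"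
proof -
  have lin: "((\<lambda>t. h (f t)) has_real_derivative h (g t)) (at t within S)"
    if "bounded_linear h" "(f has_vector_derivative g t) (at t within S)" for h :: "complex \<Rightarrow> real" and g t and S :: "real set"
    using bounded_linear.has_vector_derivative[OF that]
    by (simp add: has_real_derivative_iff_has_vector_derivative)
  have jump: "countable {t. h (l t) < h (r t)}" if "bounded_linear h" for h :: "complex \<Rightarrow> real"
    by (rule countable_one_sided_derivative_jump_real[of "\<lambda>t. h (f t)"]) (use lin that l r in blast)+
  have m: "bounded_linear (\<lambda>z. - Re z)" "bounded_linear (\<lambda>z. - Im z)"
    by (simp_all add: bounded_linear_minus bounded_linear_Re bounded_linear_Im)
  have "{t. l t \<noteq> r t} \<subseteq> ({t. Re (l t) < Re (r t)} \<union> {t. Im (l t) < Im (r t)}) \<union>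
     ({t. - Re (l t) < - Re (r t)} \<union> {t. - Im (l t) < - Im (r t)})"
    by (auto simp: complex_eq_iff)
  then show ?thesis
    by (rule countable_subset)
       (intro countable_Un jump[OF bounded_linear_Re] jump[OF bounded_linear_Im] jump[OF m(1)] jump[OF m(2)])
qed

section \<open>Lengths of curves and convex arcs\<close>

text \<open>The signed area of the parallelogram spanned by u and v, positive when v points to the
  left of u. Orientation and support are expressed by its sign, which avoids branches of the
  argument.\<close>

definition wedge :: "complex \<Rightarrow> complex \<Rightarrow> real" where
  "wedge u v = Re u * Im v - Im u * Re v"

lemma wedge_eq_Im_cnj: "wedge u v = Im (cnj u * v)"
  by (simp add: wedge_def)

text \<open>The index sum inside \<open>curve_length\<close>, recast as a recursion so that
  inscribed polygons can be split and joined by list induction.\<close>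

fun polygon_length :: "('a \<Rightarrow> complex) \<Rightarrow> 'a list \<Rightarrow> real" where
  "polygon_length \<gamma> (x # y # ts) = dist (\<gamma> x) (\<gamma> y) + polygon_length \<gamma> (y # ts)"
| "polygon_length \<gamma> _ = 0"

lemma polygon_length_eq_sum:
  "polygon_length \<gamma> ts = (\<Sum>i<length ts - 1. dist (\<gamma> (ts ! i)) (\<gamma> (ts ! Suc i)))"
proof (induction \<gamma> ts rule: polygon_length.induct)
  case (1 \<gamma> x y ts)
  have "(\<Sum>i<length (x # y # ts) - 1. dist (\<gamma> ((x # y # ts) ! i)) (\<gamma> ((x # y # ts) ! Suc i)))
      = (\<Sum>i<Suc (length ts). dist (\<gamma> ((x # y # ts) ! i)) (\<gamma> ((x # y # ts) ! Suc i)))"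
    by simp
  also have "\<dots> = dist (\<gamma> x) (\<gamma> y) + (\<Sum>i<length ts. dist (\<gamma> ((y # ts) ! i)) (\<gamma> ((y # ts) ! Suc i)))"
    by (subst sum.lessThan_Suc_shift) simp
  finally show ?case using 1 by simp
qed auto

lemma polygon_length_nonneg: "0 \<le> polygon_length \<gamma> ts"
  by (induction \<gamma> ts rule: polygon_length.induct) auto

lemma polygon_length_append_le:
  "polygon_length \<gamma> xs + polygon_length \<gamma> ys \<le> polygon_length \<gamma> (xs @ ys)"
proof (induction \<gamma> xs rule: polygon_length.induct)
  case ("2_2" \<gamma> v)
  then show ?case by (cases ys) auto
qed auto

text \<open>The triangle inequality: a detour through m cannot shorten a polygon. With m the
  division point of an interval it yields the upper bound in
  \<open>curve_length_add\<close>.\<close>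

lemma polygon_length_insert:
  "polygon_length \<gamma> (xs @ ys) \<le> polygon_length \<gamma> (xs @ [m]) + polygon_length \<gamma> (m # ys)"
proof (induction \<gamma> xs rule: polygon_length.induct)
  case ("2_1" \<gamma>)
  then show ?case by (cases ys) auto
next
  case ("2_2" \<gamma> v)
  then show ?case
    using dist_triangle[of "\<gamma> v" _ "\<gamma> m"] by (cases ys) auto
qed auto

lemma polygon_length_map: "polygon_length \<gamma> (map f ts) = polygon_length (\<lambda>x. \<gamma> (f x)) ts"
  by (induction "\<lambda>x. \<gamma> (f x)" ts rule: polygon_length.induct) auto

lemma polygon_length_cong:
  "(\<And>x. x \<in> set ts \<Longrightarrow> \<gamma> x = \<gamma>' x) \<Longrightarrow> polygon_length \<gamma> ts = polygon_length \<gamma>' ts"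
  by (induction \<gamma> ts rule: polygon_length.induct) auto

lemma curve_length_eq_polygon_length:
  "curve_length \<gamma> a b = (SUP ts \<in> {ts. sorted ts \<and> set ts \<subseteq> {a..b}}. ennreal (polygon_length \<gamma> ts))"
  unfolding curve_length_def polygon_length_eq_sum ..

lemma polygon_length_le_curve_length:
  "sorted ts \<Longrightarrow> set ts \<subseteq> {a..b} \<Longrightarrow> ennreal (polygon_length \<gamma> ts) \<le> curve_length \<gamma> a b"
  unfolding curve_length_eq_polygon_length by (rule SUP_upper) simp

lemma dist_le_curve_length:
  "a \<le> b \<Longrightarrow> ennreal (dist (\<gamma> a) (\<gamma> b)) \<le> curve_length \<gamma> a b"
  using polygon_length_le_curve_length[of "[a, b]" a b \<gamma>] by simp

text \<open>The increments of h dominate the chords, so the length of an inscribed polygon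
  telescopes. A general h instead of a Lipschitz constant is what later allows a multiple of a
  coordinate of the curve to bound its length.\<close>

lemma curve_length_leI:
  assumes h: "\<And>x y. \<lbrakk>a \<le> x; x \<le> y; y \<le> b\<rbrakk> \<Longrightarrow> dist (\<gamma> x) (\<gamma> y) \<le> h y - h x" and "a \<le> b"
  shows "curve_length \<gamma> a b \<le> ennreal (h b - h a)"
proof -
  have mono: "h x \<le> h y" if "a \<le> x" "x \<le> y" "y \<le> b" for x y
    using h[OF that] zero_le_dist[of "\<gamma> x" "\<gamma> y"] by linarith
  have "sorted ts \<Longrightarrow> set ts \<subseteq> {x..b} \<Longrightarrow> a \<le> x \<Longrightarrow> x \<le> b \<Longrightarrow> polygon_length \<gamma> ts \<le> h b - h x" for ts x
  proof (induction ts arbitrary: x rule: induct_list012)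
    case (3 u v ts)
    have "polygon_length \<gamma> (v # ts) \<le> h b - h v" using 3(3-) by (intro 3(2)) auto
    moreover have "dist (\<gamma> u) (\<gamma> v) \<le> h v - h u" using 3(3-) by (intro h) auto
    moreover have "h x \<le> h u" using 3(3-) by (intro mono) auto
    ultimately show ?case by simp
  qed (use mono in auto)
  then show ?thesis
    unfolding curve_length_eq_polygon_length using \<open>a \<le> b\<close>
    by (intro SUP_least ennreal_leI) auto
qed

lemma curve_length_add:
  assumes "a \<le> b" "b \<le> c"
  shows "curve_length \<gamma> a c = curve_length \<gamma> a b + curve_length \<gamma> b c"
proof (rule antisym)
  show "curve_length \<gamma> a c \<le> curve_length \<gamma> a b + curve_length \<gamma> b c"
    unfolding curve_length_eq_polygon_length[of \<gamma> a c]
  proof (rule SUP_least, clarify)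
    fix ts assume ts: "sorted ts" "set ts \<subseteq> {a..c}"
    define xs where "xs = takeWhile (\<lambda>x. x \<le> b) ts"
    define ys where "ys = dropWhile (\<lambda>x. x \<le> b) ts"
    have xy: "ts = xs @ ys" by (simp add: xs_def ys_def)
    have sx: "sorted (xs @ [b])" "set (xs @ [b]) \<subseteq> {a..b}"
      using ts assms set_takeWhileD[of _ "\<lambda>x. x \<le> b" ts] sorted_wrt_takeWhile[of "(\<le>)" ts]
      by (fastforce simp: xs_def sorted_append)+
    have "y > b" if "y \<in> set ys" for y
    proof -
      obtain y0 ys' where ys: "ys = y0 # ys'" using \<open>y \<in> set ys\<close> by (cases ys) auto
      then have "y0 > b" using hd_dropWhile[of "\<lambda>x. x \<le> b" ts] unfolding ys_def[symmetric] by auto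
      moreover have "sorted ys" using ts xy sorted_append by blast
      ultimately show ?thesis using that ys by auto
    qed
    then have sy: "sorted (b # ys)" "set (b # ys) \<subseteq> {b..c}"
      using ts xy assms by (auto simp: sorted_append less_imp_le)
    have "ennreal (polygon_length \<gamma> ts) \<le> ennreal (polygon_length \<gamma> (xs @ [b]) + polygon_length \<gamma> (b # ys))"
      unfolding xy by (intro ennreal_leI polygon_length_insert)
    also have "\<dots> = ennreal (polygon_length \<gamma> (xs @ [b])) + ennreal (polygon_length \<gamma> (b # ys))"
      by (intro ennreal_plus polygon_length_nonneg)
    also have "\<dots> \<le> curve_length \<gamma> a b + curve_length \<gamma> b c"
      using sx sy by (intro add_mono polygon_length_le_curve_length)
    finally show "ennreal (polygon_length \<gamma> ts) \<le> curve_length \<gamma> a b + curve_length \<gamma> b c" .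
  qed
next
  let ?S = "\<lambda>a b. {ts. sorted ts \<and> set ts \<subseteq> {a..b::real}}"
  have ne: "?S a b \<noteq> {}" for a b by (auto intro!: exI[of _ "[]"])
  have *: "ennreal (polygon_length \<gamma> xs) + ennreal (polygon_length \<gamma> ys) \<le> curve_length \<gamma> a c"
    if "xs \<in> ?S a b" "ys \<in> ?S b c" for xs ys
  proof -
    have "ennreal (polygon_length \<gamma> xs) + ennreal (polygon_length \<gamma> ys)
        = ennreal (polygon_length \<gamma> xs + polygon_length \<gamma> ys)"
      by (simp add: ennreal_plus polygon_length_nonneg)
    also have "\<dots> \<le> ennreal (polygon_length \<gamma> (xs @ ys))"
      by (intro ennreal_leI polygon_length_append_le)
    also have "\<dots> \<le> curve_length \<gamma> a c"
      using that assms by (intro polygon_length_le_curve_length) (force simp: sorted_append)+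
    finally show ?thesis .
  qed
  have "ennreal (polygon_length \<gamma> xs) + curve_length \<gamma> b c \<le> curve_length \<gamma> a c"
    if "xs \<in> ?S a b" for xs
    unfolding curve_length_eq_polygon_length[of \<gamma> b c] ennreal_SUP_add_right[OF ne]
    by (intro SUP_least * that)
  then show "curve_length \<gamma> a b + curve_length \<gamma> b c \<le> curve_length \<gamma> a c"
    unfolding curve_length_eq_polygon_length[of \<gamma> a b] ennreal_SUP_add_left[OF ne, symmetric]
    by (intro SUP_least)
qed

lemma curve_length_reparam_le:
  assumes "mono_on {a..b} \<psi>" "\<psi> ` {a..b} \<subseteq> {c..d}" "\<And>x. x \<in> {a..b} \<Longrightarrow> \<gamma> x = \<sigma> (\<psi> x)"
  shows "curve_length \<gamma> a b \<le> curve_length \<sigma> c d"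
  unfolding curve_length_eq_polygon_length[of \<gamma> a b]
proof (rule SUP_least, clarify)
  fix ts assume ts: "sorted ts" "set ts \<subseteq> {a..b}"
  have "polygon_length \<gamma> ts = polygon_length \<sigma> (map \<psi> ts)"
    unfolding polygon_length_map using ts assms(3) by (intro polygon_length_cong) auto
  moreover have "sorted (map \<psi> ts)"
    unfolding sorted_map
    by (rule sorted_wrt_mono_rel[OF _ ts(1)]) (use ts(2) assms(1) in \<open>blast intro: mono_onD\<close>)
  moreover have "set (map \<psi> ts) \<subseteq> {c..d}" using ts assms(2) by auto
  ultimately show "ennreal (polygon_length \<gamma> ts) \<le> curve_length \<sigma> c d"
    using polygon_length_le_curve_length by metis
qed

text \<open>
  In the coordinates \<open>X = wedge e c\<close> and \<open>Y = - Re (cnj e * c)\<close> the arc is the graph of a convex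
  function, so the slopes \<open>m a b\<close> are monotone.  The last assumption says that the arc from \<open>a\<close> to
  \<open>b\<close> has length at least \<open>b - a\<close>, in a form that carries over directly to the reversed curve.
\<close>

lemma convex_arc_right_derivative:
  fixes c :: "real \<Rightarrow> complex"
  assumes "0 < h"
    and fwd: "\<And>a b. \<lbrakk>t - h \<le> a; a < b; b \<le> t + h\<rbrakk> \<Longrightarrow> 0 < wedge e (c b - c a)"
    and orient: "\<And>a b d. \<lbrakk>t - h \<le> a; a < b; b < d; d \<le> t + h\<rbrakk> \<Longrightarrow> 0 \<le> wedge (c b - c a) (c d - c a)"
    and dist_le: "\<And>a b. a \<le> b \<Longrightarrow> dist (c a) (c b) \<le> b - a"
    and len: "\<And>a b k. \<lbrakk>a \<le> b; \<And>x y. \<lbrakk>a \<le> x; x \<le> y; y \<le> b\<rbrakk> \<Longrightarrow> dist (c x) (c y) \<le> k y - k x\<rbrakk>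
      \<Longrightarrow> b - a \<le> k b - (k a :: real)"
  shows "\<exists>d. norm d = 1 \<and> (c has_vector_derivative d) (at_right t)"
proof -
  define X where "X s = wedge e (c s)" for s
  define Y where "Y s = - Re (cnj e * c s)" for s
  define m where "m a b = (Y b - Y a) / (X b - X a)" for a b
  define E where "E = (norm e)\<^sup>2"
  have e0: "e \<noteq> 0" using fwd[of t "t + h"] \<open>0 < h\<close> by (auto simp: wedge_def)
  have E0: "E > 0" using e0 by (simp add: E_def)
  have Xpos: "X a < X b" if "t - h \<le> a" "a < b" "b \<le> t + h" for a b
    using fwd[OF that] by (simp add: X_def wedge_def algebra_simps)
  \<comment> \<open>Chords are expanded in the orthogonal frame \<open>\<i> * e\<close>,
    \<open>e\<close>; dividing by E makes up for e not being a unit vector.\<close>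
  have chord: "c b - c a = ((X b - X a) *\<^sub>R (\<i> * e) - (Y b - Y a) *\<^sub>R e) /\<^sub>R E" for a b
  proof -
    have "E *\<^sub>R (c b - c a) = (X b - X a) *\<^sub>R (\<i> * e) - (Y b - Y a) *\<^sub>R e"
      unfolding E_def cmod_power2
      by (rule complex_eqI) (simp_all add: X_def Y_def wedge_def power2_eq_square algebra_simps)
    then show ?thesis using E0 by (metis less_irrefl scaleR_one scaleR_scaleR left_inverse)
  qed
  have wedge_XY: "wedge (c b - c a) (c d - c a') * E
      = (X b - X a) * (Y d - Y a') - (Y b - Y a) * (X d - X a')" for a b d a'
    unfolding E_def cmod_power2
    by (simp add: X_def Y_def wedge_def power2_eq_square) algebra
  have m1: "m a b \<le> m a d" "m a b \<le> m b d" "m a d \<le> m b d"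
    if "t - h \<le> a" "a < b" "b < d" "d \<le> t + h" for a b d
  proof -
    have p: "X a < X b" "X b < X d" "X a < X d" using Xpos that by auto
    have "0 \<le> (X b - X a) * (Y d - Y a) - (Y b - Y a) * (X d - X a)"
      using orient[OF that] E0 wedge_XY[of b a d a] by (metis less_imp_le mult_nonneg_nonneg)
    then show "m a b \<le> m a d" "m a b \<le> m b d" "m a d \<le> m b d"
      using p by (simp_all add: m_def divide_simps) (simp_all add: algebra_simps)
  qed
  \<comment> \<open>The right slope at t of the convex graph. Slopes of chords from t decrease as
    the other end approaches t, so the limit is an infimum.\<close>
  define M where "M = Inf (m t ` {t<..t+h})"
  have bdd: "bdd_below (m t ` {t<..t+h})"
    using m1(2)[of "t-h" t] \<open>0 < h\<close> by (intro bdd_belowI2[of _ "m (t-h) t"]) auto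
  have Mle: "M \<le> m t b" if "t < b" "b \<le> t + h" for b
    unfolding M_def using that bdd by (intro cInf_lower) auto
  \<comment> \<open>The displacement per unit of X along a line of slope M. The derivative keeps
    only its direction, because arclength forces unit speed.\<close>
  define D where "D = (\<i> * e - M *\<^sub>R e) /\<^sub>R E"
  have D0: "norm D > 0"
  proof -
    have "\<i> * e - M *\<^sub>R e = (\<i> - of_real M) * e" by (simp add: algebra_simps scaleR_conv_of_real)
    moreover have "\<i> - of_real M \<noteq> (0::complex)" by (simp add: complex_eq_iff)
    ultimately show ?thesis using e0 E0 by (simp add: D_def)
  qed
  have contc: "isCont c s" for s
  proof -
    have "1-lipschitz_on UNIV c"
    proof (rule lipschitz_onI)
      fix x y show "dist (c x) (c y) \<le> 1 * dist x y"
        using dist_le[of x y] dist_le[of y x] by (cases "x \<le> y") (auto simp: dist_commute dist_real_def)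
    qed simp
    then have "continuous_on UNIV c" by (rule lipschitz_on_continuous_on)
    then show ?thesis by (simp add: continuous_on_eq_continuous_at)
  qed
  have lim: "\<exists>a>t. \<forall>b. t < b \<and> b < a \<longrightarrow> norm ((c b - c t) /\<^sub>R (b - t) - D /\<^sub>R norm D) < \<eta>"
    if "\<eta> > 0" for \<eta>
  proof -
    \<comment> \<open>Below there are two errors of size at most \<delta> x / \<tau>, with x /
      \<tau> at most 2 / |D|. Together they are at most 4 \<delta> / |D|, which is less than
      \<eta>.\<close>
    define \<delta> where "\<delta> = norm D * min (1/2) (\<eta> / 5)"
    have \<delta>: "\<delta> > 0" "\<delta> \<le> norm D / 2" "5 * \<delta> \<le> norm D * \<eta>"
      using D0 \<open>\<eta> > 0\<close> by (auto simp: \<delta>_def min_def field_simps)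
    define \<epsilon> where "\<epsilon> = \<delta> * norm e"
    have "\<epsilon> > 0" using \<delta> e0 by (simp add: \<epsilon>_def)
    then have "\<exists>x\<in>m t ` {t<..t+h}. x < M + \<epsilon>"
      unfolding M_def using \<open>0 < h\<close> bdd by (subst cInf_less_iff[symmetric]) auto
    then obtain c0 where c0: "t < c0" "c0 \<le> t + h" "m t c0 < M + \<epsilon>" by auto
    have "isCont X t" "isCont Y t" unfolding X_def Y_def wedge_def
      using contc by (intro continuous_intros; simp)+
    then have "isCont (\<lambda>a. m a c0) t"
      unfolding m_def using Xpos[of t c0] c0 \<open>0 < h\<close> by (intro continuous_intros) auto
    then have "((\<lambda>a. m a c0) \<longlongrightarrow> m t c0) (at_right t)"
      by (simp add: isCont_def filterlim_at_split)
    from order_tendstoD(2)[OF this c0(3)]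
    obtain a1 where a1: "a1 > t" "\<And>a. t < a \<Longrightarrow> a < a1 \<Longrightarrow> m a c0 < M + \<epsilon>"
      unfolding eventually_at_right_field by blast
    define a0 where "a0 = min a1 c0"
    \<comment> \<open>Chords between any two nearby parameters to the right of t are controlled, not
      only those starting at t: bounding the length of the arc needs all of them.\<close>
    have slope: "M \<le> m a b" "m a b \<le> M + \<epsilon>" if "t \<le> a" "a < b" "b < a0" for a b
    proof -
      show "M \<le> m a b"
      proof (cases "a = t")
        case False
        then have "M \<le> m t a" using that a0_def c0 by (intro Mle) auto
        also have "m t a \<le> m a b" using that a0_def c0 False \<open>0 < h\<close> by (intro m1) auto
        finally show ?thesis .
      qed (use Mle that a0_def c0 in auto)
      have "m a b \<le> m a c0" using that a0_def c0 \<open>0 < h\<close> by (intro m1) auto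
      also have "\<dots> \<le> M + \<epsilon>" using a1(2)[of a] c0 that a0_def by (cases "a = t") auto
      finally show "m a b \<le> M + \<epsilon>" .
    qed
    have near: "norm (c b - c a - (X b - X a) *\<^sub>R D) \<le> \<delta> * (X b - X a)"
      if "t \<le> a" "a < b" "b < a0" for a b
    proof -
      have X: "X a < X b" using that a0_def c0 \<open>0 < h\<close> by (intro Xpos) auto
      have eq: "c b - c a - (X b - X a) *\<^sub>R D = - (((Y b - Y a) - M * (X b - X a)) *\<^sub>R (e /\<^sub>R E))"
        unfolding chord D_def by (simp add: algebra_simps)
      have "0 \<le> (Y b - Y a) - M * (X b - X a)" "(Y b - Y a) - M * (X b - X a) \<le> \<epsilon> * (X b - X a)"
        using slope[OF that] X by (simp_all add: m_def divide_simps algebra_simps)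
      then have "norm (c b - c a - (X b - X a) *\<^sub>R D) \<le> \<epsilon> * (X b - X a) * norm (e /\<^sub>R E)"
        unfolding eq norm_minus_cancel norm_scaleR[of "Y b - Y a - M * (X b - X a)"]
        by (intro mult_right_mono) auto
      also have "norm (e /\<^sub>R E) = 1 / norm e" using e0 by (simp add: E_def power2_eq_square divide_simps)
      also have "\<epsilon> * (X b - X a) * (1 / norm e) = \<delta> * (X b - X a)" using e0 by (simp add: \<epsilon>_def)
      finally show ?thesis .
    qed
    have "norm ((c b - c t) /\<^sub>R (b - t) - D /\<^sub>R norm D) < \<eta>" if b: "t < b" "b < a0" for b
    proof -
      define x where "x = X b - X t"
      define \<tau> where "\<tau> = b - t"
      have x0: "x > 0" unfolding x_def using Xpos[of t b] b a0_def c0 \<open>0 < h\<close> by auto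
      have \<tau>0: "\<tau> > 0" using b by (simp add: \<tau>_def)
      \<comment> \<open>Here arclength enters: the multiple \<open>norm D + \<delta>\<close> of X
        dominates every chord of the arc, hence its length b - t. The opposite comparison
        \<open>lo\<close> uses only the chord from t to b.\<close>
      have "b - t \<le> (norm D + \<delta>) * X b - (norm D + \<delta>) * X t"
      proof (rule len)
        fix u v assume uv: "t \<le> u" "u \<le> v" "v \<le> b"
        show "dist (c u) (c v) \<le> (norm D + \<delta>) * X v - (norm D + \<delta>) * X u"
        proof (cases "u = v")
          case False
          then have "u < v" using uv by simp
          then have X: "X u < X v" using Xpos[of u v] uv b a0_def c0 \<open>0 < h\<close> by auto
          have "norm (c v - c u) \<le> norm ((X v - X u) *\<^sub>R D) + \<delta> * (X v - X u)"
            using near[of u v] \<open>u < v\<close> uv b norm_triangle_ineq2[of "c v - c u" "(X v - X u) *\<^sub>R D"]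
            by linarith
          also have "norm ((X v - X u) *\<^sub>R D) = (X v - X u) * norm D" using X by simp
          finally show ?thesis by (simp add: dist_norm norm_minus_commute algebra_simps)
        qed simp
      qed (use b in auto)
      then have up: "\<tau> \<le> (norm D + \<delta>) * x" by (simp add: \<tau>_def x_def algebra_simps)
      have nv: "norm (c b - c t - x *\<^sub>R D) \<le> \<delta> * x" using near[of t b] b by (simp add: x_def)
      have "norm (x *\<^sub>R D) \<le> norm (c b - c t) + \<delta> * x"
        using nv norm_triangle_ineq3[of "c b - c t" "x *\<^sub>R D"] by linarith
      moreover have "norm (c b - c t) \<le> \<tau>"
        using dist_le[of t b] b by (simp add: \<tau>_def dist_norm norm_minus_commute)
      ultimately have lo: "(norm D - \<delta>) * x \<le> \<tau>" using x0 by (simp add: algebra_simps)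
      have "(c b - c t) /\<^sub>R \<tau> - D /\<^sub>R norm D
          = (c b - c t - x *\<^sub>R D) /\<^sub>R \<tau> + ((x *\<^sub>R D) /\<^sub>R \<tau> - D /\<^sub>R norm D)"
        by (simp only: scaleR_diff_right) simp
      then have "norm ((c b - c t) /\<^sub>R \<tau> - D /\<^sub>R norm D)
          \<le> norm ((c b - c t - x *\<^sub>R D) /\<^sub>R \<tau>) + norm ((x *\<^sub>R D) /\<^sub>R \<tau> - D /\<^sub>R norm D)"
        by (simp only: norm_triangle_ineq)
      also have "norm ((c b - c t - x *\<^sub>R D) /\<^sub>R \<tau>) \<le> \<delta> * x / \<tau>"
        using nv \<tau>0 by (simp add: divide_simps)
      also have "norm ((x *\<^sub>R D) /\<^sub>R \<tau> - D /\<^sub>R norm D) = \<bar>x / \<tau> - 1 / norm D\<bar> * norm D"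
      proof -
        have "(x *\<^sub>R D) /\<^sub>R \<tau> - D /\<^sub>R norm D = (x / \<tau> - 1 / norm D) *\<^sub>R D"
          by (simp add: divide_inverse mult.commute scaleR_diff_left)
        then show ?thesis by simp
      qed
      also have "\<dots> = \<bar>x * norm D - \<tau>\<bar> / \<tau>"
      proof -
        have "x / \<tau> - 1 / norm D = (x * norm D - \<tau>) / (\<tau> * norm D)"
          using \<tau>0 D0 by (simp add: field_simps)
        then show ?thesis using \<tau>0 D0 by (simp add: abs_mult)
      qed
      also have "\<dots> \<le> \<delta> * x / \<tau>"
        using up lo \<tau>0 by (intro divide_right_mono) (auto simp: abs_le_iff algebra_simps)
      finally have "norm ((c b - c t) /\<^sub>R \<tau> - D /\<^sub>R norm D) \<le> 2 * \<delta> * x / \<tau>" by simp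
      also have "2 * \<delta> * x / \<tau> < \<eta>"
      proof -
        have "norm D / 2 * x \<le> (norm D - \<delta>) * x" using \<delta> x0 by (intro mult_right_mono) auto
        then have t1: "norm D * x \<le> 2 * \<tau>" using lo by linarith
        have "4 * \<delta> * x < 5 * \<delta> * x" using \<delta> x0 by simp
        also have "\<dots> \<le> norm D * \<eta> * x" using \<delta> x0 by (intro mult_right_mono) auto
        also have "\<dots> = \<eta> * (norm D * x)" by simp
        also have "\<dots> \<le> \<eta> * (2 * \<tau>)" using t1 \<open>\<eta> > 0\<close> by (intro mult_left_mono) auto
        finally have "2 * \<delta> * x < \<eta> * \<tau>" by simp
        then show ?thesis using \<tau>0 by (simp add: divide_less_eq)
      qed
      finally show ?thesis by (simp add: \<tau>_def)
    qed
    then show ?thesis using a1 c0 a0_def by (intro exI[of _ a0]) auto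
  qed
  have "((\<lambda>b. (c b - c t) /\<^sub>R (b - t)) \<longlongrightarrow> D /\<^sub>R norm D) (at_right t)"
    unfolding tendsto_iff dist_norm eventually_at_right_field
    using lim by blast
  then have "(c has_vector_derivative D /\<^sub>R norm D) (at_right t)"
    by (simp add: has_vector_derivative_iff_slope)
  then show ?thesis using D0 by (intro exI[of _ "D /\<^sub>R norm D"]) simp
qed

section \<open>The arclength parametrization of a convex curve\<close>

lemma norm_cis_diff_le: "norm (cis a - cis b) \<le> \<bar>a - b\<bar>"
proof -
  have "(norm (cis a - cis b))\<^sup>2 = 2 - 2 * cos (a - b)"
    using sin_cos_squared_add[of a] sin_cos_squared_add[of b]
    unfolding cmod_power2 cos_diff by (simp add: power2_eq_square algebra_simps)
  also have "\<dots> = 4 * (sin ((a - b) / 2))\<^sup>2"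
  proof -
    have "cos (2 * ((a - b) / 2)) = 1 - 2 * (sin ((a - b) / 2))\<^sup>2" by (rule cos_double_sin)
    moreover have "2 * ((a - b) / 2) = a - b" by simp
    ultimately have "cos (a - b) = 1 - 2 * (sin ((a - b) / 2))\<^sup>2" by (simp only:)
    then show ?thesis by simp
  qed
  also have "\<dots> \<le> 4 * ((a - b) / 2)\<^sup>2"
    by (intro mult_left_mono abs_sin_x_le_abs_x abs_le_square_iff[THEN iffD1]) simp
  also have "\<dots> = \<bar>a - b\<bar>\<^sup>2" by (simp add: power2_eq_square)
  finally show ?thesis by (rule power2_le_imp_le) simp
qed

lemma winding_number_eq_log:
  assumes "continuous_on {0..1} q" and "\<And>t. t \<in> {0..1} \<Longrightarrow> g t = z + exp (q t)"
  shows "winding_number g z = (q 1 - q 0) / (2 * of_real pi * \<i>)"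
proof -
  have "winding_number g z = winding_number (\<lambda>t. g t - z) 0"
    by (rule winding_number_offset)
  also have "\<dots> = winding_number (exp \<circ> q) 0"
    by (rule winding_number_cong) (use assms(2) in \<open>auto simp: algebra_simps\<close>)
  also have "\<dots> = (q 1 - q 0) / (2 * of_real pi * \<i>)"
    using winding_number_compose_exp[of q] assms(1) by (simp add: path_def pathfinish_def pathstart_def)
  finally show ?thesis .
qed

text \<open>The nearer of two boundary points on a ray from p would arise by pulling the farther one
  towards the interior point p, and would therefore be interior.\<close>

lemma frontier_same_ray:
  fixes p :: complex
  assumes "convex \<Omega>" "closed \<Omega>" "p \<in> interior \<Omega>" "p + k *\<^sub>R v \<in> frontier \<Omega>" "p + l *\<^sub>R v \<in> frontier \<Omega>" "0 < k" "0 < l"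
  shows "k = l"
proof -
  have "False" if "0 < k" "k < l" "p + k *\<^sub>R v \<in> frontier \<Omega>" "p + l *\<^sub>R v \<in> frontier \<Omega>" for k l
  proof -
    have "p + l *\<^sub>R v \<in> \<Omega>" using that assms(2) frontier_subset_closed by blast
    then have "(p + l *\<^sub>R v) - (1 - k / l) *\<^sub>R ((p + l *\<^sub>R v) - p) \<in> interior \<Omega>"
      using that by (intro mem_interior_convex_shrink assms) auto
    also have "(p + l *\<^sub>R v) - (1 - k / l) *\<^sub>R ((p + l *\<^sub>R v) - p) = p + k *\<^sub>R v"
      using that by (simp add: algebra_simps)
    finally show False using that(3) by (simp add: frontier_def)
  qed
  from this[of k l] this[of l k] assms show ?thesis by (metis less_linear)
qed

section \<open>Polar coordinates about the centre of an inscribed disc\<close>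

locale convex_body =
  fixes \<Omega> :: "complex set" and p :: complex and r :: real
  assumes compact: "compact \<Omega>" and convex: "convex \<Omega>"
    and r_pos: "0 < r" and cball_subset: "cball p r \<subseteq> \<Omega>"
begin

lemma closed: "closed \<Omega>" using compact compact_imp_closed by blast

lemma frontier_subset: "frontier \<Omega> \<subseteq> \<Omega>" using closed frontier_subset_closed by blast

lemma interior_p: "p \<in> interior \<Omega>"
  unfolding mem_interior using r_pos subset_trans[OF ball_subset_cball cball_subset] by blast

lemma p_mem: "p \<in> \<Omega>" using interior_p interior_subset by blast

lemma frontier_dist: "r \<le> dist p z" if "z \<in> frontier \<Omega>"
proof (rule ccontr)
  assume "\<not> ?thesis"
  then have "z \<in> ball p r" by simp
  moreover have "ball p r \<subseteq> interior \<Omega>"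
    using cball_subset by (meson ball_subset_cball interior_maximal open_ball order_trans)
  ultimately show False using that by (auto simp: frontier_def)
qed

definition radius :: "real \<Rightarrow> real" where
  "radius \<phi> = Sup {s. 0 \<le> s \<and> p + s *\<^sub>R cis \<phi> \<in> \<Omega>}"

abbreviation diam :: real where "diam \<equiv> diameter \<Omega>"

lemma mem_diam: "norm (z - w) \<le> diam" if "z \<in> \<Omega>" "w \<in> \<Omega>"
  using diameter_bounded_bound[OF compact_imp_bounded[OF compact] that] by (simp add: dist_norm)

lemma r_le_diam: "r \<le> diam"
proof -
  have "p + of_real r \<in> \<Omega>" using cball_subset r_pos by (auto simp: dist_norm)
  from mem_diam[OF this p_mem] show ?thesis using r_pos by simp
qed

lemma radius:
  shows mem_radius: "0 \<le> s \<Longrightarrow> p + s *\<^sub>R cis \<phi> \<in> \<Omega> \<longleftrightarrow> s \<le> radius \<phi>"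
    and r_le_radius: "r \<le> radius \<phi>" and radius_le: "radius \<phi> \<le> diam"
    and radius_frontier: "p + radius \<phi> *\<^sub>R cis \<phi> \<in> frontier \<Omega>"
proof -
  let ?S = "{s. 0 \<le> s \<and> p + s *\<^sub>R cis \<phi> \<in> \<Omega>}"
  have le_d: "s \<le> diam" if "s \<in> ?S" for s
    using mem_diam[of "p + s *\<^sub>R cis \<phi>" p] that p_mem by simp
  have rS: "r \<in> ?S" using cball_subset r_pos by (auto simp: dist_norm)
  have bdd: "bdd_above ?S" using le_d by (auto simp: bdd_above_def)
  have "closed ?S"
  proof -
    have "?S = {0..} \<inter> (\<lambda>s. p + s *\<^sub>R cis \<phi>) -` \<Omega>" by auto
    then show ?thesis by (simp add: closed_Int continuous_closed_vimage closed)
  qed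
  then have RS: "radius \<phi> \<in> ?S"
    unfolding radius_def using rS bdd by (intro closed_contains_Sup) auto
  show "r \<le> radius \<phi>" unfolding radius_def using rS bdd by (rule cSup_upper)
  show "radius \<phi> \<le> diam" using le_d RS by blast
  have conv: "p + s *\<^sub>R cis \<phi> \<in> \<Omega>" if "0 \<le> s" "s \<le> radius \<phi>" for s
  proof (cases "radius \<phi> = 0")
    case True
    then show ?thesis using that p_mem by simp
  next
    case False
    then have "(1 - s / radius \<phi>) *\<^sub>R p + (s / radius \<phi>) *\<^sub>R (p + radius \<phi> *\<^sub>R cis \<phi>) \<in> \<Omega>"
      using RS p_mem that by (intro convexD[OF convex]) auto
    also have "(1 - s / radius \<phi>) *\<^sub>R p + (s / radius \<phi>) *\<^sub>R (p + radius \<phi> *\<^sub>R cis \<phi>) = p + s *\<^sub>R cis \<phi>"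
      using False by (simp add: algebra_simps)
    finally show ?thesis .
  qed
  show mem: "p + s *\<^sub>R cis \<phi> \<in> \<Omega> \<longleftrightarrow> s \<le> radius \<phi>" if "0 \<le> s" for s
  proof
    assume "p + s *\<^sub>R cis \<phi> \<in> \<Omega>"
    then show "s \<le> radius \<phi>" unfolding radius_def using bdd that by (intro cSup_upper) auto
  qed (use conv that in auto)
  have "p + radius \<phi> *\<^sub>R cis \<phi> \<notin> interior \<Omega>"
  proof
    assume "p + radius \<phi> *\<^sub>R cis \<phi> \<in> interior \<Omega>"
    then obtain e where e: "e > 0" "cball (p + radius \<phi> *\<^sub>R cis \<phi>) e \<subseteq> \<Omega>"
      using mem_interior_cball by blast
    have "p + (radius \<phi> + e) *\<^sub>R cis \<phi> \<in> cball (p + radius \<phi> *\<^sub>R cis \<phi>) e"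
      using e by (simp add: dist_norm algebra_simps)
    then have "p + (radius \<phi> + e) *\<^sub>R cis \<phi> \<in> \<Omega>" using e by blast
    then show False using mem[of "radius \<phi> + e"] RS e by auto
  qed
  then show "p + radius \<phi> *\<^sub>R cis \<phi> \<in> frontier \<Omega>"
    using RS closed by (simp add: frontier_def)
qed

lemma radius_pos: "0 < radius \<phi>" using r_pos r_le_radius less_le_trans by blast

lemma radius_unique:
  assumes "z \<in> frontier \<Omega>" "z = p + s *\<^sub>R cis \<phi>" "0 < s"
  shows "s = radius \<phi>"
  using frontier_same_ray[OF convex closed interior_p, of s "cis \<phi>" "radius \<phi>"] radius_frontier radius_pos
    assms by simp

text \<open>Subadditivity of the Minkowski gauge, which is \<open>1 / radius\<close> on unit vectors.\<close>

lemma inverse_radius_le: "1 / radius \<phi> \<le> 1 / radius \<psi> + norm (cis \<phi> - cis \<psi>) / r"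
proof (cases "cis \<phi> = cis \<psi>")
  case True
  then show ?thesis by (simp add: radius_def)
next
  case False
  define k where "k = norm (cis \<phi> - cis \<psi>)"
  define a where "a = 1 / radius \<psi>"
  define b where "b = k / r"
  have k: "k > 0" using False by (simp add: k_def)
  have ab: "a > 0" "b > 0" using radius_pos r_pos k by (simp_all add: a_def b_def)
  \<comment> \<open>Scaled by a and b, the displacements of the next two points from p add up to
    \<open>cis \<phi>\<close>. Their convex combination therefore shows that \<Omega> extends at
    least 1 / (a + b) from p in direction \<phi>.\<close>
  have q1: "p + radius \<psi> *\<^sub>R cis \<psi> \<in> \<Omega>" using radius_frontier frontier_subset by blast
  have q2: "p + (r / k) *\<^sub>R (cis \<phi> - cis \<psi>) \<in> \<Omega>"
    using cball_subset k r_pos by (auto simp: dist_norm k_def[symmetric] intro!: subsetD[OF cball_subset])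
  have "(a / (a + b)) *\<^sub>R (p + radius \<psi> *\<^sub>R cis \<psi>) + (b / (a + b)) *\<^sub>R (p + (r / k) *\<^sub>R (cis \<phi> - cis \<psi>)) \<in> \<Omega>"
    using ab by (intro convexD[OF convex q1 q2]) (auto simp: add_divide_distrib[symmetric])
  also have "(a / (a + b)) *\<^sub>R (p + radius \<psi> *\<^sub>R cis \<psi>) + (b / (a + b)) *\<^sub>R (p + (r / k) *\<^sub>R (cis \<phi> - cis \<psi>))
      = (a / (a + b) + b / (a + b)) *\<^sub>R p + ((a * radius \<psi>) / (a + b)) *\<^sub>R cis \<psi>
        + ((b * (r / k)) / (a + b)) *\<^sub>R (cis \<phi> - cis \<psi>)"
    by (simp add: algebra_simps)
  also have "\<dots> = p + (1 / (a + b)) *\<^sub>R cis \<phi>"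
  proof -
    have "a / (a + b) + b / (a + b) = 1" using ab by (simp add: add_divide_distrib[symmetric])
    moreover have "a * radius \<psi> = 1" using radius_pos[of \<psi>] by (simp add: a_def)
    moreover have "b * (r / k) = 1" using k r_pos by (simp add: b_def)
    ultimately show ?thesis by (simp only: scaleR_one scaleR_diff_right) simp
  qed
  finally have "1 / (a + b) \<le> radius \<phi>" using ab by (subst mem_radius[symmetric]) auto
  then have "1 \<le> radius \<phi> * (a + b)" using ab by (simp add: divide_le_eq)
  then show ?thesis using radius_pos[of \<phi>] by (simp add: a_def b_def k_def divide_le_eq mult.commute)
qed

lemma radius_lipschitz: "\<bar>radius \<phi> - radius \<psi>\<bar> \<le> diam\<^sup>2 / r * \<bar>\<phi> - \<psi>\<bar>"
proof -
  have "\<bar>1 / radius \<psi> - 1 / radius \<phi>\<bar> \<le> norm (cis \<phi> - cis \<psi>) / r"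
    using inverse_radius_le[of \<phi> \<psi>] inverse_radius_le[of \<psi> \<phi>]
    by (simp add: abs_le_iff norm_minus_commute)
  also have "\<dots> \<le> \<bar>\<phi> - \<psi>\<bar> / r" using norm_cis_diff_le r_pos by (intro divide_right_mono) auto
  finally have *: "\<bar>1 / radius \<psi> - 1 / radius \<phi>\<bar> \<le> \<bar>\<phi> - \<psi>\<bar> / r" .
  have "\<bar>radius \<phi> - radius \<psi>\<bar> = (radius \<phi> * radius \<psi>) * \<bar>1 / radius \<psi> - 1 / radius \<phi>\<bar>"
  proof -
    have "radius \<phi> - radius \<psi> = (radius \<phi> * radius \<psi>) * (1 / radius \<psi> - 1 / radius \<phi>)"
      using radius_pos[of \<phi>] radius_pos[of \<psi>] by (simp add: field_simps)
    then show ?thesis using radius_pos[of \<phi>] radius_pos[of \<psi>] by (simp add: abs_mult)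
  qed
  also have "\<dots> \<le> (diam * diam) * (\<bar>\<phi> - \<psi>\<bar> / r)"
    using * radius_pos[of \<phi>] radius_pos[of \<psi>] radius_le
    by (intro mult_mono) (auto intro: less_imp_le mult_nonneg_nonneg order_trans[OF less_imp_le radius_le])
  finally show ?thesis by (simp add: power2_eq_square)
qed

definition polar :: "real \<Rightarrow> complex" where "polar \<phi> = p + radius \<phi> *\<^sub>R cis \<phi>"

lemma polar_lipschitz: "dist (polar a) (polar b) \<le> (diam\<^sup>2 / r + diam) * \<bar>a - b\<bar>"
proof -
  have "polar a - polar b = (radius a - radius b) *\<^sub>R cis a + radius b *\<^sub>R (cis a - cis b)"
    by (simp add: polar_def algebra_simps)
  then have "norm (polar a - polar b) \<le> \<bar>radius a - radius b\<bar> + radius b * norm (cis a - cis b)"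
    using norm_triangle_ineq[of "(radius a - radius b) *\<^sub>R cis a" "radius b *\<^sub>R (cis a - cis b)"]
      radius_pos[of b] by simp
  also have "\<dots> \<le> diam\<^sup>2 / r * \<bar>a - b\<bar> + diam * \<bar>a - b\<bar>"
    using radius_lipschitz norm_cis_diff_le radius_le radius_pos[of b]
    by (intro add_mono mult_mono) (auto intro: less_imp_le order_trans)
  finally show ?thesis by (simp add: dist_norm algebra_simps)
qed

lemma polar_periodic: "polar (x + 2 * pi) = polar x"
  by (simp add: polar_def radius_def cis.ctr)

lemma polar_frontier: "polar x \<in> frontier \<Omega>"
  using radius_frontier by (simp add: polar_def)

lemma polar_eqD: "polar a = polar b \<Longrightarrow> cis a = cis b"
proof -
  assume "polar a = polar b"
  then have eq: "radius a *\<^sub>R cis a = radius b *\<^sub>R cis b" by (simp add: polar_def)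
  then have "norm (radius a *\<^sub>R cis a) = norm (radius b *\<^sub>R cis b)" by simp
  then have "radius a = radius b" using radius_pos[of a] radius_pos[of b] by simp
  then show ?thesis using eq radius_pos[of b] by simp
qed

lemma frontier_polar:
  assumes "z \<in> frontier \<Omega>" obtains x where "0 \<le> x" "x < 2 * pi" "z = polar x"
proof -
  have z: "z \<noteq> p" using interior_p assms by (auto simp: frontier_def)
  define x where "x = Arg2pi (z - p)"
  have "z = p + norm (z - p) *\<^sub>R cis x"
    using Arg2pi_eq[of "z - p"] by (simp add: x_def cis_conv_exp scaleR_conv_of_real algebra_simps)
  moreover from radius_unique[OF assms this] z have "norm (z - p) = radius x" by simp
  ultimately have "z = polar x" by (simp only: polar_def)
  moreover have "0 \<le> x" "x < 2 * pi" using Arg2pi[of "z - p"] by (simp_all add: x_def)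
  ultimately show ?thesis using that by blast
qed

section \<open>Arclength along the polar curve and its inverse function\<close>

definition len :: "real \<Rightarrow> real \<Rightarrow> real" where "len a b = enn2real (curve_length polar a b)"

definition lipconst :: real where "lipconst = diam\<^sup>2 / r + diam"

lemma lipconst_nonneg: "0 \<le> lipconst"
  using r_pos r_le_diam by (simp add: lipconst_def)

lemma curve_length_polar_le: "a \<le> b \<Longrightarrow> curve_length polar a b \<le> ennreal (lipconst * b - lipconst * a)"
proof (rule curve_length_leI)
  fix x y :: real assume "x \<le> y"
  then show "dist (polar x) (polar y) \<le> lipconst * y - lipconst * x"
    using polar_lipschitz[of x y] unfolding lipconst_def[symmetric] by (simp add: algebra_simps)
qed

lemma curve_length_polar: "curve_length polar a b = ennreal (len a b)" if "a \<le> b"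
  unfolding len_def
  using order_le_less_trans[OF curve_length_polar_le[OF that] ennreal_less_top] by simp

lemma len_nonneg: "0 \<le> len a b" by (simp add: len_def)

lemma len_le: "len a b \<le> lipconst * (b - a)" if "a \<le> b"
proof -
  have "ennreal (len a b) \<le> ennreal (lipconst * (b - a))"
    using curve_length_polar_le[OF that] curve_length_polar[OF that] by (simp add: algebra_simps)
  then show ?thesis using that lipconst_nonneg by (simp add: ennreal_le_iff)
qed

lemma len_add: "len a c = len a b + len b c" if "a \<le> b" "b \<le> c"
proof -
  have "ennreal (len a c) = ennreal (len a b) + ennreal (len b c)"
    using curve_length_add[OF that, of polar] that by (simp add: curve_length_polar)
  also have "\<dots> = ennreal (len a b + len b c)"
    by (rule ennreal_plus[symmetric]) (rule len_nonneg)+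
  finally show ?thesis by (subst (asm) ennreal_inj) (auto intro: len_nonneg add_nonneg_nonneg)
qed

lemma len_pos: "0 < len a b" if "a < b"
proof -
  \<comment> \<open>After a full turn the curve is back at its start, so positivity is read off from
    a chord spanning at most half a turn.\<close>
  define b' where "b' = min b (a + pi)"
  have b': "a < b'" "b' \<le> b" "b' - a \<le> pi" using that by (auto simp: b'_def)
  have "polar a \<noteq> polar b'"
  proof
    assume "polar a = polar b'"
    then have "cis a = cis b'" by (rule polar_eqD)
    then have "cis (b' - a) = 1" by (simp add: cis_divide[symmetric])
    then have "cos (b' - a) = 1" by (simp add: complex_eq_iff)
    then have "cos (b' - a) = cos 0" by simp
    then show False using b' cos_inj_pi[of "b' - a" 0] by simp
  qed
  then have "0 < dist (polar a) (polar b')" by simp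
  also have "\<dots> \<le> len a b'"
    using dist_le_curve_length[of a b' polar] b' by (simp add: curve_length_polar ennreal_le_iff len_nonneg)
  also have "\<dots> \<le> len a b" using len_add[of a b' b] b' len_nonneg[of b' b] by simp
  finally show ?thesis .
qed

lemma len_periodic: "len (a + 2 * pi) (b + 2 * pi) = len a b"
proof -
  have "curve_length polar (a + 2 * pi) (b + 2 * pi) \<le> curve_length polar a b"
    by (rule curve_length_reparam_le[where \<psi>="\<lambda>x. x - 2 * pi"])
       (use polar_periodic[of "_ - 2 * pi"] in \<open>auto simp: mono_on_def\<close>)
  moreover have "curve_length polar a b \<le> curve_length polar (a + 2 * pi) (b + 2 * pi)"
    by (rule curve_length_reparam_le[where \<psi>="\<lambda>x. x + 2 * pi"])
       (use polar_periodic in \<open>auto simp: mono_on_def\<close>)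
  ultimately show ?thesis unfolding len_def by (metis antisym)
qed

text \<open>Signed so that it becomes an increasing bijection of the whole line; its inverse then
  gives a periodic parametrization defined for every real parameter.\<close>

definition arclen :: "real \<Rightarrow> real" where "arclen x = (if 0 \<le> x then len 0 x else - len x 0)"

lemma arclen_diff: "arclen b - arclen a = len a b" if "a \<le> b"
  using that len_add[of 0 a b] len_add[of a 0 b] len_add[of a b 0] by (auto simp: arclen_def)

lemma arclen_strict_mono: "strict_mono arclen"
  using arclen_diff len_pos by (intro strict_monoI) (metis diff_gt_0_iff_gt less_imp_le)

lemma arclen_continuous: "continuous_on UNIV arclen"
proof (rule lipschitz_on_continuous_on)
  show "lipconst-lipschitz_on UNIV arclen"
  proof (rule lipschitz_onI)
    have "dist (arclen x) (arclen y) \<le> lipconst * dist x y" if "x \<le> y" for x y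
      using arclen_diff[OF that] len_le[OF that] len_nonneg[of x y] that by (simp add: dist_real_def)
    then show "dist (arclen x) (arclen y) \<le> lipconst * dist x y" for x y
      by (metis dist_commute linear)
  qed (rule lipconst_nonneg)
qed

lemma arclen_0: "arclen 0 = 0"
  using arclen_diff[of 0 0] len_le[of 0 0] len_nonneg[of 0 0] by (simp add: arclen_def)

lemma arclen_periodic: "arclen (x + 2 * pi) = arclen x + arclen (2 * pi)"
proof (cases "0 \<le> x")
  case True
  then show ?thesis using arclen_diff[of "2 * pi" "x + 2 * pi"] arclen_diff[of 0 x] len_periodic[of 0 x]
    by (simp add: arclen_0)
next
  case False
  then show ?thesis using arclen_diff[of "x + 2 * pi" "2 * pi"] arclen_diff[of x 0] len_periodic[of x 0]
    by (simp add: arclen_0)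
qed

lemma arclen_2pi_pos: "0 < arclen (2 * pi)"
  using arclen_strict_mono arclen_0 by (metis pi_gt_zero strict_monoD zero_less_mult_iff zero_less_numeral)

lemma arclen_surj: "surj arclen"
proof -
  have n: "arclen (2 * pi * real n) = real n * arclen (2 * pi)" for n
  proof (induction n)
    case (Suc n)
    have "2 * pi * real (Suc n) = 2 * pi * real n + 2 * pi" by (simp add: algebra_simps)
    then show ?case using Suc by (simp only: arclen_periodic) (simp add: algebra_simps)
  qed (simp add: arclen_0)
  have m: "arclen (- (2 * pi * real n)) = - (real n * arclen (2 * pi))" for n
  proof (induction n)
    case (Suc n)
    have "arclen (- (2 * pi * real (Suc n)) + 2 * pi) = arclen (- (2 * pi * real (Suc n))) + arclen (2 * pi)"
      by (rule arclen_periodic)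
    moreover have "- (2 * pi * real (Suc n)) + 2 * pi = - (2 * pi * real n)" by (simp add: algebra_simps)
    ultimately show ?case using Suc by (simp add: algebra_simps)
  qed (simp add: arclen_0)
  have "\<exists>x. arclen x = y" for y
  proof -
    obtain k where k: "\<bar>y\<bar> < real k * arclen (2 * pi)"
      using reals_Archimedean3[OF arclen_2pi_pos] by blast
    have "\<exists>x\<ge>- (2 * pi * real k). x \<le> 2 * pi * real k \<and> arclen x = y"
    proof (rule IVT')
      show "arclen (- (2 * pi * real k)) \<le> y" "y \<le> arclen (2 * pi * real k)"
        using k unfolding n m by auto
      show "continuous_on {- (2 * pi * real k)..2 * pi * real k} arclen"
        using arclen_continuous continuous_on_subset by blast
      show "- (2 * pi * real k) \<le> 2 * pi * real k"
        using mult_nonneg_nonneg[of "2 * pi" "real k"] by simp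
    qed
    then show ?thesis by blast
  qed
  then show ?thesis by (metis surjI)
qed

definition angle :: "real \<Rightarrow> real" where "angle = inv arclen"

lemma arclen_angle [simp]: "arclen (angle t) = t"
  unfolding angle_def by (rule surj_f_inv_f[OF arclen_surj])

lemma angle_arclen [simp]: "angle (arclen x) = x"
  unfolding angle_def by (rule inv_f_f) (use arclen_strict_mono strict_mono_imp_inj_on in blast)

lemma angle_strict_mono: "strict_mono angle"
  by (rule strict_monoI) (metis arclen_angle arclen_strict_mono strict_mono_less)

lemma angle_continuous: "continuous_on UNIV angle"
proof (rule continuous_onI_mono)
  have "range angle = UNIV" by (metis angle_arclen surjI)
  then show "open (range angle)" by simp
qed (use angle_strict_mono strict_mono_less_eq in blast)

text \<open>The polar curve, reparametrized by the inverse of its arclength. The winding number is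
  computed at p, where a logarithm of the curve is explicit, and carried to the other interior
  points because the connected interior misses the curve.\<close>

lemma ccw_arclength_param_exists: "\<exists>L \<gamma>. ccw_arclength_param \<Omega> L \<gamma>"
proof (intro exI)
  define L where "L = arclen (2 * pi)"
  define \<gamma> where "\<gamma> t = polar (angle t)" for t
  have L: "L > 0" using arclen_2pi_pos by (simp add: L_def)
  have angle_shift: "angle (t + L) = angle t + 2 * pi" for t
    using arclen_periodic[of "angle t"] angle_arclen[of "angle t + 2 * pi"] by (simp add: L_def)
  have angle0: "angle 0 = 0" using angle_arclen[of 0] by (simp add: arclen_0)
  have angleL: "angle L = 2 * pi" using angle_shift[of 0] angle0 by simp
  have contp: "continuous_on UNIV polar"
    by (rule lipschitz_on_continuous_on[of lipconst], rule lipschitz_onI)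
       (use polar_lipschitz lipconst_nonneg in \<open>auto simp: lipconst_def dist_real_def\<close>)
  have contL: "continuous_on {0..1} (\<lambda>u. angle (L * u))"
    by (rule continuous_on_compose2[OF angle_continuous]) (auto intro!: continuous_intros)
  have path: "path (\<lambda>u. \<gamma> (L * u))"
    unfolding path_def \<gamma>_def by (rule continuous_on_compose2[OF contp contL]) auto
  have range: "0 \<le> angle (L * u)" "angle (L * u) \<le> 2 * pi" "u < 1 \<Longrightarrow> angle (L * u) < 2 * pi"
    if "0 \<le> u" "u \<le> 1" for u
  proof -
    have "0 \<le> L * u" "L * u \<le> L" using that L by (auto simp: mult_le_cancel_left1)
    then show "0 \<le> angle (L * u)" "angle (L * u) \<le> 2 * pi"
      using strict_mono_less_eq[OF angle_strict_mono, of 0 "L * u"]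
        strict_mono_less_eq[OF angle_strict_mono, of "L * u" L] angle0 angleL by auto
    assume "u < 1"
    then show "angle (L * u) < 2 * pi"
      using strict_mono_less[OF angle_strict_mono, of "L * u" L] L angleL by simp
  qed
  have cis_inj: "x = y \<or> (x = 0 \<and> y = 2 * pi) \<or> (x = 2 * pi \<and> y = 0)"
    if xy: "0 \<le> x" "x \<le> 2 * pi" "0 \<le> y" "y \<le> 2 * pi" "cis x = cis y" for x y
  proof -
    have "sin x = sin y \<and> cos x = cos y" using xy(5) by (simp add: complex_eq_iff)
    then obtain n :: int where n: "x = y + 2 * pi * n" using sin_cos_eq_iff by blast
    have "- (2 * pi) \<le> 2 * pi * n" "2 * pi * n \<le> 2 * pi" using n xy by linarith+
    then have "2 * pi * (-1) \<le> 2 * pi * real_of_int n" "2 * pi * real_of_int n \<le> 2 * pi * 1" by simp_all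
    then have "-1 \<le> real_of_int n" "real_of_int n \<le> 1"
      using pi_gt_zero by (simp_all only: mult_le_cancel_left_pos zero_less_mult_iff zero_less_numeral simp_thms)
    then have "-1 \<le> n" "n \<le> 1" by linarith+
    then consider "n = -1" | "n = 0" | "n = 1" by linarith
    then show ?thesis by cases (use n xy in auto)
  qed
  have wnp: "winding_number (\<lambda>u. \<gamma> (L * u)) p = 1"
  proof -
    \<comment> \<open>A continuous logarithm of the curve seen from p: the real part returns to its
      initial value and the imaginary part gains 2 pi.\<close>
    define q where "q u = of_real (ln (radius (angle (L * u)))) + \<i> * of_real (angle (L * u))" for u
    have "continuous_on UNIV radius"
      by (rule lipschitz_on_continuous_on[of "diam\<^sup>2 / r"], rule lipschitz_onI)
         (use radius_lipschitz r_pos in \<open>auto simp: dist_real_def\<close>)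
    then have "continuous_on {0..1} (\<lambda>u. radius (angle (L * u)))"
      by (rule continuous_on_compose2[OF _ contL]) auto
    then have "continuous_on {0..1} q"
      unfolding q_def using radius_pos contL
      by (intro continuous_intros) (auto simp: less_imp_neq[symmetric] dest: less_imp_neq)
    moreover have "\<gamma> (L * u) = p + exp (q u)" for u
      using radius_pos[of "angle (L * u)"]
      by (simp add: \<gamma>_def polar_def q_def exp_add exp_of_real cis_conv_exp scaleR_conv_of_real)
    ultimately have "winding_number (\<lambda>u. \<gamma> (L * u)) p = (q 1 - q 0) / (2 * of_real pi * \<i>)"
      by (intro winding_number_eq_log) auto
    also have "q 1 - q 0 = \<i> * (2 * of_real pi)"
    proof -
      have "radius (2 * pi) = radius 0" by (simp add: radius_def cis.ctr)
      then show ?thesis by (simp add: q_def angle0 angleL)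
    qed
    finally show ?thesis by simp
  qed
  have img: "path_image (\<lambda>u. \<gamma> (L * u)) = frontier \<Omega>"
  proof
    show "frontier \<Omega> \<subseteq> path_image (\<lambda>u. \<gamma> (L * u))"
    proof
      fix z assume "z \<in> frontier \<Omega>"
      then obtain x where x: "0 \<le> x" "x < 2 * pi" "z = polar x" by (rule frontier_polar)
      have "arclen 0 \<le> arclen x" "arclen x \<le> L"
        unfolding L_def using x strict_mono_less_eq[OF arclen_strict_mono] by auto
      then have "arclen x / L \<in> {0..1}" using L by (simp add: arclen_0)
      moreover have "z = \<gamma> (L * (arclen x / L))" using L x by (simp add: \<gamma>_def)
      ultimately show "z \<in> path_image (\<lambda>u. \<gamma> (L * u))" unfolding path_image_def by blast
    qed
  qed (auto simp: path_image_def \<gamma>_def polar_frontier)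
  have closed_path: "pathfinish (\<lambda>u. \<gamma> (L * u)) = pathstart (\<lambda>u. \<gamma> (L * u))"
    using polar_periodic[of 0] by (simp add: pathfinish_def pathstart_def \<gamma>_def angle0 angleL)
  show "ccw_arclength_param \<Omega> L \<gamma>"
    unfolding ccw_arclength_param_def
  proof (intro conjI allI ballI impI)
    show "0 < L" by (fact L)
    show "\<gamma> (t + L) = \<gamma> t" for t by (simp add: \<gamma>_def angle_shift polar_periodic)
    show "simple_path (\<lambda>u. \<gamma> (L * u))"
      unfolding simple_path_def loop_free_def
    proof (intro conjI path ballI impI)
      fix u v :: real assume uv: "u \<in> {0..1}" "v \<in> {0..1}" "\<gamma> (L * u) = \<gamma> (L * v)"
      then have "cis (angle (L * u)) = cis (angle (L * v))" unfolding \<gamma>_def by (intro polar_eqD)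
      with uv range have "angle (L * u) = angle (L * v) \<or> (angle (L * u) = 0 \<and> angle (L * v) = 2 * pi)
          \<or> (angle (L * u) = 2 * pi \<and> angle (L * v) = 0)"
        by (intro cis_inj) auto
      then have "L * u = L * v \<or> L * u = 0 \<and> L * v = L \<or> L * u = L \<and> L * v = 0"
        using angle0 angleL by (metis arclen_angle)
      then show "u = v \<or> u = 0 \<and> v = 1 \<or> u = 1 \<and> v = 0" using L by auto
    qed
    show "path_image (\<lambda>u. \<gamma> (L * u)) = frontier \<Omega>" by (fact img)
    show "winding_number (\<lambda>u. \<gamma> (L * u)) z = 1" if "z \<in> interior \<Omega>" for z
      unfolding wnp[symmetric]
      by (rule winding_number_eq[OF path closed_path that interior_p])
         (use convex img in \<open>auto simp: convex_connected frontier_def\<close>)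
    show "curve_length \<gamma> a b = ennreal (b - a)" if "a \<le> b" for a b
    proof -
      have "curve_length \<gamma> a b \<le> curve_length polar (angle a) (angle b)"
        by (rule curve_length_reparam_le[where \<psi>=angle])
           (use strict_mono_less_eq[OF angle_strict_mono] in \<open>auto simp: mono_on_def \<gamma>_def\<close>)
      moreover have "curve_length polar (angle a) (angle b) \<le> curve_length \<gamma> a b"
      proof (rule curve_length_reparam_le[where \<psi>=arclen])
        show "mono_on {angle a..angle b} arclen"
          using strict_mono_less_eq[OF arclen_strict_mono] by (auto simp: mono_on_def)
        show "arclen ` {angle a..angle b} \<subseteq> {a..b}"
          using strict_mono_less_eq[OF arclen_strict_mono, of "angle a"]
            strict_mono_less_eq[OF arclen_strict_mono, of _ "angle b"] by auto
      qed (simp add: \<gamma>_def)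
      moreover have "angle a \<le> angle b" using that strict_mono_less_eq[OF angle_strict_mono] by blast
      moreover from this have "len (angle a) (angle b) = b - a" using arclen_diff by fastforce
      ultimately show ?thesis by (metis antisym curve_length_polar)
    qed
  qed
qed

end

section \<open>One-sided tangents\<close>

text \<open>To leave the first quarter turn, \<phi> would have to pass the value \<phi> a + pi / 2,
  where the cosine vanishes.\<close>

lemma sin_pos_if_cos_pos:
  fixes \<phi> :: "real \<Rightarrow> real"
  assumes cont: "continuous_on {a..b} \<phi>" and mono: "\<phi> a < \<phi> b" and ab: "a \<le> b"
    and pos: "\<And>s. \<lbrakk>a \<le> s; s \<le> b\<rbrakk> \<Longrightarrow> 0 < cos (\<phi> s - \<phi> a)"
  shows "0 < sin (\<phi> b - \<phi> a)"
proof -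
  have "\<phi> b < \<phi> a + pi / 2"
  proof (rule ccontr)
    assume "\<not> ?thesis"
    then have "\<exists>s\<ge>a. s \<le> b \<and> \<phi> s = \<phi> a + pi / 2"
      using cont ab pi_gt_zero by (intro IVT') auto
    then obtain s where s: "a \<le> s" "s \<le> b" "\<phi> s = \<phi> a + pi / 2" by auto
    then show False using pos[OF s(1,2)] by simp
  qed
  then show ?thesis using mono pi_gt_zero by (intro sin_gt_zero) linarith+
qed

lemma wedge_cis: "wedge (a *\<^sub>R cis x) (b *\<^sub>R cis y) = a * b * sin (y - x)"
  by (simp add: wedge_def sin_diff algebra_simps)

text \<open>An arbitrary parametrization meeting the specification rather than the polar one just
  built: \<open>boundary_param\<close> is a \<open>SOME\<close>, so only the specification is
  available for it.\<close>

locale ccw_convex_body = convex_body \<Omega> p r for \<Omega> p r +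
  fixes L :: real and \<gamma> :: "real \<Rightarrow> complex"
  assumes param: "ccw_arclength_param \<Omega> L \<gamma>"
begin

lemma L_pos: "0 < L"
  and \<gamma>_shift: "\<gamma> (t + L) = \<gamma> t"
  and simple: "simple_path (\<lambda>u. \<gamma> (L * u))"
  and image: "path_image (\<lambda>u. \<gamma> (L * u)) = frontier \<Omega>"
  and winding: "z \<in> interior \<Omega> \<Longrightarrow> winding_number (\<lambda>u. \<gamma> (L * u)) z = 1"
  and length: "a \<le> b \<Longrightarrow> curve_length \<gamma> a b = ennreal (b - a)"
  using param by (auto simp: ccw_arclength_param_def)

sublocale periodic_fun_simple \<gamma> L
  by unfold_locales (rule \<gamma>_shift)

lemma \<gamma>_lipschitz: "norm (\<gamma> a - \<gamma> b) \<le> \<bar>a - b\<bar>"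
proof -
  have "dist (\<gamma> a) (\<gamma> b) \<le> b - a" if "a \<le> b" for a b
    using dist_le_curve_length[OF that, of \<gamma>] length[OF that] that by (simp add: ennreal_le_iff)
  from this[of a b] this[of b a] show ?thesis
    by (cases "a \<le> b") (auto simp: dist_norm norm_minus_commute)
qed

lemma \<gamma>_continuous: "continuous_on S \<gamma>"
proof (rule continuous_on_subset[OF _ subset_UNIV])
  show "continuous_on UNIV \<gamma>"
    by (rule lipschitz_on_continuous_on[of 1], rule lipschitz_onI)
       (use \<gamma>_lipschitz in \<open>auto simp: dist_norm\<close>)
qed

lemma period_representative: obtains n :: int where "a \<le> t + of_int n * L" "t + of_int n * L < a + L"
proof -
  define n where "n = - \<lfloor>(t - a) / L\<rfloor>"
  have "of_int \<lfloor>(t - a) / L\<rfloor> * L \<le> t - a" "t - a < (of_int \<lfloor>(t - a) / L\<rfloor> + 1) * L"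
    using L_pos by (simp_all add: pos_le_divide_eq[symmetric] pos_divide_less_eq[symmetric])
  then show ?thesis using that[of n] by (simp add: n_def algebra_simps)
qed

lemma \<gamma>_frontier: "\<gamma> t \<in> frontier \<Omega>"
proof -
  obtain n :: int where n: "0 \<le> t + of_int n * L" "t + of_int n * L < 0 + L" by (rule period_representative)
  have "\<gamma> t = \<gamma> (L * ((t + of_int n * L) / L))" using L_pos by (simp add: plus_of_int)
  also have "\<dots> \<in> path_image (\<lambda>u. \<gamma> (L * u))"
    unfolding path_image_def using n L_pos by (intro imageI) auto
  finally show ?thesis by (simp add: image)
qed

lemma \<gamma>_mem: "\<gamma> t \<in> \<Omega>" using \<gamma>_frontier frontier_subset by blast

lemma frontier_\<gamma>: assumes "z \<in> frontier \<Omega>" obtains t where "a \<le> t" "t < a + L" "\<gamma> t = z"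
proof -
  obtain u where "z = \<gamma> (L * u)" using assms unfolding image[symmetric] path_image_def by blast
  moreover obtain n :: int where "a \<le> L * u + of_int n * L" "L * u + of_int n * L < a + L" by (rule period_representative)
  ultimately show ?thesis using that plus_of_int by metis
qed

lemma \<gamma>_inj_0: "s = t" if "\<gamma> s = \<gamma> t" "0 \<le> s" "s < L" "0 \<le> t" "t < L"
proof -
  have "s / L \<in> {0..1}" "t / L \<in> {0..1}" "s / L \<noteq> 1" "t / L \<noteq> 1" using that L_pos by auto
  moreover have "\<gamma> (L * (s / L)) = \<gamma> (L * (t / L))" using that L_pos by simp
  ultimately have "s / L = t / L"
    using simple unfolding simple_path_def loop_free_def by blast
  then show ?thesis using L_pos by simp
qed

lemma \<gamma>_eqD: assumes "\<gamma> s = \<gamma> t" obtains n :: int where "s = t + of_int n * L"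
proof -
  obtain m :: int where m: "0 \<le> s + of_int m * L" "s + of_int m * L < 0 + L" by (rule period_representative)
  obtain n :: int where n: "0 \<le> t + of_int n * L" "t + of_int n * L < 0 + L" by (rule period_representative)
  have "s + of_int m * L = t + of_int n * L"
    by (rule \<gamma>_inj_0) (use m n assms in \<open>simp_all add: plus_of_int\<close>)
  then show ?thesis using that[of "n - m"] by (simp add: algebra_simps)
qed

lemma \<gamma>_neq: "\<gamma> s \<noteq> \<gamma> t" if "t < s" "s < t + L"
proof
  assume "\<gamma> s = \<gamma> t"
  then obtain n :: int where n: "s = t + of_int n * L" by (rule \<gamma>_eqD)
  then have "0 < of_int n * L" "of_int n * L < 1 * L" using that by auto
  then have "0 < (of_int n :: real)" "of_int n < (1::real)"
    using L_pos by (auto simp: zero_less_mult_iff mult_less_cancel_right)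
  then have "0 < n" "n < 1" by simp_all
  then show False by linarith
qed

text \<open>Every ray from q meets the boundary once, so the lifted angle is injective and, being
  continuous, strictly monotone. The winding number 1 makes it increasing and adds 2 pi over the
  base period; over any other period the gain is the same, being a continuous function with values
  in multiples of 2 pi.\<close>

lemma polar_lift:
  assumes q: "q \<in> interior \<Omega>"
  obtains \<phi> :: "real \<Rightarrow> real" where "strict_mono \<phi>" "continuous_on UNIV \<phi>"
    "\<And>t. \<gamma> t - q = norm (\<gamma> t - q) *\<^sub>R cis (\<phi> t)" "\<And>t. \<phi> (t + L) = \<phi> t + 2 * pi"
proof -
  have ne: "\<gamma> t - q \<noteq> 0" for t using \<gamma>_frontier[of t] q by (auto simp: frontier_def)
  obtain g where g: "continuous_on UNIV g" "\<And>t. \<gamma> t - q = exp (g t)"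
    by (rule continuous_logarithm_on_contractible[of UNIV "\<lambda>t. \<gamma> t - q"])
       (use ne in \<open>auto intro!: continuous_intros \<gamma>_continuous\<close>)
  define \<phi> where "\<phi> t = Im (g t)" for t
  have lift: "\<gamma> t - q = norm (\<gamma> t - q) *\<^sub>R cis (\<phi> t)" for t
    unfolding g(2) \<phi>_def by (subst exp_eq_polar) (simp add: scaleR_conv_of_real)
  have cont: "continuous_on UNIV \<phi>" unfolding \<phi>_def by (intro continuous_intros g)
  have "continuous_on {0..1} (\<lambda>u. g (L * u))"
    by (rule continuous_on_compose2[OF g(1)]) (auto intro!: continuous_intros)
  moreover have "\<gamma> (L * u) = q + exp (g (L * u))" for u by (simp flip: g(2))
  ultimately have "(g (L * 1) - g (L * 0)) / (2 * of_real pi * \<i>) = 1"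
    using winding_number_eq_log[of "\<lambda>u. g (L * u)" "\<lambda>u. \<gamma> (L * u)" q] winding[OF q] by simp
  then have "g L - g 0 = 2 * of_real pi * \<i>" by (simp add: divide_eq_eq)
  then have "Im (g L - g 0) = Im (2 * of_real pi * \<i>)" by simp
  then have \<phi>L: "\<phi> L = \<phi> 0 + 2 * pi" by (simp add: \<phi>_def)
  define \<delta> where "\<delta> t = \<phi> (t + L) - \<phi> t" for t
  have int: "\<exists>n::int. \<delta> t = 2 * pi * n" for t
  proof -
    have "cis (\<phi> (t + L)) = cis (\<phi> t)"
      using lift[of "t + L"] lift[of t] ne[of t] \<gamma>_shift[of t] by (metis scaleR_cancel_left norm_eq_zero)
    then have "sin (\<phi> (t + L)) = sin (\<phi> t) \<and> cos (\<phi> (t + L)) = cos (\<phi> t)"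
      by (simp add: complex_eq_iff)
    then obtain n :: int where "\<phi> (t + L) = \<phi> t + 2 * pi * n" using sin_cos_eq_iff by blast
    then show ?thesis by (auto simp: \<delta>_def)
  qed
  have "\<delta> constant_on UNIV"
  proof (rule continuous_discrete_range_constant)
    show "continuous_on UNIV \<delta>" unfolding \<delta>_def
      by (intro continuous_intros cont continuous_on_compose2[OF cont]) auto
    show "\<exists>e>0. \<forall>y. y \<in> UNIV \<and> \<delta> y \<noteq> \<delta> x \<longrightarrow> e \<le> norm (\<delta> y - \<delta> x)" for x
    proof (intro exI[of _ "2 * pi"] conjI allI impI)
      fix y assume y: "y \<in> UNIV \<and> \<delta> y \<noteq> \<delta> x"
      obtain m n :: int where mn: "\<delta> y = 2 * pi * m" "\<delta> x = 2 * pi * n" using int by blast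
      then have "m \<noteq> n" using y by auto
      then have "1 \<le> \<bar>real_of_int (m - n)\<bar>" by linarith
      then have "2 * pi * 1 \<le> 2 * pi * \<bar>real_of_int (m - n)\<bar>" by (intro mult_left_mono) auto
      also have "\<dots> = norm (\<delta> y - \<delta> x)"
        unfolding mn by (simp add: abs_mult right_diff_distrib[symmetric])
      finally show "2 * pi \<le> norm (\<delta> y - \<delta> x)" by simp
    qed simp
  qed simp
  then have "\<delta> t = \<delta> 0" for t by (metis constant_on_def UNIV_I)
  then have shift: "\<phi> (t + L) = \<phi> t + 2 * pi" for t
    using \<phi>L by (simp add: \<delta>_def) (metis add_diff_cancel_left' diff_add_cancel add.commute)
  have shift_n: "\<phi> (t + of_int n * L) = \<phi> t + 2 * pi * of_int n" for t and n :: int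
  proof -
    \<comment> \<open>Removing the linear drift leaves a periodic function, so shifts by n periods
      follow from the periodicity lemmas.\<close>
    interpret \<psi>: periodic_fun_simple "\<lambda>t. \<phi> t - 2 * pi / L * t" L
      by unfold_locales (use L_pos in \<open>simp add: shift field_simps\<close>)
    have "2 * pi / L * (t + of_int n * L) = 2 * pi / L * t + 2 * pi * of_int n"
      using L_pos by (simp add: field_simps)
    then show ?thesis using \<psi>.plus_of_int[of t n] by simp
  qed
  have "inj \<phi>"
  proof (rule injI)
    fix s t assume st: "\<phi> s = \<phi> t"
    have "norm (\<gamma> s - q) = norm (\<gamma> t - q)"
    proof (rule frontier_same_ray[OF convex closed q])
      show "q + norm (\<gamma> s - q) *\<^sub>R cis (\<phi> t) \<in> frontier \<Omega>"
        using lift[of s] \<gamma>_frontier[of s] st by (simp add: algebra_simps)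
      show "q + norm (\<gamma> t - q) *\<^sub>R cis (\<phi> t) \<in> frontier \<Omega>"
        using lift[of t] \<gamma>_frontier[of t] by (simp add: algebra_simps)
    qed (use ne in auto)
    then have "\<gamma> s = \<gamma> t" using lift[of s] lift[of t] st by (metis diff_add_cancel)
    then obtain n :: int where n: "s = t + of_int n * L" by (rule \<gamma>_eqD)
    then have "n = 0" using shift_n[of t n] st by simp
    then show "s = t" using n by simp
  qed
  then have "strict_mono_on UNIV \<phi> \<or> strict_antimono_on UNIV \<phi>"
    using injective_eq_monotone_map[OF is_interval_univ cont] by simp
  moreover have "\<not> strict_antimono_on UNIV \<phi>"
  proof
    assume "strict_antimono_on UNIV \<phi>"
    then have "\<phi> L < \<phi> 0" using L_pos by (auto simp: monotone_on_def)
    then show False using \<phi>L pi_gt_zero by simp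
  qed
  ultimately have "strict_mono \<phi>" by blast
  then show ?thesis using that cont lift shift by blast
qed

text \<open>From a to b the curve moves by less than \<rho>, the least possible distance from q, so
  its direction from q turns by less than a right angle; it turns to the left because the lifted
  angle increases. The centre q is left free for the sake of \<open>arc_forward\<close>.\<close>

lemma wedge_forward:
  assumes ball: "cball q \<rho> \<subseteq> \<Omega>" "0 < \<rho>" and ab: "a < b" "b - a < \<rho>"
  shows "0 < wedge (\<gamma> a - q) (\<gamma> b - q)"
proof -
  interpret q: convex_body \<Omega> q \<rho> using compact convex ball by unfold_locales
  obtain \<phi> where \<phi>: "strict_mono \<phi>" "continuous_on UNIV \<phi>"
    "\<And>t. \<gamma> t - q = norm (\<gamma> t - q) *\<^sub>R cis (\<phi> t)" "\<And>t. \<phi> (t + L) = \<phi> t + 2 * pi"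
    using polar_lift[OF q.interior_p] by metis
  have n: "\<rho> \<le> norm (\<gamma> t - q)" for t
    using q.frontier_dist[OF \<gamma>_frontier] by (simp add: dist_norm norm_minus_commute)
  have pos: "0 < norm (\<gamma> t - q)" for t using n[of t] ball(2) by linarith
  have "0 < cos (\<phi> s - \<phi> a)" if s: "a \<le> s" "s \<le> b" for s
  proof -
    have "norm (\<gamma> s - \<gamma> a) < norm (\<gamma> a - q)" using \<gamma>_lipschitz[of s a] s ab n[of a] by linarith
    then have "norm (\<gamma> a - q) * norm (\<gamma> s - \<gamma> a) < norm (\<gamma> a - q) * norm (\<gamma> a - q)"
      using pos by (intro mult_strict_left_mono) auto
    moreover have "- (norm (\<gamma> a - q) * norm (\<gamma> s - \<gamma> a)) \<le> (\<gamma> a - q) \<bullet> (\<gamma> s - \<gamma> a)"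
      using Cauchy_Schwarz_ineq2[of "\<gamma> a - q" "\<gamma> s - \<gamma> a"] by linarith
    moreover have "(\<gamma> a - q) \<bullet> (\<gamma> s - q) = (\<gamma> a - q) \<bullet> (\<gamma> s - \<gamma> a) + norm (\<gamma> a - q) * norm (\<gamma> a - q)"
    proof -
      have "\<gamma> s - q = (\<gamma> s - \<gamma> a) + (\<gamma> a - q)" by simp
      then show ?thesis by (simp only: inner_add_right dot_square_norm power2_eq_square)
    qed
    ultimately have "0 < (\<gamma> a - q) \<bullet> (\<gamma> s - q)" by linarith
    also have "(\<gamma> a - q) \<bullet> (\<gamma> s - q) = norm (\<gamma> a - q) * norm (\<gamma> s - q) * cos (\<phi> s - \<phi> a)"
      by (subst \<phi>(3)[of a], subst \<phi>(3)[of s])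
         (simp add: inner_complex_def cos_diff algebra_simps del: norm_scaleR)
    finally show ?thesis using zero_less_mult_pos[OF _ mult_pos_pos[OF pos[of a] pos[of s]]] by blast
  qed
  then have "0 < sin (\<phi> b - \<phi> a)"
    using ab \<phi> by (intro sin_pos_if_cos_pos[of a b \<phi>])
      (auto intro: continuous_on_subset simp: strict_mono_less)
  moreover have "wedge (\<gamma> a - q) (\<gamma> b - q) = norm (\<gamma> a - q) * norm (\<gamma> b - q) * sin (\<phi> b - \<phi> a)"
    by (subst \<phi>(3)[of a], subst \<phi>(3)[of b]) (rule wedge_cis)
  ultimately show ?thesis using pos by simp
qed

text \<open>
  If the sum were negative, \<open>wedge P Q *\<^sub>R R + wedge Q R *\<^sub>R P = - wedge R P *\<^sub>R Q\<close> would place \<open>p + Q\<close>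
  strictly inside \<open>\<Omega>\<close>.
\<close>

lemma wedge_cyclic_sum_nonneg:
  assumes P: "p + P \<in> \<Omega>" "p + R \<in> \<Omega>" "p + Q \<in> frontier \<Omega>"
    and w: "0 \<le> wedge P Q" "0 \<le> wedge Q R"
  shows "0 \<le> wedge P Q + wedge Q R + wedge R P"
proof (rule ccontr)
  assume neg: "\<not> ?thesis"
  define c where "c = - wedge R P"
  have c: "c > 0" using neg w by (simp add: c_def)
  define l where "l = (wedge P Q + wedge Q R) / c"
  have "wedge P Q + wedge Q R < c" using neg by (simp add: c_def)
  then have l: "0 \<le> l" "l < 1" using w c by (simp_all add: l_def)
  have id: "c *\<^sub>R Q = wedge Q R *\<^sub>R P + wedge P Q *\<^sub>R R"
    by (rule complex_eqI) (simp_all add: c_def wedge_def algebra_simps)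
  obtain z where z: "z \<in> \<Omega>" "l *\<^sub>R (z - p) = Q"
  proof (cases "l = 0")
    case True
    then have "wedge Q R = 0" "wedge P Q = 0" using w c by (simp_all add: l_def)
    then have "Q = 0" using id c by simp
    then show ?thesis using that[of "p + P"] P True by simp
  next
    case False
    define a where "a = wedge Q R / (c * l)"
    define b where "b = wedge P Q / (c * l)"
    have cl: "c * l = wedge P Q + wedge Q R" using c by (simp add: l_def)
    have "c * l > 0" using c l False by simp
    then have ab: "0 \<le> a" "0 \<le> b" "a + b = 1"
      using w cl unfolding a_def b_def add_divide_distrib[symmetric] by (simp_all add: add.commute)
    have "a *\<^sub>R (p + P) + b *\<^sub>R (p + R) \<in> \<Omega>" using ab P by (intro convexD[OF convex]) auto
    moreover have "a *\<^sub>R (p + P) + b *\<^sub>R (p + R) - p = a *\<^sub>R P + b *\<^sub>R R"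
    proof -
      have "a *\<^sub>R (p + P) + b *\<^sub>R (p + R) = (a + b) *\<^sub>R p + (a *\<^sub>R P + b *\<^sub>R R)" by (simp add: algebra_simps)
      then show ?thesis using ab by simp
    qed
    moreover have "l *\<^sub>R (a *\<^sub>R P + b *\<^sub>R R) = (c *\<^sub>R Q) /\<^sub>R c"
      unfolding id a_def b_def using False c by (simp add: scaleR_add_right field_simps)
    ultimately show ?thesis using that[of "a *\<^sub>R (p + P) + b *\<^sub>R (p + R)"] c by simp
  qed
  have "z - (1 - l) *\<^sub>R (z - p) \<in> interior \<Omega>"
    using l z by (intro mem_interior_convex_shrink[OF convex interior_p]) auto
  also have "z - (1 - l) *\<^sub>R (z - p) = p + l *\<^sub>R (z - p)" by (simp add: algebra_simps)
  finally show False using P(3) z by (simp add: frontier_def)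
qed

text \<open>Twice the signed area of the triangle is the cyclic sum of wedges seen from p. At most
  one of the three angular gaps exceeds pi, and a cyclic renaming makes the other two the
  nonnegative terms required by \<open>wedge_cyclic_sum_nonneg\<close>.\<close>

lemma orientation:
  assumes "t < s" "s < u" "u < t + L"
  shows "0 \<le> wedge (\<gamma> s - \<gamma> t) (\<gamma> u - \<gamma> t)"
proof -
  obtain \<phi> where \<phi>: "strict_mono \<phi>" "continuous_on UNIV \<phi>"
    "\<And>t. \<gamma> t - p = norm (\<gamma> t - p) *\<^sub>R cis (\<phi> t)" "\<And>t. \<phi> (t + L) = \<phi> t + 2 * pi"
    using polar_lift[OF interior_p] by metis
  define P Q R where "P = \<gamma> t - p" and "Q = \<gamma> s - p" and "R = \<gamma> u - p"
  have w: "wedge (\<gamma> x - p) (\<gamma> y - p) = norm (\<gamma> x - p) * norm (\<gamma> y - p) * sin (\<phi> y - \<phi> x)" for x y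
    by (subst \<phi>(3)[of x], subst \<phi>(3)[of y]) (rule wedge_cis)
  have nonneg: "0 \<le> wedge (\<gamma> x - p) (\<gamma> y - p)" if "0 \<le> \<phi> y - \<phi> x" "\<phi> y - \<phi> x \<le> pi" for x y
    unfolding w using that by (intro mult_nonneg_nonneg sin_ge_zero) auto
  have g: "\<phi> t < \<phi> s" "\<phi> s < \<phi> u" "\<phi> u < \<phi> t + 2 * pi"
    using assms \<phi>(1) \<phi>(4)[of t] strict_mono_less by metis+
  have PQ: "0 \<le> wedge P Q" if "\<phi> s - \<phi> t \<le> pi" unfolding P_def Q_def using g that by (intro nonneg) auto
  have QR: "0 \<le> wedge Q R" if "\<phi> u - \<phi> s \<le> pi" unfolding R_def Q_def using g that by (intro nonneg) auto
  have RP: "0 \<le> wedge R P" if "\<phi> t + 2 * pi - \<phi> u \<le> pi"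
    using nonneg[of "t + L" u] g that by (simp add: \<phi>(4) R_def P_def \<gamma>_shift)
  have m: "p + P \<in> \<Omega>" "p + Q \<in> \<Omega>" "p + R \<in> \<Omega>" "p + P \<in> frontier \<Omega>" "p + Q \<in> frontier \<Omega>" "p + R \<in> frontier \<Omega>"
    using \<gamma>_mem \<gamma>_frontier by (simp_all add: P_def Q_def R_def)
  have "0 \<le> wedge P Q + wedge Q R + wedge R P"
  proof -
    consider "\<phi> s - \<phi> t > pi" | "\<phi> u - \<phi> s > pi" | "\<phi> s - \<phi> t \<le> pi" "\<phi> u - \<phi> s \<le> pi" by linarith
    then show ?thesis
    proof cases
      case 1
      then have "0 \<le> wedge Q R" "0 \<le> wedge R P" using QR RP g by auto
      from wedge_cyclic_sum_nonneg[OF m(2) m(1) m(6) this] show ?thesis by simp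
    next
      case 2
      then have "0 \<le> wedge R P" "0 \<le> wedge P Q" using PQ RP g by auto
      from wedge_cyclic_sum_nonneg[OF m(3) m(2) m(4) this] show ?thesis by simp
    next
      case 3
      from wedge_cyclic_sum_nonneg[OF m(1) m(3) m(5) PQ[OF 3(1)] QR[OF 3(2)]] show ?thesis .
    qed
  qed
  also have "wedge P Q + wedge Q R + wedge R P = wedge (\<gamma> s - \<gamma> t) (\<gamma> u - \<gamma> t)"
    by (simp add: P_def Q_def R_def wedge_def algebra_simps)
  finally show ?thesis .
qed

text \<open>A window of this radius around t has length at most r / 4 and at most L / 4. The first
  keeps a disc of radius r / 2 inside \<Omega> after its centre moves by r / 8, as
  \<open>arc_forward\<close> needs; the second keeps the window within one period.\<close>

definition arc_radius :: real where "arc_radius = min (r / 8) (L / 8)"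

lemma arc_radius: "0 < arc_radius" "arc_radius \<le> r / 8" "arc_radius \<le> L / 8"
  using r_pos L_pos by (auto simp: arc_radius_def)

lemma arc_forward:
  assumes "t - arc_radius \<le> a" "a < b" "b \<le> t + arc_radius"
  shows "0 < wedge (\<gamma> t - p) (\<gamma> b - \<gamma> a)"
proof -
  \<comment> \<open>Moving the centre along with the curve makes \<gamma> a - q equal to \<gamma> t
    - p, so one fixed direction serves all chords near t.\<close>
  define q where "q = p + (\<gamma> a - \<gamma> t)"
  have "norm (\<gamma> a - \<gamma> t) \<le> r / 8" using \<gamma>_lipschitz[of a t] arc_radius assms by linarith
  then have "cball q (r / 2) \<subseteq> cball p r"
    using r_pos by (simp add: cball_subset_cball_iff q_def dist_norm)
  then have "0 < wedge (\<gamma> a - q) (\<gamma> b - q)"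
    using assms arc_radius r_pos cball_subset by (intro wedge_forward[of q "r / 2"]) auto
  also have "\<dots> = wedge (\<gamma> t - p) (\<gamma> b - \<gamma> a)" by (simp add: q_def wedge_def algebra_simps)
  finally show ?thesis .
qed

text \<open>Being 1-Lipschitz only says that the speed is at most 1. This is the converse side of
  the arclength condition: whatever dominates all chords dominates the elapsed parameter.\<close>

lemma rectifiable_le:
  assumes "a \<le> b" and "\<And>x y. \<lbrakk>a \<le> x; x \<le> y; y \<le> b\<rbrakk> \<Longrightarrow> dist (\<gamma> x) (\<gamma> y) \<le> k y - k x"
  shows "b - a \<le> k b - k a"
proof -
  have "ennreal (b - a) \<le> ennreal (k b - k a)"
    using curve_length_leI[of a b \<gamma> k] assms length by simp
  moreover have "0 \<le> k b - k a" using assms(2)[of a b] assms(1) zero_le_dist[of "\<gamma> a" "\<gamma> b"] by linarith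
  ultimately show ?thesis by (simp add: ennreal_le_iff)
qed

lemma right_derivative_exists: "\<exists>d. norm d = 1 \<and> (\<gamma> has_vector_derivative d) (at_right t)"
proof (rule convex_arc_right_derivative[OF arc_radius(1) arc_forward[of t]])
  show "0 \<le> wedge (\<gamma> b - \<gamma> a) (\<gamma> d - \<gamma> a)"
    if "t - arc_radius \<le> a" "a < b" "b < d" "d \<le> t + arc_radius" for a b d
    using that arc_radius L_pos by (intro orientation) auto
  show "dist (\<gamma> a) (\<gamma> b) \<le> b - a" if "a \<le> b" for a b
    using \<gamma>_lipschitz[of a b] that by (simp add: dist_norm)
qed (auto intro: rectifiable_le)

text \<open>Running backwards reverses the orientation and complex conjugation restores it, so the
  conjugate of the reversed curve satisfies the hypotheses of
  \<open>convex_arc_right_derivative\<close>.\<close>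

lemma left_derivative_exists: "\<exists>d. norm d = 1 \<and> (\<gamma> has_vector_derivative d) (at_left t)"
proof -
  define c where "c s = cnj (\<gamma> (- s))" for s
  have "\<exists>d. norm d = 1 \<and> (c has_vector_derivative d) (at_right (- t))"
  proof (rule convex_arc_right_derivative[OF arc_radius(1), where e="cnj (\<gamma> t - p)"])
    fix a b assume ab: "- t - arc_radius \<le> a" "a < b" "b \<le> - t + arc_radius"
    have "wedge (cnj (\<gamma> t - p)) (c b - c a) = wedge (\<gamma> t - p) (\<gamma> (- a) - \<gamma> (- b))"
      by (simp add: c_def wedge_def algebra_simps)
    then show "0 < wedge (cnj (\<gamma> t - p)) (c b - c a)" using arc_forward[of t "- b" "- a"] ab by simp
  next
    fix a b d assume ab: "- t - arc_radius \<le> a" "a < b" "b < d" "d \<le> - t + arc_radius"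
    have "wedge (c b - c a) (c d - c a) = wedge (\<gamma> (- b) - \<gamma> (- d)) (\<gamma> (- a) - \<gamma> (- d))"
      by (simp add: c_def wedge_def algebra_simps)
    also have "0 \<le> \<dots>" using ab arc_radius L_pos by (intro orientation) auto
    finally show "0 \<le> wedge (c b - c a) (c d - c a)" .
  next
    fix a b :: real assume "a \<le> b"
    then show "dist (c a) (c b) \<le> b - a"
      using \<gamma>_lipschitz[of "- a" "- b"] by (simp add: dist_norm c_def flip: complex_cnj_diff)
  next
    fix a b :: real and k :: "real \<Rightarrow> real"
    assume ab: "a \<le> b" and k: "\<And>x y. \<lbrakk>a \<le> x; x \<le> y; y \<le> b\<rbrakk> \<Longrightarrow> dist (c x) (c y) \<le> k y - k x"
    have "- a - - b \<le> - k (- (- a)) - (- k (- (- b)))"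
    proof (rule rectifiable_le[where k="\<lambda>x. - k (- x)"])
      fix x y assume xy: "- b \<le> x" "x \<le> y" "y \<le> - a"
      have "dist (\<gamma> x) (\<gamma> y) = dist (c (- y)) (c (- x))"
        by (simp add: c_def dist_norm norm_minus_commute flip: complex_cnj_diff)
      also have "\<dots> \<le> k (- x) - k (- y)" using k[of "- y" "- x"] xy by simp
      finally show "dist (\<gamma> x) (\<gamma> y) \<le> - k (- y) - - k (- x)" by simp
    qed (use ab in simp)
    then show "b - a \<le> k b - k a" by simp
  qed
  then obtain d where d: "norm d = 1" "(c has_vector_derivative d) (at_right (- t))" by blast
  have "((\<lambda>y. (c y - c (- t)) /\<^sub>R (y - - t)) \<longlongrightarrow> d) (at_right (- t))"
    using d(2) by (simp add: has_vector_derivative_iff_slope)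
  then have "((\<lambda>y. (c (- y) - c (- t)) /\<^sub>R (- y - - t)) \<longlongrightarrow> d) (at_left t)"
    by (simp add: filterlim_at_left_to_right add.commute)
  then have "((\<lambda>y. - cnj ((c (- y) - c (- t)) /\<^sub>R (- y - - t))) \<longlongrightarrow> - cnj d) (at_left t)"
    by (intro tendsto_intros)
  moreover have "- cnj ((c (- y) - c (- t)) /\<^sub>R (- y - - t)) = (\<gamma> y - \<gamma> t) /\<^sub>R (y - t)" for y
  proof -
    have "inverse (- y - - t) = - inverse (y - t)" by (simp flip: inverse_minus_eq)
    then show ?thesis by (simp add: c_def)
  qed
  ultimately have "(\<gamma> has_vector_derivative - cnj d) (at_left t)"
    by (simp add: has_vector_derivative_iff_slope)
  then show ?thesis using d(1) by (intro exI[of _ "- cnj d"]) simp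
qed

section \<open>Tangents, supporting lines and their distance from the centre\<close>

definition rt :: "real \<Rightarrow> complex" where "rt t = vector_derivative \<gamma> (at_right t)"
definition lt :: "real \<Rightarrow> complex" where "lt t = vector_derivative \<gamma> (at_left t)"

lemma rt: "(\<gamma> has_vector_derivative rt t) (at_right t)" "norm (rt t) = 1"
  using right_derivative_exists[of t] unfolding rt_def
  by (auto simp: vector_derivative_within[OF trivial_limit_at_right_real])

lemma lt: "(\<gamma> has_vector_derivative lt t) (at_left t)" "norm (lt t) = 1"
  using left_derivative_exists[of t] unfolding lt_def
  by (auto simp: vector_derivative_within[OF trivial_limit_at_left_real])

lemma countable_neq: "countable {t. lt t \<noteq> rt t}"
  by (rule countable_one_sided_derivative_neq[OF lt(1) rt(1)])

lemma rt_slope: "((\<lambda>y. (\<gamma> y - \<gamma> t) /\<^sub>R (y - t)) \<longlongrightarrow> rt t) (at_right t)"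
  using rt(1) by (simp add: has_vector_derivative_iff_slope)

lemma lt_slope: "((\<lambda>y. (\<gamma> y - \<gamma> t) /\<^sub>R (y - t)) \<longlongrightarrow> lt t) (at_left t)"
  using lt(1) by (simp add: has_vector_derivative_iff_slope)

text \<open>\<Omega> is the convex hull of its frontier, so a half-plane contains \<Omega> as soon
  as it contains the curve.\<close>

lemma frontier_imp_halfplane:
  assumes "\<And>s. 0 \<le> wedge d (\<gamma> s - \<gamma> t)" "z \<in> \<Omega>"
  shows "0 \<le> wedge d (z - \<gamma> t)"
proof -
  have "z \<in> convex hull (frontier \<Omega>)" using Krein_Milman_frontier[OF convex compact] assms(2) by blast
  also have "\<dots> \<subseteq> {z. 0 \<le> wedge d (z - \<gamma> t)}"
  proof (rule hull_minimal)
    show "frontier \<Omega> \<subseteq> {z. 0 \<le> wedge d (z - \<gamma> t)}"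
    proof
      fix w assume "w \<in> frontier \<Omega>"
      then obtain s where "\<gamma> s = w" by (rule frontier_\<gamma>)
      then show "w \<in> {z. 0 \<le> wedge d (z - \<gamma> t)}" using assms(1)[of s] by simp
    qed
    show "convex {z. 0 \<le> wedge d (z - \<gamma> t)}"
    proof (rule convexI)
      fix x y u v assume *: "x \<in> {z. 0 \<le> wedge d (z - \<gamma> t)}" "y \<in> {z. 0 \<le> wedge d (z - \<gamma> t)}"
        "0 \<le> u" "0 \<le> v" "u + v = (1::real)"
      have v: "v = 1 - u" using * by simp
      have "wedge d (u *\<^sub>R x + v *\<^sub>R y - \<gamma> t) = u * wedge d (x - \<gamma> t) + v * wedge d (y - \<gamma> t)"
        unfolding v by (simp add: wedge_def algebra_simps)
      then show "u *\<^sub>R x + v *\<^sub>R y \<in> {z. 0 \<le> wedge d (z - \<gamma> t)}" using * by simp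
    qed
  qed
  finally show ?thesis by simp
qed

lemma tendsto_wedge [tendsto_intros]:
  "(f \<longlongrightarrow> a) F \<Longrightarrow> (g \<longlongrightarrow> b) F \<Longrightarrow> ((\<lambda>x. wedge (f x) (g x)) \<longlongrightarrow> wedge a b) F"
  unfolding wedge_def by (intro tendsto_intros)

text \<open>By \<open>orientation\<close>, every later point lies to the left of a short chord
  leaving \<gamma> t; the limit of these chords gives the supporting line.\<close>

lemma rt_support: "z \<in> \<Omega> \<Longrightarrow> 0 \<le> wedge (rt t) (z - \<gamma> t)"
proof (rule frontier_imp_halfplane)
  fix s
  obtain u where u: "t \<le> u" "u < t + L" "\<gamma> u = \<gamma> s" by (rule frontier_\<gamma>[OF \<gamma>_frontier])
  show "0 \<le> wedge (rt t) (\<gamma> s - \<gamma> t)"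
  proof (cases "u = t")
    case False
    have "((\<lambda>y. wedge ((\<gamma> y - \<gamma> t) /\<^sub>R (y - t)) (\<gamma> s - \<gamma> t)) \<longlongrightarrow> wedge (rt t) (\<gamma> s - \<gamma> t)) (at_right t)"
      by (intro tendsto_intros rt_slope)
    then show ?thesis
    proof (rule tendsto_lowerbound)
      have "0 \<le> wedge ((\<gamma> y - \<gamma> t) /\<^sub>R (y - t)) (\<gamma> s - \<gamma> t)" if "t < y" "y < u" for y
      proof -
        have "0 \<le> wedge (\<gamma> y - \<gamma> t) (\<gamma> u - \<gamma> t) / (y - t)"
          using that u by (intro divide_nonneg_pos orientation) auto
        also have "\<dots> = wedge ((\<gamma> y - \<gamma> t) /\<^sub>R (y - t)) (\<gamma> s - \<gamma> t)"
          by (simp add: wedge_def u(3) divide_inverse algebra_simps)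
        finally show ?thesis .
      qed
      then show "\<forall>\<^sub>F y in at_right t. 0 \<le> wedge ((\<gamma> y - \<gamma> t) /\<^sub>R (y - t)) (\<gamma> s - \<gamma> t)"
        unfolding eventually_at_right_field using u False by (intro exI[of _ u]) auto
    qed simp
  qed (use u in \<open>simp add: wedge_def\<close>)
qed

lemma lt_support: "z \<in> \<Omega> \<Longrightarrow> 0 \<le> wedge (lt t) (z - \<gamma> t)"
proof (rule frontier_imp_halfplane)
  fix s
  obtain u where u: "t - L \<le> u" "u < t - L + L" "\<gamma> u = \<gamma> s" by (rule frontier_\<gamma>[OF \<gamma>_frontier])
  show "0 \<le> wedge (lt t) (\<gamma> s - \<gamma> t)"
  proof (cases "u = t - L")
    case False
    have "((\<lambda>y. wedge ((\<gamma> y - \<gamma> t) /\<^sub>R (y - t)) (\<gamma> s - \<gamma> t)) \<longlongrightarrow> wedge (lt t) (\<gamma> s - \<gamma> t)) (at_left t)"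
      by (intro tendsto_intros lt_slope)
    then show ?thesis
    proof (rule tendsto_lowerbound)
      have "0 \<le> wedge ((\<gamma> y - \<gamma> t) /\<^sub>R (y - t)) (\<gamma> s - \<gamma> t)" if "u < y" "y < t" for y
      proof -
        have "0 \<le> wedge (\<gamma> y - \<gamma> u) (\<gamma> t - \<gamma> u) / (t - y)"
          using that u False by (intro divide_nonneg_pos orientation) auto
        also have "\<dots> = wedge ((\<gamma> y - \<gamma> t) /\<^sub>R (y - t)) (\<gamma> s - \<gamma> t)"
          using that by (simp add: wedge_def u(3)[symmetric] divide_simps) (simp add: algebra_simps)
        finally show ?thesis .
      qed
      then show "\<forall>\<^sub>F y in at_left t. 0 \<le> wedge ((\<gamma> y - \<gamma> t) /\<^sub>R (y - t)) (\<gamma> s - \<gamma> t)"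
        unfolding eventually_at_left_field using u False by (intro exI[of _ u]) auto
    qed simp
  next
    case True
    then have "\<gamma> s = \<gamma> t" using u(3) \<gamma>_shift[of "t - L"] by simp
    then show ?thesis by (simp add: wedge_def)
  qed
qed

text \<open>A supporting line cannot cut the inscribed disc, so p stays at distance at least r from
  it. The test point is the point of the disc nearest to the line.\<close>

lemma support_gap:
  assumes "norm d = 1" "\<And>z. z \<in> \<Omega> \<Longrightarrow> 0 \<le> wedge d (z - w)"
  shows "r \<le> wedge d (p - w)"
proof -
  have "p - r *\<^sub>R (\<i> * d) \<in> \<Omega>"
    using r_pos assms(1) by (intro subsetD[OF cball_subset]) (simp add: dist_norm norm_mult)
  then have "0 \<le> wedge d (p - r *\<^sub>R (\<i> * d) - w)" by (rule assms(2))
  also have "\<dots> = wedge d (p - w) - r * (norm d)\<^sup>2"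
    unfolding cmod_power2 by (simp add: wedge_def power2_eq_square algebra_simps)
  finally show ?thesis using assms(1) by simp
qed

lemma rt_gap: "r \<le> wedge (rt t) (p - \<gamma> t)"
  by (rule support_gap[OF rt(2) rt_support])

lemma lt_gap: "r \<le> wedge (lt t) (p - \<gamma> t)"
  by (rule support_gap[OF lt(2) lt_support])

lemma wedge_lt_rt: "0 \<le> wedge (lt t) (rt t)"
proof (rule tendsto_lowerbound)
  show "((\<lambda>y. wedge (lt t) ((\<gamma> y - \<gamma> t) /\<^sub>R (y - t))) \<longlongrightarrow> wedge (lt t) (rt t)) (at_right t)"
    by (intro tendsto_intros rt_slope)
  have "0 \<le> wedge (lt t) ((\<gamma> y - \<gamma> t) /\<^sub>R (y - t))" if "t < y" for y
  proof -
    have "0 \<le> wedge (lt t) (\<gamma> y - \<gamma> t) / (y - t)"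
      using that lt_support[OF \<gamma>_mem] by (intro divide_nonneg_pos) auto
    also have "\<dots> = wedge (lt t) ((\<gamma> y - \<gamma> t) /\<^sub>R (y - t))"
      by (simp add: wedge_def divide_inverse algebra_simps)
    finally show ?thesis .
  qed
  then show "\<forall>\<^sub>F y in at_right t. 0 \<le> wedge (lt t) ((\<gamma> y - \<gamma> t) /\<^sub>R (y - t))"
    unfolding eventually_at_right_field by (intro exI[of _ "t + 1"]) auto
qed simp

end

section \<open>The angle subtended by an arc\<close>

context ccw_convex_body
begin

lemma deriv_shift:
  assumes "(\<gamma> has_vector_derivative d) (at t within S)"
  shows "(\<gamma> has_vector_derivative d) (at (t + L) within (\<lambda>s. s + L) ` S)"
proof -
  have im: "(\<lambda>s. s - L) ` (\<lambda>s. s + L) ` S = S" by (simp add: image_image)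
  have "((\<lambda>s. s - L) has_vector_derivative 1) (at (t + L) within (\<lambda>s. s + L) ` S)"
    by (auto intro!: derivative_eq_intros)
  moreover have "(\<gamma> has_vector_derivative d) (at ((t + L) - L) within (\<lambda>s. s - L) ` (\<lambda>s. s + L) ` S)"
    unfolding im using assms by simp
  ultimately have "((\<gamma> \<circ> (\<lambda>s. s - L)) has_vector_derivative 1 *\<^sub>R d) (at (t + L) within (\<lambda>s. s + L) ` S)"
    by (rule vector_diff_chain_within)
  moreover have "\<gamma> \<circ> (\<lambda>s. s - L) = \<gamma>" using \<gamma>_shift[of "_ - L"] by (auto simp: fun_eq_iff)
  ultimately show ?thesis by simp
qed

lemma rt_shift: "rt (t + L) = rt t"
proof -
  have "(\<lambda>s. s + L) ` {t<..} = {t + L<..}" by (auto intro: image_eqI[of _ _ "_ - L"])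
  then have "(\<gamma> has_vector_derivative rt t) (at_right (t + L))" using deriv_shift[OF rt(1)[of t]] by simp
  then show ?thesis
    unfolding rt_def[of "t + L"] by (rule vector_derivative_within[OF trivial_limit_at_right_real])
qed

lemma lt_shift: "lt (t + L) = lt t"
proof -
  have "(\<lambda>s. s + L) ` {..<t} = {..<t + L}" by (auto intro: image_eqI[of _ _ "_ - L"])
  then have "(\<gamma> has_vector_derivative lt t) (at_left (t + L))" using deriv_shift[OF lt(1)[of t]] by simp
  then show ?thesis
    unfolding lt_def[of "t + L"] by (rule vector_derivative_within[OF trivial_limit_at_left_real])
qed

text \<open>The angular speed of \<gamma> s as seen from \<gamma> t; divided by pi it is the density
  of the boundary measure. At s = t the division by zero yields 0.\<close>

definition dlog :: "real \<Rightarrow> real \<Rightarrow> real" where "dlog t s = Im (rt s / (\<gamma> s - \<gamma> t))"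

lemma Im_divide_wedge: "Im (u / v) = wedge v u / (norm v)\<^sup>2"
  by (simp add: Im_divide wedge_def cmod_power2 algebra_simps)

lemma dlog_nonneg: "0 \<le> dlog t s"
proof -
  have "wedge (\<gamma> s - \<gamma> t) (rt s) = wedge (rt s) (\<gamma> t - \<gamma> s)" by (simp add: wedge_def algebra_simps)
  then show ?thesis unfolding dlog_def Im_divide_wedge using rt_support[OF \<gamma>_mem, of s t] by simp
qed

lemma dlog_shift: "dlog t (s + L) = dlog t s" by (simp add: dlog_def rt_shift \<gamma>_shift)

lemma p_neq: "p - \<gamma> t \<noteq> 0" using interior_p \<gamma>_frontier[of t] by (auto simp: frontier_def)

text \<open>The ray from \<gamma> t pointing away from p contains no other point of \<Omega>:
  \<gamma> t would lie strictly between such a point and the interior point p. So the principal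
  logarithm, normalised by the direction of p, is available on the whole curve away from \<gamma>
  t.\<close>

lemma slit: "(z - \<gamma> t) / (p - \<gamma> t) \<notin> \<real>\<^sub>\<le>\<^sub>0" if "z \<in> \<Omega>" "z \<noteq> \<gamma> t"
proof
  assume "(z - \<gamma> t) / (p - \<gamma> t) \<in> \<real>\<^sub>\<le>\<^sub>0"
  then obtain k where k: "(z - \<gamma> t) / (p - \<gamma> t) = of_real k" "k \<le> 0" by (rule nonpos_Reals_cases)
  then have z: "z = \<gamma> t + of_real k * (p - \<gamma> t)" using p_neq[of t] by (simp add: field_simps)
  then have "k < 0" using that k by (cases "k = 0") auto
  then have "z - (k / (k - 1)) *\<^sub>R (z - p) \<in> interior \<Omega>"
    using that by (intro mem_interior_convex_shrink[OF convex interior_p]) (auto simp: divide_simps)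
  also have "z - (k / (k - 1)) *\<^sub>R (z - p) = \<gamma> t"
  proof -
    have "(k - 1) *\<^sub>R (z - (k / (k - 1)) *\<^sub>R (z - p)) = (k - 1) *\<^sub>R z - k *\<^sub>R (z - p)"
      using \<open>k < 0\<close> by (simp add: scaleR_diff_right)
    also have "\<dots> = (k - 1) *\<^sub>R \<gamma> t"
      unfolding z by (simp add: scaleR_conv_of_real algebra_simps)
    finally show ?thesis using \<open>k < 0\<close> by simp
  qed
  finally show False using \<gamma>_frontier[of t] by (simp add: frontier_def)
qed

definition ang :: "real \<Rightarrow> real \<Rightarrow> real" where "ang t s = Arg ((\<gamma> s - \<gamma> t) / (p - \<gamma> t))"

lemma dlog_has_integral:
  assumes "t < a" "a \<le> b" "b < t + L"
  shows "(dlog t has_integral ang t b - ang t a) {a..b}"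
proof -
  define e where "e = p - \<gamma> t"
  have e: "e \<noteq> 0" using p_neq by (simp add: e_def)
  define U where "U = (\<lambda>z. (z - \<gamma> t) / e) -` (- \<real>\<^sub>\<le>\<^sub>0)"
  have "open U" unfolding U_def
    by (intro continuous_open_vimage) (use e in \<open>auto intro!: continuous_intros simp: closed_nonpos_Reals_complex open_Compl\<close>)
  have mem: "\<gamma> x \<in> U" if "a \<le> x" "x \<le> b" for x
    using slit[OF \<gamma>_mem, of x t] \<gamma>_neq[of t x] that assms by (simp add: U_def e_def)
  have "((\<lambda>x. (1 / (\<gamma> x - \<gamma> t)) * rt x) has_integral Ln ((\<gamma> b - \<gamma> t) / e) - Ln ((\<gamma> a - \<gamma> t) / e)) {a..b}"
  proof (rule has_integral_holomorphic_along_curve[OF \<open>a \<le> b\<close> \<open>open U\<close>,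
        where C=1 and G="\<lambda>z. Ln ((z - \<gamma> t) / e)" and g="\<lambda>z. 1 / (z - \<gamma> t)"])
    fix z assume z: "z \<in> U"
    then have "(z - \<gamma> t) / e \<notin> \<real>\<^sub>\<le>\<^sub>0" "z \<noteq> \<gamma> t" by (auto simp: U_def)
    then show "((\<lambda>z. Ln ((z - \<gamma> t) / e)) has_field_derivative 1 / (z - \<gamma> t)) (at z)"
      using e by (auto intro!: derivative_eq_intros simp: field_simps)
  qed (use mem rt(1) \<gamma>_lipschitz in auto)
  from has_integral_linear[OF this bounded_linear_Im]
  have "((\<lambda>x. Im ((1 / (\<gamma> x - \<gamma> t)) * rt x)) has_integral
      Im (Ln ((\<gamma> b - \<gamma> t) / e) - Ln ((\<gamma> a - \<gamma> t) / e))) {a..b}"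
    unfolding o_def .
  moreover have "Im (Ln ((\<gamma> b - \<gamma> t) / e) - Ln ((\<gamma> a - \<gamma> t) / e)) = ang t b - ang t a"
    using e \<gamma>_neq[of t a] \<gamma>_neq[of t b] assms by (simp add: ang_def Arg_def e_def)
  moreover have "(\<lambda>x. Im ((1 / (\<gamma> x - \<gamma> t)) * rt x)) = dlog t" by (simp add: dlog_def fun_eq_iff)
  ultimately show ?thesis by simp
qed

lemma Im_divide_wedge_swap: "e \<noteq> 0 \<Longrightarrow> Im (u / e) = - wedge u e / (norm e)\<^sup>2"
  by (simp add: Im_divide_wedge wedge_def)

text \<open>\<open>Arg\<close> ignores positive factors, so the vanishing chord may be replaced by
  its difference quotient. The limit is off the branch cut because the tangent line misses p. At the
  other end of the period, \<open>ang_left\<close> argues likewise at t + L, where the curve returns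
  to \<gamma> t.\<close>

lemma ang_right: "(ang t \<longlongrightarrow> Arg (rt t / (p - \<gamma> t))) (at_right t)"
proof -
  define e where "e = p - \<gamma> t"
  have e: "e \<noteq> 0" using p_neq by (simp add: e_def)
  have "Im (rt t / e) < 0"
    using e rt_gap[of t] r_pos by (simp add: Im_divide_wedge_swap e_def[symmetric])
  then have "rt t / e \<notin> \<real>\<^sub>\<le>\<^sub>0" by (auto simp: complex_nonpos_Reals_iff)
  then have "isCont Arg (rt t / e)" by (rule continuous_at_Arg)
  then have "((\<lambda>y. Arg (((\<gamma> y - \<gamma> t) /\<^sub>R (y - t)) / e)) \<longlongrightarrow> Arg (rt t / e)) (at_right t)"
    by (rule isCont_tendsto_compose) (intro tendsto_intros rt_slope e)
  moreover have "\<forall>\<^sub>F y in at_right t. Arg (((\<gamma> y - \<gamma> t) /\<^sub>R (y - t)) / e) = ang t y"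
    unfolding eventually_at_right_field
  proof (intro exI[of _ "t + 1"] conjI allI impI)
    fix y assume y: "t < y" "y < t + 1"
    have "((\<gamma> y - \<gamma> t) /\<^sub>R (y - t)) / e = ((\<gamma> y - \<gamma> t) / e) / of_real (y - t)"
      by (simp add: scaleR_conv_of_real divide_inverse mult_ac)
    then show "Arg (((\<gamma> y - \<gamma> t) /\<^sub>R (y - t)) / e) = ang t y"
      using y Arg_divide_of_real[of "y - t"] by (simp only: ang_def e_def diff_gt_0_iff_gt)
  qed simp
  ultimately show ?thesis unfolding e_def by (rule Lim_transform_eventually)
qed

lemma ang_left: "(ang t \<longlongrightarrow> Arg (- lt t / (p - \<gamma> t))) (at_left (t + L))"
proof -
  define e where "e = p - \<gamma> t"
  have e: "e \<noteq> 0" using p_neq by (simp add: e_def)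
  have "wedge (- lt t) e = - wedge (lt t) e" by (simp add: wedge_def)
  then have "0 < Im (- lt t / e)"
    using e lt_gap[of t] r_pos by (subst Im_divide_wedge_swap) (auto simp: e_def[symmetric])
  then have "- lt t / e \<notin> \<real>\<^sub>\<le>\<^sub>0" by (auto simp: complex_nonpos_Reals_iff)
  then have "isCont Arg (- lt t / e)" by (rule continuous_at_Arg)
  moreover have "((\<lambda>y. (- ((\<gamma> y - \<gamma> (t + L)) /\<^sub>R (y - (t + L)))) / e) \<longlongrightarrow> - lt t / e) (at_left (t + L))"
    using lt_slope[of "t + L"] unfolding lt_shift by (intro tendsto_intros e)
  ultimately have "((\<lambda>y. Arg ((- ((\<gamma> y - \<gamma> (t + L)) /\<^sub>R (y - (t + L)))) / e)) \<longlongrightarrow> Arg (- lt t / e)) (at_left (t + L))"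
    by (rule isCont_tendsto_compose)
  moreover have "\<forall>\<^sub>F y in at_left (t + L). Arg ((- ((\<gamma> y - \<gamma> (t + L)) /\<^sub>R (y - (t + L)))) / e) = ang t y"
    unfolding eventually_at_left_field
  proof (intro exI[of _ t] conjI allI impI)
    fix y assume y: "t < y" "y < t + L"
    have "inverse (of_real (y - (t + L)) :: complex) = - inverse (of_real (t + L - y))"
      by (simp flip: inverse_minus_eq)
    then have "(- ((\<gamma> y - \<gamma> (t + L)) /\<^sub>R (y - (t + L)))) / e = ((\<gamma> y - \<gamma> t) / e) / of_real (t + L - y)"
      unfolding \<gamma>_shift scaleR_conv_of_real of_real_inverse by (simp only: divide_inverse) (simp add: mult_ac)
    then show "Arg ((- ((\<gamma> y - \<gamma> (t + L)) /\<^sub>R (y - (t + L)))) / e) = ang t y"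
      using y Arg_divide_of_real[of "t + L - y"] by (simp only: ang_def e_def diff_gt_0_iff_gt)
  qed (use L_pos in simp)
  ultimately show ?thesis unfolding e_def by (rule Lim_transform_eventually)
qed

text \<open>The interior angle at \<gamma> t, as the difference of the directions of the two
  tangents pointing along the boundary, measured from the direction of p.\<close>

definition total_angle :: "real \<Rightarrow> real" where
  "total_angle t = Arg (- lt t / (p - \<gamma> t)) - Arg (rt t / (p - \<gamma> t))"

text \<open>No multiple of 2 pi can slip in: the support gaps place the two arguments in (-pi, 0)
  and (0, pi), so pi minus their difference lies in (-pi, pi) and is itself a principal argument.
  Its sign comes from the left turn \<open>wedge_lt_rt\<close>.\<close>

lemma jump: "Arg (rt t / lt t) = pi - total_angle t" "0 \<le> Arg (rt t / lt t)"
proof -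
  define e where "e = p - \<gamma> t"
  have e: "e \<noteq> 0" using p_neq by (simp add: e_def)
  have l0: "lt t \<noteq> 0" and r0: "rt t \<noteq> 0" using lt(2)[of t] rt(2)[of t] by auto
  define b where "b = Arg (- lt t / e)"
  define a where "a = Arg (rt t / e)"
  have T: "total_angle t = b - a" by (simp add: total_angle_def a_def b_def e_def)
  have "Im (rt t / e) < 0"
    using e rt_gap[of t] r_pos by (simp add: Im_divide_wedge_swap e_def[symmetric])
  then have a: "a < 0" "- pi < a" using Arg_lt_pi[of "rt t / e"] Arg_neg_iff mpi_less_Arg by (auto simp: a_def)
  have "wedge (- lt t) e = - wedge (lt t) e" by (simp add: wedge_def)
  then have "0 < Im (- lt t / e)"
    using e lt_gap[of t] r_pos by (subst Im_divide_wedge_swap) (auto simp: e_def[symmetric])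
  then have b: "0 < b" "b < pi" using Arg_lt_pi[of "- lt t / e"] by (auto simp: b_def)
  have "rt t / e = norm (rt t / e) *\<^sub>R cis a" "- lt t / e = norm (- lt t / e) *\<^sub>R cis b"
    unfolding a_def b_def using rcis_cmod_Arg[of "rt t / e"] rcis_cmod_Arg[of "- lt t / e"]
    by (simp_all add: rcis_def scaleR_conv_of_real)
  moreover have "norm (rt t / e) = inverse (norm e)" "norm (- lt t / e) = inverse (norm e)"
    using rt(2)[of t] lt(2)[of t] by (simp_all add: norm_divide inverse_eq_divide)
  ultimately have ra2: "rt t / e = cis a /\<^sub>R norm e" and lb2: "- lt t / e = cis b /\<^sub>R norm e"
    by (simp_all only:)
  from ra2 have ra: "rt t = e * (cis a /\<^sub>R norm e)" using e by (metis nonzero_mult_div_cancel_left times_divide_eq_right)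
  from lb2
  have "- lt t = e * (cis b /\<^sub>R norm e)" using e by (metis nonzero_mult_div_cancel_left times_divide_eq_right)
  then have lb: "lt t = - (e * (cis b /\<^sub>R norm e))" by (metis minus_minus)
  have "rt t / lt t = - (cis a / cis b)" unfolding ra lb using e by (simp add: scaleR_conv_of_real)
  also have "\<dots> = cis (pi - (b - a))"
    by (simp add: cis_divide) (simp add: cis.ctr complex_eq_iff cos_diff sin_diff)
  finally have q: "rt t / lt t = cis (pi - (b - a))" .
  then show eq: "Arg (rt t / lt t) = pi - total_angle t" using a b T by (simp add: Arg_cis)
  have "sin (pi - (b - a)) = Im (rt t / lt t)" by (simp add: q)
  also have "\<dots> \<ge> 0" unfolding Im_divide_wedge using wedge_lt_rt[of t] by simp
  finally have "0 \<le> sin (pi - (b - a))" .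
  show "0 \<le> Arg (rt t / lt t)"
  proof (rule ccontr)
    assume "\<not> ?thesis"
    then have "pi - (b - a) < 0" "- pi < pi - (b - a)" using eq T a b by auto
    then have "0 < sin (- (pi - (b - a)))" by (intro sin_gt_zero) auto
    then show False using \<open>0 \<le> sin (pi - (b - a))\<close> by (simp only: sin_minus)
  qed
qed

section \<open>Measurability and the integral of the angular speed over a period\<close>

lemma \<gamma>_measurable [measurable]: "\<gamma> \<in> borel_measurable borel"
  by (rule borel_measurable_continuous_onI) (rule \<gamma>_continuous)

lemma rt_measurable [measurable]: "rt \<in> borel_measurable borel"
proof (rule borel_measurable_LIMSEQ_metric)
  show "(\<lambda>t. (\<gamma> (t + 1 / real (Suc i)) - \<gamma> t) /\<^sub>R (1 / real (Suc i))) \<in> borel_measurable borel" for i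
    by measurable
  fix t
  have inv0: "(\<lambda>n. 1 / real (Suc n)) \<longlonglongrightarrow> 0"
    using LIMSEQ_inverse_real_of_nat by (simp add: inverse_eq_divide)
  have "filterlim (\<lambda>n. t + 1 / real (Suc n)) (at_right t) sequentially"
    unfolding filterlim_at using tendsto_add[OF tendsto_const[of t] inv0] by auto
  from filterlim_compose[OF rt_slope this]
  show "(\<lambda>i. (\<gamma> (t + 1 / real (Suc i)) - \<gamma> t) /\<^sub>R (1 / real (Suc i))) \<longlonglongrightarrow> rt t" by simp
qed

lemma dlog_measurable [measurable]: "dlog t \<in> borel_measurable borel"
proof -
  have "dlog t = (\<lambda>s. (Re (\<gamma> s - \<gamma> t) * Im (rt s) - Im (\<gamma> s - \<gamma> t) * Re (rt s)) / (norm (\<gamma> s - \<gamma> t))\<^sup>2)"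
    by (simp add: fun_eq_iff dlog_def Im_divide_wedge wedge_def)
  also have "\<dots> \<in> borel_measurable borel" by measurable
  finally show ?thesis .
qed

lemma nn_integral_dlog: "(\<integral>\<^sup>+s. ennreal (dlog t s) * indicator {t<..<t + L} s \<partial>lborel) = ennreal (total_angle t)"
proof -
  \<comment> \<open>The formula for \<open>dlog\<close> holds on compact subintervals of the open
    period. The shift by 3 makes the margin at most L / 3, so the first of these intervals is
    already nondegenerate.\<close>
  define \<delta> where "\<delta> n = L / real (n + 3)" for n
  have \<delta>: "0 < \<delta> n" "3 * \<delta> n \<le> L" for n
    using L_pos by (simp_all add: \<delta>_def field_simps)
  have \<delta>_anti: "\<delta> n \<le> \<delta> m" if "m \<le> n" for m n
    using that L_pos by (simp add: \<delta>_def frac_le)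
  have \<delta>0: "\<delta> \<longlonglongrightarrow> 0"
  proof -
    have "(\<lambda>n. L / real n) \<longlonglongrightarrow> 0" by (rule lim_const_over_n)
    from LIMSEQ_ignore_initial_segment[OF this, of 3] show ?thesis by (simp add: \<delta>_def[abs_def])
  qed
  define I where "I n = {t + \<delta> n..t + L - \<delta> n}" for n
  define F where "F n s = ennreal (dlog t s) * indicator (I n) s" for n s
  have int: "integral\<^sup>N lborel (F n) = ennreal (ang t (t + L - \<delta> n) - ang t (t + \<delta> n))" for n
    unfolding F_def I_def using \<delta>[of n] dlog_nonneg
    by (intro nn_integral_has_integral_lebesgue' dlog_has_integral) auto
  have inc: "incseq F"
  proof (rule incseq_SucI, rule le_funI)
    fix n s
    have "I n \<subseteq> I (Suc n)" using \<delta>_anti[of n "Suc n"] by (auto simp: I_def)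
    then show "F n s \<le> F (Suc n) s" by (auto simp: F_def indicator_def)
  qed
  have sup: "(SUP n. F n s) = ennreal (dlog t s) * indicator {t<..<t + L} s" for s
  proof (rule antisym)
    show "(SUP n. F n s) \<le> ennreal (dlog t s) * indicator {t<..<t + L} s"
    proof (rule SUP_least)
      fix n
      have "I n \<subseteq> {t<..<t + L}" using \<delta>(1)[of n] by (auto simp: I_def)
      then show "F n s \<le> ennreal (dlog t s) * indicator {t<..<t + L} s" by (auto simp: F_def indicator_def)
    qed
    show "ennreal (dlog t s) * indicator {t<..<t + L} s \<le> (SUP n. F n s)"
    proof (cases "s \<in> {t<..<t + L}")
      case True
      then have "0 < min (s - t) (t + L - s)" by simp
      from order_tendstoD(2)[OF \<delta>0 this] obtain n where "\<delta> n < min (s - t) (t + L - s)"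
        unfolding eventually_sequentially by blast
      then have "F n s = ennreal (dlog t s) * indicator {t<..<t + L} s"
        using True by (simp add: F_def I_def)
      then show ?thesis using SUP_upper[of n UNIV "\<lambda>n. F n s"] by simp
    qed simp
  qed
  have "(\<lambda>n. integral\<^sup>N lborel (F n)) \<longlonglongrightarrow> (SUP n. integral\<^sup>N lborel (F n))"
    by (rule LIMSEQ_SUP) (use inc in \<open>auto simp: incseq_def le_fun_def intro!: nn_integral_mono\<close>)
  also have "(SUP n. integral\<^sup>N lborel (F n)) = (\<integral>\<^sup>+s. (SUP n. F n s) \<partial>lborel)"
    by (rule nn_integral_monotone_convergence_SUP[symmetric, OF inc]) (simp add: F_def[abs_def] I_def)
  finally have L1: "(\<lambda>n. integral\<^sup>N lborel (F n)) \<longlonglongrightarrow> (\<integral>\<^sup>+s. ennreal (dlog t s) * indicator {t<..<t + L} s \<partial>lborel)"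
    unfolding sup .
  have "filterlim (\<lambda>n. t + \<delta> n) (at_right t) sequentially"
    unfolding filterlim_at using tendsto_add[OF tendsto_const[of t] \<delta>0] \<delta>(1) less_imp_neq[OF \<delta>(1), symmetric] by auto
  from filterlim_compose[OF ang_right this] have A: "(\<lambda>n. ang t (t + \<delta> n)) \<longlonglongrightarrow> Arg (rt t / (p - \<gamma> t))" .
  have "filterlim (\<lambda>n. t + L - \<delta> n) (at_left (t + L)) sequentially"
    unfolding filterlim_at using tendsto_diff[OF tendsto_const[of "t + L"] \<delta>0] \<delta>(1) less_imp_neq[OF \<delta>(1), symmetric] by auto
  from filterlim_compose[OF ang_left this]
  have B: "(\<lambda>n. ang t (t + L - \<delta> n)) \<longlonglongrightarrow> Arg (- lt t / (p - \<gamma> t))" .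
  have "(\<lambda>n. integral\<^sup>N lborel (F n)) \<longlonglongrightarrow> ennreal (total_angle t)"
    unfolding int total_angle_def by (intro tendsto_ennrealI tendsto_diff A B)
  with L1 show ?thesis by (rule LIMSEQ_unique)
qed

lemma nn_integral_period:
  assumes [measurable]: "f \<in> borel_measurable borel" and per: "\<And>s. f (s + L) = f s"
    and t: "0 \<le> t" "t < L"
  shows "(\<integral>\<^sup>+s. f s * indicator {0..<L} s \<partial>lborel) = (\<integral>\<^sup>+s. f s * indicator {t..<t + L} s \<partial>lborel)"
proof -
  have "(\<integral>\<^sup>+s. f s * indicator {L..<t + L} s \<partial>lborel) = (\<integral>\<^sup>+s. f (L + 1 * s) * indicator {L..<t + L} (L + 1 * s) \<partial>lborel)"
    by (subst nn_integral_real_affine[where c=1 and t=L]) simp_all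
  also have "\<dots> = (\<integral>\<^sup>+s. f s * indicator {0..<t} s \<partial>lborel)"
    by (intro nn_integral_cong) (auto simp: indicator_def per add.commute)
  finally have shift: "(\<integral>\<^sup>+s. f s * indicator {L..<t + L} s \<partial>lborel) = (\<integral>\<^sup>+s. f s * indicator {0..<t} s \<partial>lborel)" .
  have "(\<integral>\<^sup>+s. f s * indicator {0..<L} s \<partial>lborel)
      = (\<integral>\<^sup>+s. f s * indicator {0..<t} s + f s * indicator {t..<L} s \<partial>lborel)"
    by (intro nn_integral_cong) (use t in \<open>auto simp: indicator_def\<close>)
  also have "\<dots> = (\<integral>\<^sup>+s. f s * indicator {0..<t} s \<partial>lborel) + (\<integral>\<^sup>+s. f s * indicator {t..<L} s \<partial>lborel)"
    by (rule nn_integral_add) measurable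
  also have "\<dots> = (\<integral>\<^sup>+s. f s * indicator {t..<L} s \<partial>lborel) + (\<integral>\<^sup>+s. f s * indicator {L..<t + L} s \<partial>lborel)"
    unfolding shift by (rule add.commute)
  also have "\<dots> = (\<integral>\<^sup>+s. f s * indicator {t..<L} s + f s * indicator {L..<t + L} s \<partial>lborel)"
    by (rule nn_integral_add[symmetric]) measurable
  also have "\<dots> = (\<integral>\<^sup>+s. f s * indicator {t..<t + L} s \<partial>lborel)"
    by (intro nn_integral_cong) (use t in \<open>auto simp: indicator_def\<close>)
  finally show ?thesis .
qed

end

section \<open>The Neumann--Poincare measures\<close>

locale boundary_body = ccw_convex_body \<Omega> p r "perimeter \<Omega>" "boundary_curve \<Omega>" for \<Omega> p r
begin

abbreviation per :: real where "per \<equiv> perimeter \<Omega>"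
abbreviation \<beta> :: "real \<Rightarrow> complex" where "\<beta> \<equiv> boundary_curve \<Omega>"
abbreviation bdry :: "complex measure" where "bdry \<equiv> restrict_space borel (frontier \<Omega>)"

lemma inj_boundary_curve: "inj_on \<beta> {0..<per}"
  using \<gamma>_inj_0 by (auto simp: inj_on_def)

lemma boundary_time: "boundary_time \<Omega> (\<beta> t) = t" if "0 \<le> t" "t < per"
  unfolding boundary_time_def using that by (intro the_inv_into_f_f inj_boundary_curve) auto

lemma boundary_time_frontier:
  assumes "z \<in> frontier \<Omega>"
  shows "0 \<le> boundary_time \<Omega> z" "boundary_time \<Omega> z < per" "\<beta> (boundary_time \<Omega> z) = z"
proof -
  obtain t where "0 \<le> t" "t < 0 + per" "\<beta> t = z" by (rule frontier_\<gamma>[OF assms])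
  then show "0 \<le> boundary_time \<Omega> z" "boundary_time \<Omega> z < per" "\<beta> (boundary_time \<Omega> z) = z"
    using boundary_time[of t] by auto
qed

lemma tangent_jump: "tangent_jump \<Omega> (\<beta> t) = Arg (rt t / lt t)" if "0 \<le> t" "t < per"
  using boundary_time[OF that]
  by (simp add: tangent_jump_def outgoing_tangent_def incoming_tangent_def rt_def lt_def)

lemma corner_imp_neq: "lt t \<noteq> rt t" if "corner \<Omega> (\<beta> t)" "0 \<le> t" "t < per"
proof
  assume "lt t = rt t"
  moreover have "rt t \<noteq> 0" using rt(2)[of t] by auto
  ultimately show False using that by (simp add: corner_def tangent_jump)
qed

lemma np_density:
  "np_density \<Omega> \<zeta> (\<beta> t) = (if corner \<Omega> (\<beta> t) \<or> \<beta> t = \<zeta> then 0 else Im (rt t / (\<beta> t - \<zeta>)) / pi)"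
  if "0 \<le> t" "t < per"
proof -
  have "Re (- \<i> * u / v) = Im (u / v)" for u v :: complex
    by (simp add: Re_divide Im_divide diff_divide_distrib)
  then show ?thesis
    using boundary_time[OF that] by (simp add: np_density_def outward_normal_def outgoing_tangent_def rt_def)
qed

lemma space_bdry: "space bdry = frontier \<Omega>" by (simp add: space_restrict_space)

lemma curve_measurable: "\<beta> \<in> measurable (restrict_space lborel {0..<per}) bdry"
  by (intro measurable_restrict_space2 measurable_restrict_space1) (auto simp: \<gamma>_frontier)

text \<open>The function jumps at the base point, but its sublevel sets are images of compact
  parameter intervals and hence closed.\<close>

lemma boundary_time_measurable: "boundary_time \<Omega> \<in> borel_measurable bdry"
proof (rule borel_measurableI_le)
  fix a
  consider "a < 0" | "0 \<le> a" "a < per" | "per \<le> a" by linarith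
  then show "{z \<in> space bdry. boundary_time \<Omega> z \<le> a} \<in> sets bdry"
  proof cases
    case 1
    then have "{z \<in> space bdry. boundary_time \<Omega> z \<le> a} = {}"
      using boundary_time_frontier(1) by (force simp: space_bdry)
    then show ?thesis by (simp only: sets.empty_sets)
  next
    case 2
    have "{z \<in> space bdry. boundary_time \<Omega> z \<le> a} = \<beta> ` {0..a} \<inter> frontier \<Omega>"
    proof (intro set_eqI iffI)
      fix z assume "z \<in> {z \<in> space bdry. boundary_time \<Omega> z \<le> a}"
      then have "z \<in> frontier \<Omega>" "boundary_time \<Omega> z \<le> a" by (auto simp: space_bdry)
      then show "z \<in> \<beta> ` {0..a} \<inter> frontier \<Omega>"
        using boundary_time_frontier[of z] by (intro IntI image_eqI[of z \<beta> "boundary_time \<Omega> z"]) auto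
    next
      fix z assume "z \<in> \<beta> ` {0..a} \<inter> frontier \<Omega>"
      then obtain t where "z = \<beta> t" "0 \<le> t" "t \<le> a" by auto
      then show "z \<in> {z \<in> space bdry. boundary_time \<Omega> z \<le> a}"
        using 2 boundary_time[of t] \<gamma>_frontier by (simp add: space_bdry)
    qed
    moreover
    have "closed (\<beta> ` {0..a})"
      by (intro compact_imp_closed compact_continuous_image \<gamma>_continuous) simp
    then have "\<beta> ` {0..a} \<in> sets borel" by (rule borel_closed)
    then have "frontier \<Omega> \<inter> \<beta> ` {0..a} \<in> sets bdry" unfolding sets_restrict_space by (rule imageI)
    ultimately show ?thesis by (simp only: Int_commute)
  next
    case 3
    then have "{z \<in> space bdry. boundary_time \<Omega> z \<le> a} = space bdry"
      using boundary_time_frontier(2) by (force simp: space_bdry)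
    then show ?thesis using sets.top[of bdry] by (simp only:)
  qed
qed

lemma countable_corners: "countable {z \<in> frontier \<Omega>. corner \<Omega> z}"
proof (rule countable_subset)
  show "{z \<in> frontier \<Omega>. corner \<Omega> z} \<subseteq> \<beta> ` {t. lt t \<noteq> rt t}"
  proof
    fix z assume z: "z \<in> {z \<in> frontier \<Omega>. corner \<Omega> z}"
    then have "lt (boundary_time \<Omega> z) \<noteq> rt (boundary_time \<Omega> z)"
      using boundary_time_frontier[of z] by (intro corner_imp_neq) auto
    then show "z \<in> \<beta> ` {t. lt t \<noteq> rt t}"
      using z boundary_time_frontier[of z] by (intro image_eqI[of z \<beta> "boundary_time \<Omega> z"]) auto
  qed
qed (intro countable_image countable_neq)

lemma np_density_measurable: "np_density \<Omega> (\<beta> t) \<in> borel_measurable bdry"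
proof -
  let ?E = "{z \<in> frontier \<Omega>. corner \<Omega> z \<or> z = \<beta> t}"
  have "countable ?E"
    by (rule countable_subset[of _ "{z \<in> frontier \<Omega>. corner \<Omega> z} \<union> {\<beta> t}"]) (use countable_corners in auto)
  moreover have "{z} \<in> sets bdry" if "z \<in> ?E" for z
    using that by (auto simp: sets_restrict_space intro!: image_eqI[of _ _ "{z}"])
  ultimately have "?E \<in> sets bdry" using sets.countable[of ?E bdry] by blast
  then have E: "{z \<in> space bdry. corner \<Omega> z \<or> z = \<beta> t} \<in> sets bdry" by (simp add: space_bdry)
  have "(\<lambda>z. dlog t (boundary_time \<Omega> z) / pi) \<in> borel_measurable bdry"
    using measurable_compose[OF boundary_time_measurable dlog_measurable[of t]] by measurable
  from measurable_If[OF measurable_const[of 0] this E]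
  have *: "(\<lambda>z. if corner \<Omega> z \<or> z = \<beta> t then 0 else dlog t (boundary_time \<Omega> z) / pi) \<in> borel_measurable bdry"
    by simp
  have "np_density \<Omega> (\<beta> t) z = (if corner \<Omega> z \<or> z = \<beta> t then 0 else dlog t (boundary_time \<Omega> z) / pi)"
    if "z \<in> space bdry" for z
    using np_density[of "boundary_time \<Omega> z" "\<beta> t"] boundary_time_frontier[of z] that
    by (simp add: space_bdry dlog_def)
  from measurable_cong[THEN iffD2, OF this *] show ?thesis .
qed

lemma sets_arclength: "sets (arclength_measure \<Omega>) = sets bdry"
  by (simp add: arclength_measure_def)

text \<open>The convention that the density vanishes at corners and at \<zeta> changes the integrand
  only at countably many parameters: corners are jumps of the tangent, and \<zeta> has one parameter
  in the period.\<close>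

lemma nn_integral_density_arclength:
  assumes [measurable]: "G \<in> borel_measurable bdry"
  shows "(\<integral>\<^sup>+z. ennreal (np_density \<Omega> (\<beta> t) z) * G z \<partial>arclength_measure \<Omega>)
    = (\<integral>\<^sup>+s. ennreal (dlog t s / pi) * G (\<beta> s) * indicator {0..<per} s \<partial>lborel)"
proof -
  note [measurable] = np_density_measurable[of t]
  have "(\<integral>\<^sup>+z. ennreal (np_density \<Omega> (\<beta> t) z) * G z \<partial>arclength_measure \<Omega>)
      = (\<integral>\<^sup>+s. ennreal (np_density \<Omega> (\<beta> t) (\<beta> s)) * G (\<beta> s) \<partial>restrict_space lborel {0..<per})"
    unfolding arclength_measure_def by (rule nn_integral_distr[OF curve_measurable]) measurable
  also have "\<dots> = (\<integral>\<^sup>+s. ennreal (np_density \<Omega> (\<beta> t) (\<beta> s)) * G (\<beta> s) * indicator {0..<per} s \<partial>lborel)"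
    by (rule nn_integral_restrict_space) simp
  also have "\<dots> = (\<integral>\<^sup>+s. ennreal (dlog t s / pi) * G (\<beta> s) * indicator {0..<per} s \<partial>lborel)"
  proof (rule nn_integral_cong_AE)
    obtain n :: int where n: "0 \<le> t + of_int n * per" "t + of_int n * per < 0 + per" by (rule period_representative)
    have "countable ({s. lt s \<noteq> rt s} \<union> {t + of_int n * per})" using countable_neq by simp
    from countable_imp_null_set_lborel[OF this]
    have "AE s in lborel. s \<notin> {s. lt s \<noteq> rt s} \<union> {t + of_int n * per}" by (rule AE_not_in)
    then show "AE s in lborel. ennreal (np_density \<Omega> (\<beta> t) (\<beta> s)) * G (\<beta> s) * indicator {0..<per} s
        = ennreal (dlog t s / pi) * G (\<beta> s) * indicator {0..<per} s"
    proof eventually_elim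
      case (elim s)
      show ?case
      proof (cases "s \<in> {0..<per}")
        case True
        have "\<beta> s \<noteq> \<beta> t"
        proof
          assume "\<beta> s = \<beta> t"
          then have "\<beta> s = \<beta> (t + of_int n * per)" by (simp add: plus_of_int)
          then have "s = t + of_int n * per" using True n by (intro \<gamma>_inj_0) auto
          then show False using elim by simp
        qed
        moreover have "\<not> corner \<Omega> (\<beta> s)" using corner_imp_neq[of s] True elim by auto
        ultimately have "np_density \<Omega> (\<beta> t) (\<beta> s) = dlog t s / pi"
          using True by (simp add: np_density dlog_def)
        then show ?thesis by simp
      qed simp
    qed
  qed
  finally show ?thesis .
qed

section \<open>The boundary measures and their total mass\<close>

definition \<mu> :: "real \<Rightarrow> complex measure" where "\<mu> t = np_measure \<Omega> (\<beta> t)"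

lemma space_\<mu>: "space (\<mu> t) = frontier \<Omega>"
  unfolding \<mu>_def np_measure_def by (rule space_measure_of) (use sets.space_closed[of bdry] in \<open>simp add: space_bdry\<close>)

lemma sets_\<mu>: "sets (\<mu> t) = sets bdry"
proof -
  have "sets (\<mu> t) = sigma_sets (space bdry) (sets bdry)"
    unfolding \<mu>_def np_measure_def space_bdry
    by (rule sets_measure_of) (use sets.space_closed[of bdry] in \<open>simp add: space_bdry\<close>)
  then show ?thesis by (simp only: sets.sigma_sets_eq)
qed

text \<open>\<open>measure_of\<close> agrees with the given set function only once that function is
  known to be countably additive. Here it is an atom plus a measure with a density, and both parts
  are.\<close>

lemma emeasure_\<mu>:
  assumes A: "A \<in> sets bdry"
  shows "emeasure (\<mu> t) A = ennreal (1 - interior_angle \<Omega> (\<beta> t) / pi) * indicator A (\<beta> t)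
      + emeasure (density (arclength_measure \<Omega>) (\<lambda>z. ennreal (np_density \<Omega> (\<beta> t) z))) A"
proof -
  define f where "f A = ennreal (1 - interior_angle \<Omega> (\<beta> t) / pi) * indicator A (\<beta> t)
          + (\<integral>\<^sup>+\<sigma>\<in>A. ennreal (np_density \<Omega> (\<beta> t) \<sigma>) \<partial>arclength_measure \<Omega>)" for A
  define D where "D = density (arclength_measure \<Omega>) (\<lambda>z. ennreal (np_density \<Omega> (\<beta> t) z))"
  define c where "c = ennreal (1 - interior_angle \<Omega> (\<beta> t) / pi)"
  have sD: "sets D = sets bdry" by (simp add: D_def sets_arclength)
  have [measurable]: "np_density \<Omega> (\<beta> t) \<in> borel_measurable (arclength_measure \<Omega>)"
    using np_density_measurable[of t] sets_arclength by (simp cong: measurable_cong_sets)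
  have f: "f B = c * indicator B (\<beta> t) + emeasure D B" if "B \<in> sets bdry" for B
    unfolding f_def D_def c_def using that by (subst emeasure_density) (simp_all add: sets_arclength)
  have "emeasure (\<mu> t) A = f A"
  proof (rule emeasure_measure_of)
    show "\<mu> t = measure_of (frontier \<Omega>) (sets bdry) f" unfolding \<mu>_def np_measure_def f_def[abs_def] ..
    show "sets bdry \<subseteq> Pow (frontier \<Omega>)" using sets.space_closed[of bdry] by (simp add: space_bdry)
    show "A \<in> sets (\<mu> t)" using A by (simp add: sets_\<mu>)
    show "positive (sets (\<mu> t)) f" by (simp add: positive_def f_def)
    show "countably_additive (sets (\<mu> t)) f"
    proof (rule countably_additiveI)
      fix B :: "nat \<Rightarrow> complex set"
      assume B: "range B \<subseteq> sets (\<mu> t)" "disjoint_family B" "(\<Union>i. B i) \<in> sets (\<mu> t)"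
      then have "(\<Sum>i. f (B i)) = (\<Sum>i. c * indicator (B i) (\<beta> t) + emeasure D (B i))"
        by (intro suminf_cong f) (auto simp: sets_\<mu>)
      also have "\<dots> = (\<Sum>i. c * indicator (B i) (\<beta> t)) + (\<Sum>i. emeasure D (B i))"
        by (intro suminf_add[symmetric] summableI)
      also have "(\<Sum>i. c * indicator (B i) (\<beta> t)) = c * indicator (\<Union>i. B i) (\<beta> t)"
        using B(2) by (simp add: suminf_indicator)
      also have "(\<Sum>i. emeasure D (B i)) = emeasure D (\<Union>i. B i)"
        using B by (intro suminf_emeasure) (auto simp: sets_\<mu> sD)
      also have "c * indicator (\<Union>i. B i) (\<beta> t) + emeasure D (\<Union>i. B i) = f (\<Union>i. B i)"
        using B by (intro f[symmetric]) (simp add: sets_\<mu>)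
      finally show "(\<Sum>i. f (B i)) = f (\<Union>i. B i)" .
    qed
  qed
  then show ?thesis using f[OF A] by (simp add: D_def c_def)
qed

text \<open>Omitting the atom leaves a smaller measure. An inequality in this direction is what
  turns smallness in mean into smallness on an arc.\<close>

lemma nn_integral_\<mu>_ge:
  assumes [measurable]: "G \<in> borel_measurable bdry"
  shows "(\<integral>\<^sup>+s. ennreal (dlog t s / pi) * G (\<beta> s) * indicator {0..<per} s \<partial>lborel) \<le> (\<integral>\<^sup>+z. G z \<partial>\<mu> t)"
proof -
  define D where "D = density (arclength_measure \<Omega>) (\<lambda>z. ennreal (np_density \<Omega> (\<beta> t) z))"
  have sD: "sets D = sets (\<mu> t)" by (simp add: D_def sets_arclength sets_\<mu>)
  have m: "np_density \<Omega> (\<beta> t) \<in> borel_measurable (arclength_measure \<Omega>)" "G \<in> borel_measurable (arclength_measure \<Omega>)"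
    using np_density_measurable[of t] assms sets_arclength by (simp_all cong: measurable_cong_sets)
  have "D \<le> \<mu> t"
    unfolding le_measure[OF sD] using emeasure_\<mu>[of _ t] by (simp add: sD sets_\<mu> D_def[symmetric])
  then have "(\<integral>\<^sup>+z. G z \<partial>D) \<le> (\<integral>\<^sup>+z. G z \<partial>\<mu> t)" using sD by (intro nn_integral_mono_measure)
  moreover have "(\<integral>\<^sup>+z. G z \<partial>D) = (\<integral>\<^sup>+z. ennreal (np_density \<Omega> (\<beta> t) z) * G z \<partial>arclength_measure \<Omega>)"
    unfolding D_def by (rule nn_integral_density) (use m in measurable)
  ultimately show ?thesis using nn_integral_density_arclength[OF assms, of t] by simp
qed

text \<open>The atom contributes the tangent jump and the density the interior angle, both divided
  by pi; by \<open>jump\<close> these angles add up to pi.\<close>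

lemma emeasure_\<mu>_space: "emeasure (\<mu> t) (space (\<mu> t)) = 1" if t: "0 \<le> t" "t < per"
proof -
  have top: "frontier \<Omega> \<in> sets bdry" using sets.top[of bdry] by (simp add: space_bdry)
  have m: "np_density \<Omega> (\<beta> t) \<in> borel_measurable (arclength_measure \<Omega>)"
    using np_density_measurable[of t] sets_arclength by (simp cong: measurable_cong_sets)
  have "emeasure (density (arclength_measure \<Omega>) (\<lambda>z. ennreal (np_density \<Omega> (\<beta> t) z))) (frontier \<Omega>)
      = (\<integral>\<^sup>+z. ennreal (np_density \<Omega> (\<beta> t) z) * indicator (frontier \<Omega>) z \<partial>arclength_measure \<Omega>)"
    using top m by (intro emeasure_density) (simp_all add: sets_arclength)
  also have "\<dots> = (\<integral>\<^sup>+s. ennreal (dlog t s / pi) * indicator (frontier \<Omega>) (\<beta> s) * indicator {0..<per} s \<partial>lborel)"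
    using top by (intro nn_integral_density_arclength) simp
  also have "\<dots> = (\<integral>\<^sup>+s. ennreal (dlog t s / pi) * indicator {0..<per} s \<partial>lborel)"
    by (intro nn_integral_cong) (simp add: \<gamma>_frontier)
  also have "\<dots> = (\<integral>\<^sup>+s. ennreal (dlog t s / pi) * indicator {t..<t + per} s \<partial>lborel)"
    using t by (intro nn_integral_period) (simp_all add: dlog_shift)
  also have "\<dots> = (\<integral>\<^sup>+s. ennreal (1 / pi) * (ennreal (dlog t s) * indicator {t<..<t + per} s) \<partial>lborel)"
  proof (rule nn_integral_cong)
    fix s
    \<comment> \<open>The half-open period contains t and the open one does not; the default value 0
      there makes the integrands agree everywhere.\<close>
    have "dlog t t = 0" by (simp add: dlog_def)
    then show "ennreal (dlog t s / pi) * indicator {t..<t + per} s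
        = ennreal (1 / pi) * (ennreal (dlog t s) * indicator {t<..<t + per} s)"
      using dlog_nonneg[of t s] by (cases "s = t") (auto simp: indicator_def ennreal_mult[symmetric])
  qed
  also have "\<dots> = ennreal (1 / pi) * ennreal (total_angle t)"
    by (subst nn_integral_cmult) (simp_all add: nn_integral_dlog)
  also have "\<dots> = ennreal (total_angle t / pi)"
  proof (cases "0 \<le> total_angle t")
    case True
    then show ?thesis by (simp add: ennreal_mult[symmetric])
  next
    case False
    then show ?thesis by (simp add: ennreal_neg divide_nonpos_pos)
  qed
  finally have e: "emeasure (\<mu> t) (space (\<mu> t))
      = ennreal (1 - interior_angle \<Omega> (\<beta> t) / pi) + ennreal (total_angle t / pi)"
    using emeasure_\<mu>[OF top, of t] by (simp add: space_\<mu> \<gamma>_frontier)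
  have j: "tangent_jump \<Omega> (\<beta> t) = pi - total_angle t" "0 \<le> tangent_jump \<Omega> (\<beta> t)"
    using tangent_jump[OF t] jump[of t] by simp_all
  have "0 \<le> total_angle t" using jump(1)[of t] Arg_le_pi[of "rt t / lt t"] by linarith
  moreover have "1 - interior_angle \<Omega> (\<beta> t) / pi = tangent_jump \<Omega> (\<beta> t) / pi"
    by (simp add: interior_angle_def field_simps)
  ultimately have "emeasure (\<mu> t) (space (\<mu> t)) = ennreal (tangent_jump \<Omega> (\<beta> t) / pi + total_angle t / pi)"
    unfolding e using j(2) by (simp add: ennreal_plus)
  then show ?thesis by (simp add: j(1) add_divide_distrib[symmetric])
qed

end

lemma (in convex_body) boundary_body: "boundary_body \<Omega> p r"
proof -
  obtain L \<gamma> where "ccw_arclength_param \<Omega> L \<gamma>" using ccw_arclength_param_exists by blast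
  then have "\<exists>q. ccw_arclength_param \<Omega> (fst q) (snd q)" by (intro exI[of _ "(L, \<gamma>)"]) simp
  from someI_ex[OF this] have "ccw_arclength_param \<Omega> (perimeter \<Omega>) (boundary_curve \<Omega>)"
    by (simp add: perimeter_def boundary_curve_def boundary_param_def)
  then show ?thesis by unfold_locales
qed

section \<open>Cauchy's formula along the boundary\<close>

context convex_body
begin

lemma segment_mem: "x + u *\<^sub>R (y - x) \<in> \<Omega>" if "x \<in> \<Omega>" "y \<in> \<Omega>" "0 \<le> u" "u \<le> 1"
proof -
  have "(1 - u) *\<^sub>R x + u *\<^sub>R y \<in> \<Omega>" using that by (intro convexD[OF convex]) auto
  then show ?thesis by (simp add: algebra_simps)
qed

text \<open>A contraction towards p carries a neighbourhood of \<Omega> into the interior, so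
  composing f with it gives a function holomorphic beyond the boundary; uniform continuity makes the
  change small. Primitives along boundary arcs need such an open domain.\<close>

lemma analytic_approx:
  assumes f: "continuous_on \<Omega> f" "f holomorphic_on interior \<Omega>" and "0 < \<epsilon>"
  obtains U F where "open U" "convex U" "\<Omega> \<subseteq> U" "F holomorphic_on U" "\<And>z. z \<in> \<Omega> \<Longrightarrow> norm (F z - f z) \<le> \<epsilon>"
proof -
  have "uniformly_continuous_on \<Omega> f" by (rule compact_uniformly_continuous[OF f(1) compact])
  then obtain \<delta> where \<delta>: "\<delta> > 0" "\<And>x y. x \<in> \<Omega> \<Longrightarrow> y \<in> \<Omega> \<Longrightarrow> dist y x < \<delta> \<Longrightarrow> dist (f y) (f x) < \<epsilon>"
    using \<open>0 < \<epsilon>\<close> unfolding uniformly_continuous_on_def by metis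
  have d: "diam > 0" using r_pos r_le_diam by linarith
  define \<kappa> where "\<kappa> = min (1/2) (\<delta> / (2 * diam))"
  have \<kappa>: "0 < \<kappa>" "\<kappa> \<le> 1/2" "\<kappa> \<le> \<delta> / (2 * diam)" using \<delta> d by (auto simp: \<kappa>_def)
  define A where "A z = z - \<kappa> *\<^sub>R (z - p)" for z
  define U where "U = A -` interior \<Omega>"
  have contA: "continuous_on UNIV A" unfolding A_def by (intro continuous_intros)
  have sub: "\<Omega> \<subseteq> U"
    using \<kappa> by (auto simp: U_def A_def intro!: mem_interior_convex_shrink[OF convex interior_p])
  show ?thesis
  proof
    show "open U" unfolding U_def by (intro open_vimage contA) simp
    show "convex U"
    proof (rule convexI)
      fix x y u v assume *: "x \<in> U" "y \<in> U" "0 \<le> u" "0 \<le> v" "u + v = (1::real)"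
      have v: "v = 1 - u" using * by simp
      have "A (u *\<^sub>R x + v *\<^sub>R y) = u *\<^sub>R A x + v *\<^sub>R A y"
        unfolding v A_def by (simp add: algebra_simps)
      also have "\<dots> \<in> interior \<Omega>"
        using * by (intro convexD[OF convex_interior[OF convex]]) (auto simp: U_def)
      finally show "u *\<^sub>R x + v *\<^sub>R y \<in> U" by (simp add: U_def)
    qed
    show "\<Omega> \<subseteq> U" by (fact sub)
    have "A = (\<lambda>z. z - of_real \<kappa> * (z - p))" by (simp add: A_def fun_eq_iff scaleR_conv_of_real)
    then have "A holomorphic_on U" by (auto intro!: holomorphic_intros)
    then have "(f \<circ> A) holomorphic_on U"
      by (rule holomorphic_on_compose_gen[OF _ f(2)]) (simp add: U_def)
    then show "(\<lambda>z. f (A z)) holomorphic_on U" by (simp add: o_def)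
    fix z assume z: "z \<in> \<Omega>"
    have "A z \<in> \<Omega>" using z sub interior_subset by (auto simp: U_def)
    moreover have "dist (A z) z < \<delta>"
    proof -
      have "dist (A z) z = \<kappa> * norm (z - p)" using \<kappa> by (simp add: A_def dist_norm)
      also have "\<dots> \<le> \<delta> / (2 * diam) * diam"
        using \<kappa> mem_diam[OF z p_mem] \<delta> d by (intro mult_mono) auto
      also have "\<dots> < \<delta>" using \<delta> d by simp
      finally show ?thesis .
    qed
    ultimately show "norm (f (A z) - f z) \<le> \<epsilon>" using \<delta>(2)[of z "A z"] z by (simp add: dist_norm)
  qed
qed

text \<open>The singularity at p is removable and the domain convex. This primitive reduces Cauchy's
  formula for F to the integral of 1 / (z - p).\<close>

lemma cauchy_kernel_primitive:
  assumes "open U" "convex U" "\<Omega> \<subseteq> U" "F holomorphic_on U"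
  obtains P where "\<And>z. z \<in> U \<Longrightarrow>
    (P has_field_derivative (if z = p then deriv F p else (F z - F p) / (z - p))) (at z)"
proof -
  have "p \<in> interior U" using assms p_mem by (simp add: interior_open subset_iff)
  from pole_lemma[OF assms(4) this]
  have "(\<lambda>z. if z = p then deriv F p else (F z - F p) / (z - p)) holomorphic_on U" .
  from holomorphic_convex_primitive'[OF assms(2,1) this] obtain P where
    "\<And>z. z \<in> U \<Longrightarrow> (P has_field_derivative (if z = p then deriv F p else (F z - F p) / (z - p))) (at z within U)"
    by blast
  then show ?thesis using that assms(1) at_within_open by metis
qed

text \<open>One piece of Cauchy's formula. The differences of P telescope when the pieces close up,
  leaving F(p) times the integral of dz / (z - p).\<close>

lemma cauchy_kernel_piece:
  assumes U: "open U" "\<Omega> \<subseteq> U" and F: "F holomorphic_on U"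
    and P: "\<And>z. z \<in> U \<Longrightarrow>
      (P has_field_derivative (if z = p then deriv F p else (F z - F p) / (z - p))) (at z)"
    and c: "a \<le> b" "\<And>x y. \<lbrakk>a \<le> x; x \<le> b; a \<le> y; y \<le> b\<rbrakk> \<Longrightarrow> norm (c x - c y) \<le> C * \<bar>x - y\<bar>"
      "\<And>x. \<lbrakk>a \<le> x; x < b\<rbrakk> \<Longrightarrow> (c has_vector_derivative c' x) (at_right x)"
      "\<And>x. \<lbrakk>a \<le> x; x \<le> b\<rbrakk> \<Longrightarrow> c x \<in> \<Omega>" "\<And>x. \<lbrakk>a \<le> x; x \<le> b\<rbrakk> \<Longrightarrow> m \<le> norm (c x - p)"
    and c': "c' \<in> borel_measurable borel" "\<And>x. norm (c' x) \<le> C" and m: "0 < m"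
  shows "(\<lambda>x. c' x / (c x - p)) integrable_on {a..b}"
    and "(\<lambda>x. F (c x) * (c' x / (c x - p))) integrable_on {a..b}"
    and "integral {a..b} (\<lambda>x. F (c x) * (c' x / (c x - p)))
      = F p * integral {a..b} (\<lambda>x. c' x / (c x - p)) + (P (c b) - P (c a))"
proof -
  have C0: "0 \<le> C" using c'(2)[of a] norm_ge_zero order_trans by blast
  have contc: "continuous_on {a..b} c"
    by (rule lipschitz_on_continuous_on[of C], rule lipschitz_onI) (use c(2) C0 in \<open>auto simp: dist_norm dist_real_def\<close>)
  have ne: "c x \<noteq> p" if "a \<le> x" "x \<le> b" for x using c(5)[OF that] m by auto
  \<comment> \<open>The tangent \<open>c'\<close> is only bounded and Borel, so integrability comes
    from measurability and a bound rather than from continuity.\<close>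
  have int: "(\<lambda>x. k x * (c' x / (c x - p))) integrable_on {a..b}" if k: "continuous_on {a..b} k" for k
  proof -
    have ck: "continuous_on {a..b} (\<lambda>x. k x / (c x - p))"
      using ne by (intro continuous_intros k contc) auto
    then obtain B where "\<forall>y\<in>(\<lambda>x. k x / (c x - p)) ` {a..b}. norm y \<le> B"
      using compact_imp_bounded[OF compact_continuous_image[OF ck compact_Icc]] unfolding bounded_iff by blast
    then have B: "norm (k x / (c x - p)) \<le> B" if "x \<in> {a..b}" for x using that by blast
    have "(\<lambda>x. k x / (c x - p)) \<in> borel_measurable (lebesgue_on {a..b})"
      by (intro continuous_imp_measurable_on_sets_lebesgue ck) auto
    moreover have "c' \<in> borel_measurable (lebesgue_on {a..b})"
      using c'(1) by (intro measurable_restrict_space1) (simp add: measurable_completion)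
    ultimately have meas: "(\<lambda>x. (k x / (c x - p)) * c' x) \<in> borel_measurable (lebesgue_on {a..b})"
      by (rule borel_measurable_times)
    have bd: "norm ((k x / (c x - p)) * c' x) \<le> B * C" if "x \<in> {a..b}" for x
      unfolding norm_mult using B[OF that] c'(2)[of x] order_trans[OF norm_ge_zero B[OF that]]
      by (intro mult_mono) auto
    have "(\<lambda>x. (k x / (c x - p)) * c' x) integrable_on {a..b}"
      by (rule measurable_bounded_by_integrable_imp_integrable[OF meas _ bd])
         (simp_all add: integrable_const_ivl)
    then show ?thesis by simp
  qed
  show i1: "(\<lambda>x. c' x / (c x - p)) integrable_on {a..b}" using int[of "\<lambda>_. 1"] by simp
  have contF: "continuous_on {a..b} (\<lambda>x. F (c x))"
    by (rule continuous_on_compose2[OF holomorphic_on_imp_continuous_on[OF F] contc]) (use c(4) U in auto)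
  then show i2: "(\<lambda>x. F (c x) * (c' x / (c x - p))) integrable_on {a..b}" by (rule int)
  have "((\<lambda>x. (if c x = p then deriv F p else (F (c x) - F p) / (c x - p)) * c' x) has_integral P (c b) - P (c a)) {a..b}"
    by (rule has_integral_holomorphic_along_curve[OF c(1) U(1), where C=C
        and g="\<lambda>z. if z = p then deriv F p else (F z - F p) / (z - p)"]) (use P c U in auto)
  then have h1: "((\<lambda>x. F (c x) * (c' x / (c x - p)) - F p * (c' x / (c x - p))) has_integral P (c b) - P (c a)) {a..b}"
    by (rule has_integral_eq[rotated]) (use ne in \<open>simp add: diff_divide_distrib left_diff_distrib\<close>)
  have h2: "((\<lambda>x. F (c x) * (c' x / (c x - p)) - F p * (c' x / (c x - p))) has_integral
      integral {a..b} (\<lambda>x. F (c x) * (c' x / (c x - p))) - F p * integral {a..b} (\<lambda>x. c' x / (c x - p))) {a..b}"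
    by (intro has_integral_diff has_integral_mult_right integrable_integral i1 i2)
  from has_integral_unique[OF h1 h2]
  show "integral {a..b} (\<lambda>x. F (c x) * (c' x / (c x - p)))
      = F p * integral {a..b} (\<lambda>x. c' x / (c x - p)) + (P (c b) - P (c a))" by (simp add: algebra_simps)
qed

end

context ccw_convex_body
begin

text \<open>The contour runs from \<zeta> straight to \<gamma> s1, along the curve to \<gamma> s2
  and straight back. Its winding number about p need not be computed: it suffices that the imaginary
  part of the integral of dz / (z - p) is at least w. The first edge contributes w by the wedge
  hypothesis, and on the other pieces the angle about p does not decrease.\<close>

lemma cauchy_estimate_holomorphic:
  assumes U: "open U" "convex U" "\<Omega> \<subseteq> U" and F: "F holomorphic_on U"
    and \<zeta>: "\<zeta> \<in> \<Omega>" and s: "s1 \<le> s2" and m: "0 < m"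
    and edge1: "\<And>u. \<lbrakk>0 \<le> u; u \<le> 1\<rbrakk> \<Longrightarrow> m \<le> norm (\<zeta> + u *\<^sub>R (\<gamma> s1 - \<zeta>) - p)"
    and edge2: "\<And>u. \<lbrakk>0 \<le> u; u \<le> 1\<rbrakk> \<Longrightarrow> m \<le> norm (\<gamma> s2 + u *\<^sub>R (\<zeta> - \<gamma> s2) - p)"
    and B1: "\<And>u. \<lbrakk>0 \<le> u; u \<le> 1\<rbrakk> \<Longrightarrow> norm (F (\<zeta> + u *\<^sub>R (\<gamma> s1 - \<zeta>))) \<le> B"
    and B2: "\<And>u. \<lbrakk>0 \<le> u; u \<le> 1\<rbrakk> \<Longrightarrow> norm (F (\<gamma> s2 + u *\<^sub>R (\<zeta> - \<gamma> s2))) \<le> B"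
    and w1: "w * diam\<^sup>2 \<le> wedge (\<zeta> - p) (\<gamma> s1 - \<zeta>)" and w2: "0 \<le> wedge (\<zeta> - p) (\<zeta> - \<gamma> s2)" and w: "0 \<le> w"
  shows "norm (F p) * w \<le> 2 * (diam / m) * B + (1 / r) * integral {s1..s2} (\<lambda>s. norm (F (\<gamma> s)))"
proof -
  obtain P where P: "\<And>z. z \<in> U \<Longrightarrow>
    (P has_field_derivative (if z = p then deriv F p else (F z - F p) / (z - p))) (at z)"
    using cauchy_kernel_primitive[OF U F] by blast
  have d0: "0 < diam" using r_pos r_le_diam by linarith
  have gr: "r \<le> norm (\<gamma> s - p)" for s
    using frontier_dist[OF \<gamma>_frontier] by (simp add: dist_norm norm_minus_commute)
  have lin_der: "((\<lambda>u. x + u *\<^sub>R (y - x)) has_vector_derivative (y - x)) (at_right v)" for x y :: complex and v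
    by (auto intro!: derivative_eq_intros)
  have lin_lip: "norm ((x + u *\<^sub>R (y - x)) - (x + v *\<^sub>R (y - x))) \<le> norm (y - x) * \<bar>u - v\<bar>" for x y :: complex and u v
    by (simp add: scaleR_diff_left[symmetric] mult.commute)
  define q1 where "q1 u = (\<gamma> s1 - \<zeta>) / (\<zeta> + u *\<^sub>R (\<gamma> s1 - \<zeta>) - p)" for u
  define q2 where "q2 s = rt s / (\<gamma> s - p)" for s
  define q3 where "q3 u = (\<zeta> - \<gamma> s2) / (\<gamma> s2 + u *\<^sub>R (\<zeta> - \<gamma> s2) - p)" for u
  have i1: "q1 integrable_on {0..1}" "(\<lambda>u. F (\<zeta> + u *\<^sub>R (\<gamma> s1 - \<zeta>)) * q1 u) integrable_on {0..1}"
    and e1: "integral {0..1} (\<lambda>u. F (\<zeta> + u *\<^sub>R (\<gamma> s1 - \<zeta>)) * q1 u) = F p * integral {0..1} q1 + (P (\<gamma> s1) - P \<zeta>)"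
    unfolding q1_def[abs_def]
    using cauchy_kernel_piece[OF U(1,3) F P, of 0 1 "\<lambda>u. \<zeta> + u *\<^sub>R (\<gamma> s1 - \<zeta>)" "norm (\<gamma> s1 - \<zeta>)" "\<lambda>_. \<gamma> s1 - \<zeta>" m]
      lin_lip lin_der segment_mem[OF \<zeta> \<gamma>_mem] edge1 m by auto
  have i3: "q3 integrable_on {0..1}" "(\<lambda>u. F (\<gamma> s2 + u *\<^sub>R (\<zeta> - \<gamma> s2)) * q3 u) integrable_on {0..1}"
    and e3: "integral {0..1} (\<lambda>u. F (\<gamma> s2 + u *\<^sub>R (\<zeta> - \<gamma> s2)) * q3 u) = F p * integral {0..1} q3 + (P \<zeta> - P (\<gamma> s2))"
    unfolding q3_def[abs_def]
    using cauchy_kernel_piece[OF U(1,3) F P, of 0 1 "\<lambda>u. \<gamma> s2 + u *\<^sub>R (\<zeta> - \<gamma> s2)" "norm (\<zeta> - \<gamma> s2)" "\<lambda>_. \<zeta> - \<gamma> s2" m]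
      lin_lip lin_der segment_mem[OF \<gamma>_mem \<zeta>] edge2 m by auto
  have i2: "q2 integrable_on {s1..s2}" "(\<lambda>s. F (\<gamma> s) * q2 s) integrable_on {s1..s2}"
    and e2: "integral {s1..s2} (\<lambda>s. F (\<gamma> s) * q2 s) = F p * integral {s1..s2} q2 + (P (\<gamma> s2) - P (\<gamma> s1))"
    unfolding q2_def[abs_def]
    using cauchy_kernel_piece[OF U(1,3) F P, of s1 s2 \<gamma> 1 rt r]
      s \<gamma>_lipschitz rt \<gamma>_mem gr rt_measurable r_pos by auto
  \<comment> \<open>The integral of dz / (z - p) round the closed contour; what follows bounds its
    modulus from below through its imaginary part.\<close>
  define W where "W = integral {0..1} q1 + integral {s1..s2} q2 + integral {0..1} q3"
  have FW: "F p * W = integral {0..1} (\<lambda>u. F (\<zeta> + u *\<^sub>R (\<gamma> s1 - \<zeta>)) * q1 u)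
      + integral {s1..s2} (\<lambda>s. F (\<gamma> s) * q2 s) + integral {0..1} (\<lambda>u. F (\<gamma> s2 + u *\<^sub>R (\<zeta> - \<gamma> s2)) * q3 u)"
    unfolding e1 e2 e3 W_def by (simp add: algebra_simps)
  have Im_int: "Im (integral S q) = integral S (\<lambda>x. Im (q x))" "(\<lambda>x. Im (q x)) integrable_on S"
    if "q integrable_on S" for q :: "real \<Rightarrow> complex" and S
    using has_integral_linear[OF integrable_integral[OF that] bounded_linear_Im]
    unfolding o_def by (auto simp: integral_unique has_integral_integrable)
  have "w \<le> Im (integral {0..1} q1)"
  proof -
    have "w \<le> Im (q1 u)" if "u \<in> {0..1}" for u
    proof -
      define z where "z = \<zeta> + u *\<^sub>R (\<gamma> s1 - \<zeta>)"
      have "z \<in> \<Omega>" unfolding z_def using that by (intro segment_mem \<zeta> \<gamma>_mem) auto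
      then have "norm (z - p) \<le> diam" using p_mem by (intro mem_diam)
      then have "w * (norm (z - p))\<^sup>2 \<le> w * diam\<^sup>2" using w by (intro mult_left_mono power_mono) auto
      also have "\<dots> \<le> wedge (z - p) (\<gamma> s1 - \<zeta>)" using w1 by (simp add: z_def wedge_def algebra_simps)
      finally have "w * (norm (z - p))\<^sup>2 \<le> wedge (z - p) (\<gamma> s1 - \<zeta>)" .
      moreover have "0 < norm (z - p)" using edge1[of u] m that by (auto simp: z_def intro: less_le_trans)
      then have "0 < (norm (z - p))\<^sup>2" by (rule zero_less_power)
      ultimately show ?thesis
        unfolding q1_def Im_divide_wedge z_def[symmetric] by (simp only: pos_le_divide_eq)
    qed
    then have "integral {0..1} (\<lambda>_::real. w) \<le> integral {0..1} (\<lambda>u. Im (q1 u))"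
      by (intro integral_le Im_int i1) auto
    then show ?thesis by (simp add: Im_int i1)
  qed
  moreover have "0 \<le> Im (integral {s1..s2} q2)"
  proof -
    have "0 \<le> Im (q2 s)" for s
    proof -
      have "wedge (\<gamma> s - p) (rt s) = wedge (rt s) (p - \<gamma> s)" by (simp add: wedge_def algebra_simps)
      then show ?thesis unfolding q2_def Im_divide_wedge using rt_gap[of s] r_pos by simp
    qed
    then show ?thesis by (simp add: Im_int i2 integral_nonneg)
  qed
  moreover have "0 \<le> Im (integral {0..1} q3)"
  proof -
    have "0 \<le> Im (q3 u)" for u
    proof -
      have "wedge (\<gamma> s2 + u *\<^sub>R (\<zeta> - \<gamma> s2) - p) (\<zeta> - \<gamma> s2) = wedge (\<zeta> - p) (\<zeta> - \<gamma> s2)"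
        by (simp add: wedge_def algebra_simps)
      then show ?thesis unfolding q3_def Im_divide_wedge using w2 by simp
    qed
    then show ?thesis by (simp add: Im_int i3 integral_nonneg)
  qed
  ultimately have "w \<le> Im W" by (simp add: W_def)
  then have "w \<le> norm W" using abs_Im_le_cmod[of W] by linarith
  then have "norm (F p) * w \<le> norm (F p * W)" by (simp add: norm_mult mult_left_mono)
  also have "\<dots> \<le> diam / m * B + (1 / r) * integral {s1..s2} (\<lambda>s. norm (F (\<gamma> s))) + diam / m * B"
    unfolding FW
  proof (intro order_trans[OF norm_triangle_ineq] add_mono)
    have B0: "0 \<le> B" using B1[of 0] norm_ge_zero order_trans zero_le_one by blast
    have bd: "norm (X * (v / z)) \<le> diam / m * B" if "norm X \<le> B" "norm v \<le> diam" "m \<le> norm z" for X v z :: complex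
    proof -
      have "norm v / norm z \<le> diam / m" using that m d0 by (intro frac_le) auto
      then have "norm (v / z) * norm X \<le> diam / m * B"
        using that B0 d0 m by (intro mult_mono) (auto simp: norm_divide)
      then show ?thesis unfolding norm_mult[of X] by (simp only: mult.commute)
    qed
    have "norm (integral {0..1} (\<lambda>u. F (\<zeta> + u *\<^sub>R (\<gamma> s1 - \<zeta>)) * q1 u)) \<le> integral {0..1} (\<lambda>_::real. diam / m * B)"
      using edge1 B1 mem_diam[OF \<gamma>_mem \<zeta>] unfolding q1_def[abs_def]
      by (intro integral_norm_bound_integral i1[unfolded q1_def[abs_def]] bd) auto
    then show "norm (integral {0..1} (\<lambda>u. F (\<zeta> + u *\<^sub>R (\<gamma> s1 - \<zeta>)) * q1 u)) \<le> diam / m * B" by simp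
    have "norm (integral {0..1} (\<lambda>u. F (\<gamma> s2 + u *\<^sub>R (\<zeta> - \<gamma> s2)) * q3 u)) \<le> integral {0..1} (\<lambda>_::real. diam / m * B)"
      using edge2 B2 mem_diam[OF \<zeta> \<gamma>_mem] unfolding q3_def[abs_def]
      by (intro integral_norm_bound_integral i3[unfolded q3_def[abs_def]] bd) auto
    then show "norm (integral {0..1} (\<lambda>u. F (\<gamma> s2 + u *\<^sub>R (\<zeta> - \<gamma> s2)) * q3 u)) \<le> diam / m * B" by simp
    have cF: "(\<lambda>s. norm (F (\<gamma> s))) integrable_on {s1..s2}"
      by (intro integrable_continuous_real continuous_on_norm
          continuous_on_compose2[OF holomorphic_on_imp_continuous_on[OF F] \<gamma>_continuous]) (use \<gamma>_mem U in auto)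
    have "norm (F (\<gamma> s) * q2 s) \<le> (1 / r) * norm (F (\<gamma> s))" for s
    proof -
      have "norm (q2 s) \<le> 1 / r" unfolding q2_def norm_divide rt(2) using gr[of s] r_pos by (intro frac_le) auto
      then have "norm (q2 s) * norm (F (\<gamma> s)) \<le> (1 / r) * norm (F (\<gamma> s))" by (intro mult_right_mono) auto
      then show ?thesis by (simp add: norm_mult mult.commute)
    qed
    then have "norm (integral {s1..s2} (\<lambda>s. F (\<gamma> s) * q2 s)) \<le> integral {s1..s2} (\<lambda>s. (1 / r) * norm (F (\<gamma> s)))"
      by (intro integral_norm_bound_integral i2 integrable_on_mult_right cF)
    then show "norm (integral {s1..s2} (\<lambda>s. F (\<gamma> s) * q2 s)) \<le> (1 / r) * integral {s1..s2} (\<lambda>s. norm (F (\<gamma> s)))"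
      by simp
  qed
  finally show ?thesis by (simp add: mult_ac)
qed

lemma cauchy_estimate:
  assumes f: "continuous_on \<Omega> f" "f holomorphic_on interior \<Omega>"
    and \<zeta>: "\<zeta> \<in> \<Omega>" and s: "s1 \<le> s2" and m: "0 < m"
    and edge1: "\<And>u. \<lbrakk>0 \<le> u; u \<le> 1\<rbrakk> \<Longrightarrow> m \<le> norm (\<zeta> + u *\<^sub>R (\<gamma> s1 - \<zeta>) - p)"
    and edge2: "\<And>u. \<lbrakk>0 \<le> u; u \<le> 1\<rbrakk> \<Longrightarrow> m \<le> norm (\<gamma> s2 + u *\<^sub>R (\<zeta> - \<gamma> s2) - p)"
    and B1: "\<And>u. \<lbrakk>0 \<le> u; u \<le> 1\<rbrakk> \<Longrightarrow> norm (f (\<zeta> + u *\<^sub>R (\<gamma> s1 - \<zeta>))) \<le> B"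
    and B2: "\<And>u. \<lbrakk>0 \<le> u; u \<le> 1\<rbrakk> \<Longrightarrow> norm (f (\<gamma> s2 + u *\<^sub>R (\<zeta> - \<gamma> s2))) \<le> B"
    and w1: "w * diam\<^sup>2 \<le> wedge (\<zeta> - p) (\<gamma> s1 - \<zeta>)" and w2: "0 \<le> wedge (\<zeta> - p) (\<zeta> - \<gamma> s2)" and w: "0 \<le> w"
  shows "norm (f p) * w \<le> 2 * (diam / m) * B + (1 / r) * integral {s1..s2} (\<lambda>s. norm (f (\<gamma> s)))"
proof -
  define I where "I = integral {s1..s2} (\<lambda>s. norm (f (\<gamma> s)))"
  \<comment> \<open>K collects the coefficients of \<epsilon> when F, its bound on the edges and its
    integral over the arc are replaced by those of f, so that \<epsilon> can tend to 0.\<close>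
  define K where "K = w + 2 * (diam / m) + (1 / r) * (s2 - s1)"
  have cf: "(\<lambda>s. norm (f (\<gamma> s))) integrable_on {s1..s2}"
    by (intro integrable_continuous_real continuous_on_norm continuous_on_compose2[OF f(1) \<gamma>_continuous])
       (use \<gamma>_mem in auto)
  have "norm (f p) * w \<le> 2 * (diam / m) * B + (1 / r) * I + \<epsilon> * K" if \<epsilon>: "0 < \<epsilon>" for \<epsilon>
  proof -
    obtain U F where UF: "open U" "convex U" "\<Omega> \<subseteq> U" "F holomorphic_on U" "\<And>z. z \<in> \<Omega> \<Longrightarrow> norm (F z - f z) \<le> \<epsilon>"
      by (rule analytic_approx[OF f \<epsilon>]) blast
    have le: "norm (F z) \<le> norm (f z) + \<epsilon>" "norm (f z) \<le> norm (F z) + \<epsilon>" if "z \<in> \<Omega>" for z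
      using UF(5)[OF that] norm_triangle_ineq2[of "F z" "f z"] norm_triangle_ineq3[of "F z" "f z"] by linarith+
    have b1: "norm (F (\<zeta> + u *\<^sub>R (\<gamma> s1 - \<zeta>))) \<le> B + \<epsilon>" if "0 \<le> u" "u \<le> 1" for u
      using le(1)[OF segment_mem[OF \<zeta> \<gamma>_mem that]] B1[OF that] order_trans add_right_mono by blast
    have b2: "norm (F (\<gamma> s2 + u *\<^sub>R (\<zeta> - \<gamma> s2))) \<le> B + \<epsilon>" if "0 \<le> u" "u \<le> 1" for u
      using le(1)[OF segment_mem[OF \<gamma>_mem \<zeta> that]] B2[OF that] order_trans add_right_mono by blast
    have cF: "(\<lambda>s. norm (F (\<gamma> s))) integrable_on {s1..s2}"
      by (intro integrable_continuous_real continuous_on_norm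
          continuous_on_compose2[OF holomorphic_on_imp_continuous_on[OF UF(4)] \<gamma>_continuous]) (use \<gamma>_mem UF in auto)
    have "integral {s1..s2} (\<lambda>s. norm (F (\<gamma> s))) \<le> integral {s1..s2} (\<lambda>s. norm (f (\<gamma> s)) + \<epsilon>)"
      by (intro integral_le cF integrable_add cf integrable_const_ivl le \<gamma>_mem)
    also have "\<dots> = I + \<epsilon> * (s2 - s1)"
      unfolding I_def using s by (subst integral_add) (auto intro: cf)
    finally have int: "integral {s1..s2} (\<lambda>s. norm (F (\<gamma> s))) \<le> I + \<epsilon> * (s2 - s1)" .
    have "norm (f p) * w \<le> (norm (F p) + \<epsilon>) * w" using le(2)[OF p_mem] w by (intro mult_right_mono)
    also have "\<dots> = norm (F p) * w + \<epsilon> * w" by (simp add: algebra_simps)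
    also have "norm (F p) * w \<le> 2 * (diam / m) * (B + \<epsilon>) + (1 / r) * integral {s1..s2} (\<lambda>s. norm (F (\<gamma> s)))"
      by (rule cauchy_estimate_holomorphic[OF UF(1-4) \<zeta> s m edge1 edge2 b1 b2 w1 w2 w])
    also have "(1 / r) * integral {s1..s2} (\<lambda>s. norm (F (\<gamma> s))) \<le> (1 / r) * (I + \<epsilon> * (s2 - s1))"
      using int r_pos by (intro mult_left_mono) auto
    finally have "norm (f p) * w \<le> 2 * (diam / m) * (B + \<epsilon>) + (1 / r) * (I + \<epsilon> * (s2 - s1)) + \<epsilon> * w" by simp
    also have "\<dots> = 2 * (diam / m) * B + (1 / r) * I + \<epsilon> * K"
    proof -
      have "2 * a * (B + \<epsilon>) + b * (I + \<epsilon> * (s2 - s1)) + \<epsilon> * w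
          = 2 * a * B + b * I + \<epsilon> * (w + 2 * a + b * (s2 - s1))" for a b
        by (simp add: algebra_simps)
      then show ?thesis unfolding K_def .
    qed
    finally show ?thesis .
  qed
  moreover have "0 < K + 1"
  proof -
    have "0 \<le> 2 * (diam / m)" "0 \<le> (1 / r) * (s2 - s1)" using s m r_pos r_le_diam by simp_all
    then show ?thesis using w by (simp add: K_def)
  qed
  ultimately have "norm (f p) * w \<le> (2 * (diam / m) * B + (1 / r) * I) + e" if "0 < e" for e
  proof -
    have e: "0 < e / (K + 1)" using that \<open>0 < K + 1\<close> by simp
    have "e / (K + 1) * K \<le> e / (K + 1) * (K + 1)" using e by (intro mult_left_mono) auto
    also have "\<dots> = e" using \<open>0 < K + 1\<close> by simp
    finally show ?thesis using \<open>\<And>\<epsilon>. 0 < \<epsilon> \<Longrightarrow> norm (f p) * w \<le> _\<close>[OF e] by linarith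
  qed
  then show ?thesis unfolding I_def[symmetric] by (rule field_le_epsilon)
qed

end

section \<open>The cone estimate\<close>

lemma wedge_le_norm: "\<bar>wedge u v\<bar> \<le> norm u * norm v"
  using abs_Im_le_cmod[of "cnj u * v"] by (simp add: wedge_eq_Im_cnj norm_mult)

lemma wedge_mult: "wedge (u * e) (v * e) = wedge u v * (norm e)\<^sup>2"
  unfolding cmod_power2 by (simp add: wedge_def power2_eq_square algebra_simps)

text \<open>The absolute value of the sine is the distance from 1 to the line through 0 with
  direction \<open>cis \<delta>\<close>.\<close>

lemma norm_scaleR_cis_minus_1: "\<bar>sin \<delta>\<bar> \<le> norm (x *\<^sub>R cis \<delta> - 1)"
proof -
  have "x *\<^sub>R cis \<delta> - 1 = cis \<delta> * (of_real x - cis (- \<delta>))"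
    by (simp add: algebra_simps cis_mult scaleR_conv_of_real)
  then have "norm (x *\<^sub>R cis \<delta> - 1) = norm (of_real x - cis (- \<delta>))" by (simp add: norm_mult)
  then show ?thesis using abs_Im_le_cmod[of "of_real x - cis (- \<delta>)"] by simp
qed

context ccw_convex_body
begin

lemma diam_pos: "0 < diam" using r_pos r_le_diam by linarith

lemma norm_axis: "r \<le> norm (p - \<gamma> t)" "norm (p - \<gamma> t) \<le> diam"
  using frontier_dist[OF \<gamma>_frontier[of t]] mem_diam[OF p_mem \<gamma>_mem] by (simp_all add: dist_norm)

text \<open>The foot q of the perpendicular from p to the ray is within r / 2 of p, so \<Omega>
  contains a disc of radius r / 2 about q. The radial function about q then locates the point where
  the ray leaves \<Omega>, beyond the foot; hence \<rho> is at least cos \<delta>.\<close>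

lemma ray_hits_boundary:
  assumes \<delta>: "\<bar>sin \<delta>\<bar> \<le> r / (2 * diam)" "0 < cos \<delta>"
  obtains s \<rho> where "t < s" "s < t + L" "cos \<delta> \<le> \<rho>" "\<gamma> s = \<gamma> t + \<rho> *\<^sub>R cis \<delta> * (p - \<gamma> t)"
proof -
  define e where "e = p - \<gamma> t"
  define q where "q = \<gamma> t + cos \<delta> *\<^sub>R cis \<delta> * e"
  have e: "norm e > 0" using p_neq by (simp add: e_def)
  have "q - p = e * (cos \<delta> *\<^sub>R cis \<delta> - 1)" by (simp add: q_def e_def algebra_simps)
  moreover have "norm (cos \<delta> *\<^sub>R cis \<delta> - 1) = \<bar>sin \<delta>\<bar>"
  proof -
    have "cos \<delta> *\<^sub>R cis \<delta> - 1 = sin \<delta> *\<^sub>R (\<i> * cis \<delta>)"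
      using sin_squared_eq[of \<delta>] by (simp add: complex_eq_iff power2_eq_square mult.commute)
    then show ?thesis by (simp add: norm_mult)
  qed
  ultimately have "norm (q - p) = norm e * \<bar>sin \<delta>\<bar>" by (simp add: norm_mult)
  also have "\<dots> \<le> diam * (r / (2 * diam))"
    using norm_axis[of t] \<delta> diam_pos by (intro mult_mono) (auto simp: e_def)
  also have "\<dots> = r / 2" using diam_pos by simp
  finally have "cball q (r / 2) \<subseteq> cball p r"
    using r_pos by (simp add: cball_subset_cball_iff dist_norm)
  then interpret q: convex_body \<Omega> q "r / 2"
    using compact convex r_pos cball_subset by unfold_locales auto
  define \<phi> where "\<phi> = Arg (cis \<delta> * e)"
  have "cis \<phi> = sgn (cis \<delta> * e)" unfolding \<phi>_def using e by (intro cis_Arg) auto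
  then have c: "cis \<phi> = (1 / norm e) *\<^sub>R (cis \<delta> * e)" by (simp add: sgn_div_norm norm_mult inverse_eq_divide)
  define \<rho> where "\<rho> = cos \<delta> + q.radius \<phi> / norm e"
  have \<rho>: "cos \<delta> \<le> \<rho>" using q.radius_pos[of \<phi>] e by (simp add: \<rho>_def)
  have "q + q.radius \<phi> *\<^sub>R cis \<phi> = \<gamma> t + \<rho> *\<^sub>R cis \<delta> * e"
    unfolding c q_def \<rho>_def by (simp add: scaleR_conv_of_real algebra_simps)
  then have "\<gamma> t + \<rho> *\<^sub>R cis \<delta> * e \<in> frontier \<Omega>" using q.radius_frontier[of \<phi>] by simp
  then obtain s where s: "t \<le> s" "s < t + L" "\<gamma> s = \<gamma> t + \<rho> *\<^sub>R cis \<delta> * e" by (rule frontier_\<gamma>)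
  moreover have "s \<noteq> t" using s(3) \<rho> \<delta>(2) e by auto
  ultimately show ?thesis using that[of s \<rho>] \<rho> by (simp add: e_def)
qed

text \<open>Since \<gamma> s lies in the cone, the line through \<gamma> t and \<gamma> s passes a
  point q within r / 2 of p. The tangent at \<gamma> s is at distance at least r from p, hence at
  least r / 2 from q, so it crosses that line at a definite angle: the wedge of \<gamma> s -
  \<gamma> t and the tangent is at least r / 2. Dividing by the squared chord gives the
  bound.\<close>

lemma dlog_cone_lower_bound:
  assumes \<beta>: "0 < sin \<beta>" "sin \<beta> \<le> r / (2 * diam)" "0 < cos \<beta>" and ne: "\<gamma> s \<noteq> \<gamma> t"
    and c1: "0 \<le> wedge (cis (- \<beta>) * (p - \<gamma> t)) (\<gamma> s - \<gamma> t)"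
    and c2: "0 \<le> wedge (\<gamma> s - \<gamma> t) (cis \<beta> * (p - \<gamma> t))"
  shows "r / (2 * diam\<^sup>2) \<le> dlog t s"
proof -
  define e where "e = p - \<gamma> t"
  define v where "v = \<gamma> s - \<gamma> t"
  define V where "V = v / e"
  define x y where "x = Re V" and "y = Im V"
  have e: "e \<noteq> 0" using p_neq by (simp add: e_def)
  have v: "v = V * e" using e by (simp add: V_def)
  have V0: "V \<noteq> 0" using ne e by (simp add: V_def v_def)
  have e2: "0 < (norm e)\<^sup>2" using e by simp
  have "0 \<le> wedge (cis (- \<beta>)) V" "0 \<le> wedge V (cis \<beta>)"
    using c1 c2 e2 unfolding e_def[symmetric] v_def[symmetric] v wedge_mult by (simp_all add: zero_le_mult_iff)
  then have xy: "0 \<le> cos \<beta> * y + sin \<beta> * x" "0 \<le> sin \<beta> * x - cos \<beta> * y"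
    by (simp_all add: wedge_def x_def y_def algebra_simps)
  have "0 \<le> sin \<beta> * x" using xy by linarith
  then have x0: "0 \<le> x" using \<beta>(1) by (simp add: zero_le_mult_iff)
  have V2: "(norm V)\<^sup>2 = x\<^sup>2 + y\<^sup>2" by (simp add: cmod_power2 x_def y_def)
  have Vpos: "0 < (norm V)\<^sup>2" using V0 by simp
  \<comment> \<open>l V is the orthogonal projection of 1 onto the line spanned by V, that is, of p
    onto the line through \<gamma> t and \<gamma> s.\<close>
  define l where "l = x / (norm V)\<^sup>2"
  have l0: "0 \<le> l" using x0 by (simp add: l_def)
  have foot: "norm (l *\<^sub>R V - 1) \<le> sin \<beta>"
  proof -
    have "\<bar>cos \<beta> * y\<bar> \<le> \<bar>sin \<beta> * x\<bar>" using xy \<open>0 \<le> sin \<beta> * x\<close> by linarith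
    then have "(cos \<beta> * y)\<^sup>2 \<le> (sin \<beta> * x)\<^sup>2" by (simp only: abs_le_square_iff)
    then have "(cos \<beta>)\<^sup>2 * y\<^sup>2 + (sin \<beta>)\<^sup>2 * y\<^sup>2 \<le> (sin \<beta>)\<^sup>2 * x\<^sup>2 + (sin \<beta>)\<^sup>2 * y\<^sup>2"
      by (simp add: power_mult_distrib)
    moreover have "(cos \<beta>)\<^sup>2 * y\<^sup>2 + (sin \<beta>)\<^sup>2 * y\<^sup>2 = y\<^sup>2"
      by (metis distrib_right mult_1 sin_cos_squared_add2)
    ultimately have y2: "y\<^sup>2 \<le> (sin \<beta>)\<^sup>2 * (norm V)\<^sup>2" unfolding V2 by (simp add: distrib_left)
    have "(norm (l *\<^sub>R V - 1))\<^sup>2 = (l * x - 1)\<^sup>2 + (l * y)\<^sup>2" by (simp add: cmod_power2 x_def y_def)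
    also have "\<dots> = l\<^sup>2 * (norm V)\<^sup>2 - 2 * (l * x) + 1"
      unfolding V2 by (simp add: power2_eq_square algebra_simps)
    also have "l\<^sup>2 * (norm V)\<^sup>2 = l * x" using Vpos by (simp add: l_def power2_eq_square)
    also have "l * x - 2 * (l * x) + 1 = 1 - l * x" by simp
    also have "\<dots> = y\<^sup>2 / (norm V)\<^sup>2"
    proof -
      have "l * x = x\<^sup>2 / (norm V)\<^sup>2" by (simp add: l_def power2_eq_square)
      moreover have "1 = (norm V)\<^sup>2 / (norm V)\<^sup>2" using Vpos by simp
      ultimately have "1 - l * x = ((norm V)\<^sup>2 - x\<^sup>2) / (norm V)\<^sup>2" by (simp only: diff_divide_distrib)
      then show ?thesis by (simp add: V2)
    qed
    also have "\<dots> \<le> (sin \<beta>)\<^sup>2" using y2 Vpos by (simp add: pos_divide_le_eq)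
    finally have "(norm (l *\<^sub>R V - 1))\<^sup>2 \<le> (sin \<beta>)\<^sup>2" .
    then show ?thesis using less_imp_le[OF \<beta>(1)] by (rule power2_le_imp_le)
  qed
  define q where "q = \<gamma> t + l *\<^sub>R v"
  have "q - p = (l *\<^sub>R V - 1) * e" by (simp add: q_def v e_def algebra_simps)
  then have "norm (q - p) = norm (l *\<^sub>R V - 1) * norm e" by (simp only: norm_mult)
  also have "\<dots> \<le> sin \<beta> * norm e" using foot by (rule mult_right_mono) simp
  also have "\<dots> \<le> r / (2 * diam) * diam"
    using \<beta> norm_axis[of t] by (intro mult_mono) (auto simp: e_def)
  also have "\<dots> = r / 2" using diam_pos by simp
  finally have qp: "norm (q - p) \<le> r / 2" .
  have "wedge (rt s) (q - \<gamma> s) = wedge (rt s) (p - \<gamma> s) + wedge (rt s) (q - p)"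
    by (simp add: wedge_def algebra_simps)
  moreover have "- norm (q - p) \<le> wedge (rt s) (q - p)"
    using wedge_le_norm[of "rt s" "q - p"] rt(2)[of s] by simp
  ultimately have "r / 2 \<le> wedge (rt s) (q - \<gamma> s)" using rt_gap[of s] qp by linarith
  also have "wedge (rt s) (q - \<gamma> s) = (1 - l) * wedge v (rt s)"
    by (simp add: q_def v_def wedge_def algebra_simps)
  finally have lw: "r / 2 \<le> (1 - l) * wedge v (rt s)" .
  have "wedge v (rt s) = wedge (rt s) (\<gamma> t - \<gamma> s)" by (simp add: v_def wedge_def algebra_simps)
  then have w0: "0 \<le> wedge v (rt s)" using rt_support[OF \<gamma>_mem] by simp
  then have "(1 - l) * wedge v (rt s) \<le> 1 * wedge v (rt s)" using l0 by (intro mult_right_mono) auto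
  with lw have half: "r / 2 \<le> wedge v (rt s)" by linarith
  have "norm v \<le> diam" unfolding v_def by (intro mem_diam \<gamma>_mem)
  then have nv: "(norm v)\<^sup>2 \<le> diam\<^sup>2" by (intro power_mono) auto
  have "v \<noteq> 0" using ne by (simp add: v_def)
  have "r / (2 * diam\<^sup>2) = (r / 2) / diam\<^sup>2" by simp
  also have "\<dots> \<le> wedge v (rt s) / (norm v)\<^sup>2"
    using half nv w0 \<open>v \<noteq> 0\<close> r_pos by (intro frac_le) auto
  also have "\<dots> = dlog t s" unfolding dlog_def Im_divide_wedge v_def ..
  finally show ?thesis .
qed

lemma cone_arc:
  assumes \<beta>: "0 < sin \<beta>" "sin \<beta> \<le> r / (2 * diam)" "0 < cos \<beta>"
  obtains s1 s2 r1 r2 where "t < s1" "s1 < s2" "s2 < t + L" "cos \<beta> \<le> r1" "cos \<beta> \<le> r2"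
    "\<gamma> s1 = \<gamma> t + r1 *\<^sub>R cis (- \<beta>) * (p - \<gamma> t)" "\<gamma> s2 = \<gamma> t + r2 *\<^sub>R cis \<beta> * (p - \<gamma> t)"
    "\<And>s. \<lbrakk>s1 \<le> s; s \<le> s2\<rbrakk> \<Longrightarrow> r / (2 * diam\<^sup>2) \<le> dlog t s"
proof -
  define e where "e = p - \<gamma> t"
  have e2: "0 < (norm e)\<^sup>2" using p_neq[of t] by (simp add: e_def)
  obtain s1 r1 where 1: "t < s1" "s1 < t + L" "cos (- \<beta>) \<le> r1" "\<gamma> s1 = \<gamma> t + r1 *\<^sub>R cis (- \<beta>) * e"
    unfolding e_def by (rule ray_hits_boundary[of "- \<beta>" t]) (use \<beta> in auto)
  obtain s2 r2 where 2: "t < s2" "s2 < t + L" "cos \<beta> \<le> r2" "\<gamma> s2 = \<gamma> t + r2 *\<^sub>R cis \<beta> * e"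
    unfolding e_def by (rule ray_hits_boundary[of \<beta> t]) (use \<beta> in auto)
  have \<rho>: "0 < r1" "0 < r2" using 1(3) 2(3) \<beta>(3) by auto
  \<comment> \<open>The two edges enclose the angle 2 \<beta>, and sin (2 \<beta>) > 0 makes the
    wedge positive. With \<open>orientation\<close> its sign decides which of the two edges the
    curve meets first.\<close>
  have w12: "wedge (\<gamma> s1 - \<gamma> t) (\<gamma> s2 - \<gamma> t) = r1 * r2 * (2 * sin \<beta> * cos \<beta>) * (norm e)\<^sup>2"
    unfolding 1(4) 2(4) using wedge_mult[of "r1 *\<^sub>R cis (- \<beta>)" e "r2 *\<^sub>R cis \<beta>"]
    by (simp add: wedge_def algebra_simps)
  then have pos: "0 < wedge (\<gamma> s1 - \<gamma> t) (\<gamma> s2 - \<gamma> t)" using \<rho> \<beta> e2 by simp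
  have swap: "wedge v u = - wedge u v" for u v by (simp add: wedge_def)
  have "s1 \<noteq> s2" using pos by (auto simp: wedge_def)
  moreover have "\<not> s2 < s1"
    using orientation[of t s2 s1] 1 2 pos swap[of "\<gamma> s1 - \<gamma> t" "\<gamma> s2 - \<gamma> t"] by auto
  ultimately have s12: "s1 < s2" by linarith
  have lower: "r / (2 * diam\<^sup>2) \<le> dlog t s" if s: "s1 \<le> s" "s \<le> s2" for s
  proof (rule dlog_cone_lower_bound[OF \<beta>])
    show "\<gamma> s \<noteq> \<gamma> t" using s 1 2 by (intro \<gamma>_neq) auto
    have "0 \<le> wedge (\<gamma> s1 - \<gamma> t) (\<gamma> s - \<gamma> t)"
      using orientation[of t s1 s] s 1 2 by (cases "s = s1") (auto simp: wedge_def)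
    also have "\<dots> = r1 * wedge (cis (- \<beta>) * e) (\<gamma> s - \<gamma> t)"
      unfolding 1(4) by (simp add: wedge_def algebra_simps)
    finally show "0 \<le> wedge (cis (- \<beta>) * (p - \<gamma> t)) (\<gamma> s - \<gamma> t)"
      using \<rho> by (simp add: zero_le_mult_iff e_def)
    have "0 \<le> wedge (\<gamma> s - \<gamma> t) (\<gamma> s2 - \<gamma> t)"
      using orientation[of t s s2] s 1 2 by (cases "s = s2") (auto simp: wedge_def)
    also have "\<dots> = r2 * wedge (\<gamma> s - \<gamma> t) (cis \<beta> * e)"
      unfolding 2(4) by (simp add: wedge_def algebra_simps)
    finally show "0 \<le> wedge (\<gamma> s - \<gamma> t) (cis \<beta> * (p - \<gamma> t))"
      using \<rho> by (simp add: zero_le_mult_iff e_def)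
  qed
  show ?thesis using that[of s1 s2 r1 r2] 1 2 s12 lower by (simp add: e_def)
qed

text \<open>For the half-angle pi / (2 k) the k-th power sends both edges to the imaginary axis,
  where the weight has modulus 1, while at p the power equals 1. On the arc the quotient is at most
  diam / r in modulus, so the weight there has a bound that depends neither on t nor on h.\<close>

lemma carleman_estimate:
  fixes k :: nat and N B :: real
  defines "\<beta> \<equiv> pi / (2 * real k)"
  assumes k: "2 \<le> k" "sin \<beta> \<le> r / (2 * diam)" and N: "0 \<le> N"
    and h: "continuous_on \<Omega> h" "h holomorphic_on interior \<Omega>" "\<And>z. z \<in> \<Omega> \<Longrightarrow> norm (h z) \<le> B"
  obtains s1 s2 where "t < s1" "s1 \<le> s2" "s2 < t + L"
    "\<And>s. \<lbrakk>s1 \<le> s; s \<le> s2\<rbrakk> \<Longrightarrow> r / (2 * diam\<^sup>2) \<le> dlog t s"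
    "norm (h p) * exp N * (cos \<beta> * sin \<beta> * r\<^sup>2 / diam\<^sup>2)
      \<le> 2 * (diam / (r * sin \<beta>)) * B + (1 / r) * (exp (N * (diam / r) ^ k) * integral {s1..s2} (\<lambda>s. norm (h (\<gamma> s))))"
proof -
  have k\<beta>: "real k * \<beta> = pi / 2" using k by (simp add: \<beta>_def)
  have \<beta>0: "0 < \<beta>" using k by (simp add: \<beta>_def)
  have "2 * \<beta> \<le> real k * \<beta>" using k \<beta>0 by (intro mult_right_mono) auto
  then have \<beta>4: "\<beta> \<le> pi / 4" using k\<beta> by simp
  have sc: "0 < sin \<beta>" "0 < cos \<beta>" using \<beta>0 \<beta>4 pi_gt_zero by (auto intro!: sin_gt_zero cos_gt_zero)
  obtain s1 s2 r1 r2 where s: "t < s1" "s1 < s2" "s2 < t + L" "cos \<beta> \<le> r1" "cos \<beta> \<le> r2"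
    "\<gamma> s1 = \<gamma> t + r1 *\<^sub>R cis (- \<beta>) * (p - \<gamma> t)" "\<gamma> s2 = \<gamma> t + r2 *\<^sub>R cis \<beta> * (p - \<gamma> t)"
    "\<And>s. \<lbrakk>s1 \<le> s; s \<le> s2\<rbrakk> \<Longrightarrow> r / (2 * diam\<^sup>2) \<le> dlog t s"
    using cone_arc[OF sc(1) k(2) sc(2)] by blast
  define e where "e = p - \<gamma> t"
  have e0: "e \<noteq> 0" using p_neq by (simp add: e_def)
  have er: "r \<le> norm e" using norm_axis[of t] by (simp add: e_def)
  define f where "f z = h z * exp (of_real N * ((z - \<gamma> t) / e) ^ k)" for z
  have cf: "continuous_on \<Omega> f" unfolding f_def by (intro continuous_intros h) (simp add: e0)
  have hf: "f holomorphic_on interior \<Omega>" unfolding f_def by (intro holomorphic_intros h) (use e0 in auto)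
  have norm_f: "norm (f z) = norm (h z) * exp (N * Re (((z - \<gamma> t) / e) ^ k))" for z
    by (simp add: f_def norm_mult norm_exp_eq_Re)
  \<comment> \<open>In units of |e|, p is at distance sin \<beta> from each edge line, and |e| is at
    least r; this is the m of the Cauchy estimate.\<close>
  have edge_pt: "m \<le> norm (\<gamma> t + x *\<^sub>R cis \<delta> * e - p)"
    if "m = r * sin \<beta>" "\<bar>sin \<delta>\<bar> = sin \<beta>" for x \<delta> m
  proof -
    have "\<gamma> t + x *\<^sub>R cis \<delta> * e - p = (x *\<^sub>R cis \<delta> - 1) * e" by (simp add: e_def algebra_simps)
    then have "norm (\<gamma> t + x *\<^sub>R cis \<delta> * e - p) = norm (x *\<^sub>R cis \<delta> - 1) * norm e" by (simp add: norm_mult)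
    also have "\<dots> \<ge> sin \<beta> * r"
      using norm_scaleR_cis_minus_1[of \<delta> x] that er r_pos by (intro mult_mono) auto
    finally show ?thesis using that by (simp add: mult.commute)
  qed
  have edge_f: "norm (f (\<gamma> t + x *\<^sub>R cis \<delta> * e)) \<le> B"
    if "\<gamma> t + x *\<^sub>R cis \<delta> * e \<in> \<Omega>" "cos (real k * \<delta>) = 0" for x \<delta>
  proof -
    have "((\<gamma> t + x *\<^sub>R cis \<delta> * e - \<gamma> t) / e) ^ k = (of_real x * cis \<delta>) ^ k"
      using e0 by (simp add: scaleR_conv_of_real)
    also have "\<dots> = (x ^ k) *\<^sub>R cis (real k * \<delta>)"
      unfolding power_mult_distrib Complex.DeMoivre by (simp add: scaleR_conv_of_real)
    finally have "((\<gamma> t + x *\<^sub>R cis \<delta> * e - \<gamma> t) / e) ^ k = (x ^ k) *\<^sub>R cis (real k * \<delta>)" .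
    then have "Re (((\<gamma> t + x *\<^sub>R cis \<delta> * e - \<gamma> t) / e) ^ k) = 0" using that(2) by simp
    then show ?thesis unfolding norm_f using h(3)[OF that(1)] by simp
  qed
  have p1: "\<gamma> t + u *\<^sub>R (\<gamma> s1 - \<gamma> t) = \<gamma> t + (u * r1) *\<^sub>R cis (- \<beta>) * e" for u
    by (simp add: s(6) e_def[symmetric])
  have p2: "\<gamma> s2 + u *\<^sub>R (\<gamma> t - \<gamma> s2) = \<gamma> t + ((1 - u) * r2) *\<^sub>R cis \<beta> * e" for u
    by (simp add: s(7) e_def[symmetric] algebra_simps)
  have kc: "cos (real k * (- \<beta>)) = 0" "cos (real k * \<beta>) = 0" by (simp_all add: k\<beta>)
  have abs_sin: "\<bar>sin (- \<beta>)\<bar> = sin \<beta>" "\<bar>sin \<beta>\<bar> = sin \<beta>" using sc by auto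
  have re: "r\<^sup>2 \<le> (norm e)\<^sup>2" using er r_pos by (intro power_mono) auto
  have est: "norm (f p) * (cos \<beta> * sin \<beta> * r\<^sup>2 / diam\<^sup>2)
      \<le> 2 * (diam / (r * sin \<beta>)) * B + (1 / r) * integral {s1..s2} (\<lambda>s. norm (f (\<gamma> s)))"
  proof (rule cauchy_estimate[OF cf hf \<gamma>_mem[of t] less_imp_le[OF s(2)]])
    show "0 < r * sin \<beta>" using r_pos sc by simp
    show "r * sin \<beta> \<le> norm (\<gamma> t + u *\<^sub>R (\<gamma> s1 - \<gamma> t) - p)" for u
      unfolding p1 by (rule edge_pt[OF refl abs_sin(1)])
    show "r * sin \<beta> \<le> norm (\<gamma> s2 + u *\<^sub>R (\<gamma> t - \<gamma> s2) - p)" for u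
      unfolding p2 by (rule edge_pt[OF refl abs_sin(2)])
    show "norm (f (\<gamma> t + u *\<^sub>R (\<gamma> s1 - \<gamma> t))) \<le> B" if "0 \<le> u" "u \<le> 1" for u
      using edge_f[OF _ kc(1), of "u * r1"] segment_mem[OF \<gamma>_mem \<gamma>_mem that, of t s1] unfolding p1 by blast
    show "norm (f (\<gamma> s2 + u *\<^sub>R (\<gamma> t - \<gamma> s2))) \<le> B" if "0 \<le> u" "u \<le> 1" for u
      using edge_f[OF _ kc(2), of "(1 - u) * r2"] segment_mem[OF \<gamma>_mem \<gamma>_mem that, of s2 t] unfolding p2 by blast
    \<comment> \<open>The wedge equals r1 sin \<beta> |e|^2. With r1 at least cos \<beta> and |e| at
      least r, this explains the factor
      \<open>cos \<beta> * sin \<beta> * r\<^sup>2 / diam\<^sup>2\<close>.\<close>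
    have "wedge (\<gamma> t - p) (\<gamma> s1 - \<gamma> t) = wedge ((-1) * e) (r1 *\<^sub>R cis (- \<beta>) * e)"
      by (simp add: s(6) e_def)
    also have "\<dots> = r1 * sin \<beta> * (norm e)\<^sup>2" unfolding wedge_mult by (simp add: wedge_def)
    finally have w: "wedge (\<gamma> t - p) (\<gamma> s1 - \<gamma> t) = r1 * sin \<beta> * (norm e)\<^sup>2" .
    have "cos \<beta> * sin \<beta> * r\<^sup>2 \<le> r1 * sin \<beta> * (norm e)\<^sup>2"
      using s(4) sc re by (intro mult_mono) auto
    then show "cos \<beta> * sin \<beta> * r\<^sup>2 / diam\<^sup>2 * diam\<^sup>2 \<le> wedge (\<gamma> t - p) (\<gamma> s1 - \<gamma> t)"
      unfolding w using diam_pos by simp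
    have "wedge (\<gamma> t - p) (\<gamma> t - \<gamma> s2) = wedge ((-1) * e) ((- (r2 *\<^sub>R cis \<beta>)) * e)"
      by (simp add: s(7) e_def)
    also have "\<dots> = r2 * sin \<beta> * (norm e)\<^sup>2" unfolding wedge_mult by (simp add: wedge_def)
    finally show "0 \<le> wedge (\<gamma> t - p) (\<gamma> t - \<gamma> s2)" using s(5) sc by simp
    show "0 \<le> cos \<beta> * sin \<beta> * r\<^sup>2 / diam\<^sup>2" using sc by simp
  qed
  have "norm (f p) = norm (h p) * exp N" unfolding norm_f using e0 by (simp add: e_def)
  moreover have "integral {s1..s2} (\<lambda>s. norm (f (\<gamma> s)))
      \<le> integral {s1..s2} (\<lambda>s. exp (N * (diam / r) ^ k) * norm (h (\<gamma> s)))"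
  proof (rule integral_le)
    show "(\<lambda>s. norm (f (\<gamma> s))) integrable_on {s1..s2}"
      by (intro integrable_continuous_real continuous_on_norm continuous_on_compose2[OF cf \<gamma>_continuous])
         (use \<gamma>_mem in auto)
    show "(\<lambda>s. exp (N * (diam / r) ^ k) * norm (h (\<gamma> s))) integrable_on {s1..s2}"
      by (intro integrable_continuous_real continuous_on_mult continuous_on_const continuous_on_norm
          continuous_on_compose2[OF h(1) \<gamma>_continuous]) (use \<gamma>_mem in auto)
    fix s
    have "norm ((\<gamma> s - \<gamma> t) / e) \<le> diam / r"
      unfolding norm_divide using mem_diam[OF \<gamma>_mem \<gamma>_mem] er r_pos diam_pos by (intro frac_le) auto
    then have "norm (((\<gamma> s - \<gamma> t) / e) ^ k) \<le> (diam / r) ^ k"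
      unfolding norm_power by (intro power_mono) auto
    then have "Re (((\<gamma> s - \<gamma> t) / e) ^ k) \<le> (diam / r) ^ k"
      using complex_Re_le_cmod order_trans by blast
    then have "exp (N * Re (((\<gamma> s - \<gamma> t) / e) ^ k)) \<le> exp (N * (diam / r) ^ k)"
      using N by (simp add: mult_left_mono)
    then show "norm (f (\<gamma> s)) \<le> exp (N * (diam / r) ^ k) * norm (h (\<gamma> s))"
      unfolding norm_f by (subst mult.commute) (intro mult_right_mono, auto)
  qed
  then have "(1 / r) * integral {s1..s2} (\<lambda>s. norm (f (\<gamma> s)))
      \<le> (1 / r) * (exp (N * (diam / r) ^ k) * integral {s1..s2} (\<lambda>s. norm (h (\<gamma> s))))"
    using r_pos by (intro mult_left_mono) auto
  ultimately show ?thesis using that[of s1 s2] s est by (simp only:)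
qed

end

section \<open>The analytic configuration constant\<close>

lemma (in convex_body) exists_cone_exponent: "\<exists>k::nat. 2 \<le> k \<and> sin (pi / (2 * real k)) \<le> r / (2 * diam)"
proof -
  have d: "0 < diam" using r_pos r_le_diam by linarith
  obtain n :: nat where n: "pi * diam / r < real n" using reals_Archimedean2 by blast
  define k where "k = n + 2"
  have k: "pi * diam / r \<le> real k" "0 < real k" using n by (auto simp: k_def)
  have "sin (pi / (2 * real k)) \<le> pi / (2 * real k)" by (rule sin_x_le_x) simp
  also have "\<dots> \<le> r / (2 * diam)"
    using k r_pos d by (simp add: pos_divide_le_eq pos_le_divide_eq divide_simps mult.commute)
  finally show ?thesis by (intro exI[of _ k]) (simp add: k_def)
qed

context boundary_body
begin

lemma finite_measure_\<mu>: "finite_measure (\<mu> t)" if "0 \<le> t" "t < per"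
  using emeasure_\<mu>_space[OF that] by (intro finite_measureI) simp

lemma measure_\<mu>_space: "measure (\<mu> t) (space (\<mu> t)) = 1" if "0 \<le> t" "t < per"
  using emeasure_\<mu>_space[OF that] by (simp add: measure_def)

lemma continuous_measurable_bdry:
  fixes h :: "complex \<Rightarrow> 'b :: topological_space"
  assumes "continuous_on \<Omega> h"
  shows "h \<in> borel_measurable bdry"
  using continuous_on_subset[OF assms frontier_subset] by (rule borel_measurable_continuous_on_restrict)

lemma continuous_integrable_\<mu>:
  fixes h :: "complex \<Rightarrow> 'b :: {banach, second_countable_topology}"
  assumes "continuous_on \<Omega> h" "0 \<le> t" "t < per"
  shows "integrable (\<mu> t) h"
proof -
  have "bounded (h ` \<Omega>)" using compact_continuous_image[OF assms(1) compact] compact_imp_bounded by blast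
  then obtain B where "\<forall>y\<in>h ` \<Omega>. norm y \<le> B" unfolding bounded_iff by blast
  then have "norm (h z) \<le> B" if "z \<in> space (\<mu> t)" for z
    using that frontier_subset by (auto simp: space_\<mu>)
  moreover have "h \<in> borel_measurable (\<mu> t)"
    using continuous_measurable_bdry[OF assms(1)] measurable_cong_sets[OF sets_\<mu> refl] by blast
  ultimately show ?thesis
    by (intro finite_measure.integrable_const_bound[OF finite_measure_\<mu>[OF assms(2,3)]] AE_I2)
qed

lemma arc_integral_le:
  assumes h: "continuous_on \<Omega> h" and t: "0 \<le> t" "t < per"
    and s: "t < s1" "s1 \<le> s2" "s2 < t + per"
    and lower: "\<And>s. \<lbrakk>s1 \<le> s; s \<le> s2\<rbrakk> \<Longrightarrow> r / (2 * diam\<^sup>2) \<le> dlog t s"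
  shows "integral {s1..s2} (\<lambda>s. norm (h (\<beta> s))) \<le> 2 * pi * diam\<^sup>2 / r * (LINT z|\<mu> t. norm (h z :: complex))"
proof -
  \<comment> \<open>The reciprocal of the lower bound r / (2 diam^2) for the angular speed divided
    by pi, so that c times the density is at least 1 on the arc.\<close>
  define c where "c = 2 * pi * diam\<^sup>2 / r"
  have c0: "0 < c" using r_pos diam_pos by (simp add: c_def)
  have hb: "continuous_on UNIV (\<lambda>s. h (\<beta> s))"
    by (rule continuous_on_compose2[OF h \<gamma>_continuous]) (use \<gamma>_mem in auto)
  then have [measurable]: "(\<lambda>s. h (\<beta> s)) \<in> borel_measurable borel" by (rule borel_measurable_continuous_onI)
  define f where "f s = ennreal (dlog t s / pi) * ennreal (norm (h (\<beta> s)))" for s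
  have fm: "f \<in> borel_measurable borel" unfolding f_def[abs_def] by measurable
  have f_shift: "f (s + per) = f s" for s by (simp add: f_def dlog_shift \<gamma>_shift)
  have "ennreal (integral {s1..s2} (\<lambda>s. norm (h (\<beta> s)))) = (\<integral>\<^sup>+s. ennreal (norm (h (\<beta> s))) * indicator {s1..s2} s \<partial>lborel)"
    by (rule nn_integral_has_integral_lebesgue'[symmetric])
       (auto intro!: integrable_integral integrable_continuous_real continuous_on_norm continuous_on_subset[OF hb])
  also have "\<dots> \<le> (\<integral>\<^sup>+s. ennreal c * (f s * indicator {t..<t + per} s) \<partial>lborel)"
  proof (rule nn_integral_mono)
    fix s
    show "ennreal (norm (h (\<beta> s))) * indicator {s1..s2} s \<le> ennreal c * (f s * indicator {t..<t + per} s)"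
    proof (cases "s \<in> {s1..s2}")
      case True
      then have "r / (2 * diam\<^sup>2) \<le> dlog t s" using lower by auto
      then have "c * (r / (2 * diam\<^sup>2) / pi) \<le> c * (dlog t s / pi)"
        using c0 by (intro mult_left_mono divide_right_mono) auto
      moreover have "c * (r / (2 * diam\<^sup>2) / pi) = 1" using r_pos diam_pos by (simp add: c_def)
      ultimately have "1 \<le> c * (dlog t s / pi)" by linarith
      then have "1 * norm (h (\<beta> s)) \<le> c * (dlog t s / pi) * norm (h (\<beta> s))" by (intro mult_right_mono) auto
      then have "ennreal (norm (h (\<beta> s))) \<le> ennreal (c * (dlog t s / pi) * norm (h (\<beta> s)))"
        by (intro ennreal_leI) simp
      also have "\<dots> = ennreal c * f s"
      proof -
        have a: "0 \<le> dlog t s / pi" using dlog_nonneg[of t s] by simp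
        show ?thesis
          by (simp only: f_def mult.assoc ennreal_mult[OF less_imp_le[OF c0] mult_nonneg_nonneg[OF a norm_ge_zero]]
              ennreal_mult[OF a norm_ge_zero])
      qed
      finally show ?thesis using True s by simp
    qed simp
  qed
  also have "\<dots> = ennreal c * (\<integral>\<^sup>+s. f s * indicator {t..<t + per} s \<partial>lborel)"
    using fm by (intro nn_integral_cmult) simp
  also have "(\<integral>\<^sup>+s. f s * indicator {t..<t + per} s \<partial>lborel) = (\<integral>\<^sup>+s. f s * indicator {0..<per} s \<partial>lborel)"
    by (rule nn_integral_period[symmetric, OF fm f_shift t])
  also have "\<dots> \<le> (\<integral>\<^sup>+z. ennreal (norm (h z)) \<partial>\<mu> t)"
  proof -
    have "(\<lambda>z. norm (h z)) \<in> borel_measurable bdry"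
      by (rule continuous_measurable_bdry) (intro continuous_on_norm h)
    then show ?thesis unfolding f_def by (intro nn_integral_\<mu>_ge) simp
  qed
  also have "\<dots> = ennreal (LINT z|\<mu> t. norm (h z))"
    by (intro nn_integral_eq_integral continuous_integrable_\<mu> continuous_on_norm h t) simp
  finally have "ennreal (integral {s1..s2} (\<lambda>s. norm (h (\<beta> s)))) \<le> ennreal c * ennreal (LINT z|\<mu> t. norm (h z))"
    by (simp add: mult_left_mono)
  also have "\<dots> = ennreal (c * (LINT z|\<mu> t. norm (h z)))"
    using c0 by (intro ennreal_mult[symmetric]) auto
  finally show ?thesis
    unfolding c_def[symmetric] using c0 by (subst (asm) ennreal_le_iff) (auto intro: mult_nonneg_nonneg)
qed

text \<open>Strict convexity of the disc in quantitative form. Pointwise x is at most \<eta> / 2 +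
  x^2 / (2 \<eta>), and the variance, the mean of |g - w|^2, equals the mean of |g|^2 minus |w|^2,
  which is at most 1 - |w|^2.\<close>

lemma mean_deviation_le:
  fixes g :: "complex \<Rightarrow> complex"
  assumes g: "continuous_on \<Omega> g" "\<And>z. z \<in> \<Omega> \<Longrightarrow> norm (g z) \<le> 1" and t: "0 \<le> t" "t < per" and "0 < \<eta>"
  defines "w \<equiv> LINT z|\<mu> t. g z"
  shows "(LINT z|\<mu> t. norm (g z - w)) \<le> \<eta> / 2 + (1 - (norm w)\<^sup>2) / (2 * \<eta>)"
proof -
  have int: "integrable (\<mu> t) k" if "continuous_on \<Omega> k" for k :: "complex \<Rightarrow> real"
    using continuous_integrable_\<mu>[OF that t] .
  have const: "(LINT z|\<mu> t. c) = c" for c :: real using measure_\<mu>_space[OF t] by simp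
  have "(LINT z|\<mu> t. norm (g z - w)) \<le> (LINT z|\<mu> t. \<eta> / 2 + ((norm (g z))\<^sup>2 - 2 * (w \<bullet> g z) + (norm w)\<^sup>2) / (2 * \<eta>))"
  proof (rule integral_mono)
    fix z
    have "(norm (g z - w))\<^sup>2 = (norm (g z))\<^sup>2 - 2 * (w \<bullet> g z) + (norm w)\<^sup>2"
      by (simp add: power2_norm_eq_inner inner_diff_left inner_diff_right inner_commute)
    moreover have "norm (g z - w) \<le> \<eta> / 2 + (norm (g z - w))\<^sup>2 / (2 * \<eta>)"
    proof -
      have "0 \<le> (norm (g z - w) - \<eta>)\<^sup>2" by simp
      then have "2 * \<eta> * norm (g z - w) \<le> \<eta> * \<eta> + (norm (g z - w))\<^sup>2"
        by (simp add: power2_eq_square algebra_simps)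
      then have "norm (g z - w) \<le> (\<eta> * \<eta> + (norm (g z - w))\<^sup>2) / (2 * \<eta>)"
        using \<open>0 < \<eta>\<close> by (simp add: pos_le_divide_eq mult.commute)
      also have "\<dots> = \<eta> / 2 + (norm (g z - w))\<^sup>2 / (2 * \<eta>)" using \<open>0 < \<eta>\<close> by (simp add: add_divide_distrib)
      finally show ?thesis .
    qed
    ultimately show "norm (g z - w) \<le> \<eta> / 2 + ((norm (g z))\<^sup>2 - 2 * (w \<bullet> g z) + (norm w)\<^sup>2) / (2 * \<eta>)" by simp
  qed (intro int continuous_intros g; use \<open>0 < \<eta>\<close> in simp)+
  also have "\<dots> = \<eta> / 2 + ((LINT z|\<mu> t. (norm (g z))\<^sup>2) - 2 * (w \<bullet> w) + (norm w)\<^sup>2) / (2 * \<eta>)"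
  proof -
    have inner: "(LINT z|\<mu> t. w \<bullet> g z) = w \<bullet> w"
      unfolding w_def[of] by (rule integral_inner_right) (intro continuous_integrable_\<mu> g t)
    have "integrable (\<mu> t) (\<lambda>z. (norm (g z))\<^sup>2)" "integrable (\<mu> t) (\<lambda>z. w \<bullet> g z)" "integrable (\<mu> t) (\<lambda>z. c)" for c :: real
      by (intro int continuous_intros g)+
    then show ?thesis by (simp add: inner measure_\<mu>_space[OF t])
  qed
  also have "\<dots> = \<eta> / 2 + ((LINT z|\<mu> t. (norm (g z))\<^sup>2) - (norm w)\<^sup>2) / (2 * \<eta>)"
    by (simp add: power2_norm_eq_inner)
  also have "\<dots> \<le> \<eta> / 2 + (1 - (norm w)\<^sup>2) / (2 * \<eta>)"
  proof -
    have "(LINT z|\<mu> t. (norm (g z))\<^sup>2) \<le> (LINT z|\<mu> t. 1)"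
    proof (rule integral_mono)
      fix z assume "z \<in> space (\<mu> t)"
      then have "norm (g z) \<le> 1" using g(2) frontier_subset by (auto simp: space_\<mu>)
      then show "(norm (g z))\<^sup>2 \<le> 1" by (simp add: power_le_one)
    qed (intro int continuous_intros g)+
    then show ?thesis using const[of 1] \<open>0 < \<eta>\<close> by (intro add_left_mono divide_right_mono) auto
  qed
  finally show ?thesis .
qed

lemma norm_mean_le_1:
  fixes g :: "complex \<Rightarrow> complex"
  assumes g: "continuous_on \<Omega> g" "\<And>z. z \<in> \<Omega> \<Longrightarrow> norm (g z) \<le> 1" and t: "0 \<le> t" "t < per"
  shows "norm (LINT z|\<mu> t. g z) \<le> 1"
proof -
  have "norm (LINT z|\<mu> t. g z) \<le> (LINT z|\<mu> t. norm (g z))" by (rule integral_norm_bound)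
  also have "\<dots> \<le> (LINT z|\<mu> t. 1)"
  proof (rule integral_mono)
    show "norm (g z) \<le> 1" if "z \<in> space (\<mu> t)" for z
      using that g(2) frontier_subset by (auto simp: space_\<mu>)
  qed (intro continuous_integrable_\<mu> continuous_intros g t)+
  also have "\<dots> = 1" using measure_\<mu>_space[OF t] by simp
  finally show ?thesis .
qed

lemma neumann_poincare_curve: "neumann_poincare \<Omega> g (\<beta> t) = (LINT z|\<mu> t. g z)"
  by (simp add: neumann_poincare_def \<mu>_def)

lemma dichotomy:
  obtains \<delta> where "0 < \<delta>" "\<delta> \<le> 1 / 128"
    "\<And>g \<zeta>. \<lbrakk>continuous_on \<Omega> g; g holomorphic_on interior \<Omega>; \<And>z. z \<in> \<Omega> \<Longrightarrow> norm (g z) \<le> 1; \<zeta> \<in> frontier \<Omega>\<rbrakk>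
      \<Longrightarrow> norm (neumann_poincare \<Omega> g \<zeta>) \<le> 1 - \<delta> \<or> norm (neumann_poincare \<Omega> g \<zeta> - g p) \<le> 1 / 4"
proof -
  obtain k :: nat where k: "2 \<le> k" "sin (pi / (2 * real k)) \<le> r / (2 * diam)"
    using exists_cone_exponent by blast
  define b where "b = pi / (2 * real k)"
  have b: "0 < b" "b < pi / 2" using k by (auto simp: b_def divide_simps)
  define w0 where "w0 = cos b * sin b * r\<^sup>2 / diam\<^sup>2"
  have w0: "0 < w0" using b r_pos diam_pos by (simp add: w0_def cos_gt_zero sin_gt_zero)
  \<comment> \<open>The contribution of the two edges, divided by the lower bound w0 for the contour
    integral; the last factor 2 bounds |g - w|.\<close>
  define C1 where "C1 = 2 * (diam / (r * sin b)) * 2 / w0"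
  have C1: "0 \<le> C1" using w0 b r_pos diam_pos by (simp add: C1_def sin_gt_zero less_imp_le)
  \<comment> \<open>Then C1 + 1 / 8 is exactly exp N / 8: dividing by the weight at p brings the
    edges, together with an arc term of at most 1 / 8, down to 1 / 8.\<close>
  define N where "N = ln (8 * C1 + 1)"
  have N: "0 \<le> N" using C1 by (simp add: N_def)
  have expN: "exp N = 8 * C1 + 1" using C1 by (simp add: N_def)
  \<comment> \<open>The price of the arc per unit of mean deviation: the Cauchy kernel, the weight
    on the arc, and the passage from arclength to the boundary measure.\<close>
  define D where "D = (1 / r) * exp (N * (diam / r) ^ k) * (2 * pi * diam\<^sup>2 / r) / w0"
  have D: "0 \<le> D" using w0 r_pos by (simp add: D_def)
  define \<eta> where "\<eta> = 1 / (8 * (D + 1))"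
  have \<eta>: "0 < \<eta>" "\<eta> \<le> 1 / 8" "D * \<eta> \<le> 1 / 8" using D by (simp_all add: \<eta>_def divide_simps)
  \<comment> \<open>If |w| > 1 - \<delta>, then 1 - |w|^2 is at most 2 \<delta> = \<eta>^2, so
    \<open>mean_deviation_le\<close> gives at most \<eta> / 2 + \<eta> / 2.\<close>
  define \<delta> where "\<delta> = \<eta>\<^sup>2 / 2"
  have \<delta>0: "0 < \<delta>" using \<eta> by (simp add: \<delta>_def)
  have \<delta>1: "\<delta> \<le> 1 / 128"
  proof -
    have "\<eta>\<^sup>2 \<le> (1 / 8)\<^sup>2" using \<eta> by (intro power_mono) auto
    then show ?thesis by (simp add: \<delta>_def power2_eq_square)
  qed
  show ?thesis
  proof (rule that[OF \<delta>0 \<delta>1])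
    fix g \<zeta>
    assume g: "continuous_on \<Omega> g" "g holomorphic_on interior \<Omega>" "\<And>z. z \<in> \<Omega> \<Longrightarrow> norm (g z) \<le> 1"
      and \<zeta>: "\<zeta> \<in> frontier \<Omega>"
    obtain t where t: "0 \<le> t" "t < per" "\<beta> t = \<zeta>" using boundary_time_frontier[OF \<zeta>] by blast
    define w where "w = (LINT z|\<mu> t. g z)"
    have Kw: "neumann_poincare \<Omega> g \<zeta> = w" using neumann_poincare_curve[of g t] t by (simp add: w_def)
    have norm_w: "norm w \<le> 1" unfolding w_def by (rule norm_mean_le_1[OF g(1,3) t(1,2)])
    show "norm (neumann_poincare \<Omega> g \<zeta>) \<le> 1 - \<delta> \<or> norm (neumann_poincare \<Omega> g \<zeta> - g p) \<le> 1 / 4"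
    proof (cases "norm w \<le> 1 - \<delta>")
      case False
      define E where "E = (LINT z|\<mu> t. norm (g z - w))"
      have "(1 - \<delta>)\<^sup>2 \<le> (norm w)\<^sup>2" using False \<delta>1 by (intro power_mono) auto
      then have "1 - (norm w)\<^sup>2 \<le> 2 * \<delta>" using \<delta>0 by (simp add: power2_eq_square algebra_simps)
        (smt (verit) mult_nonneg_nonneg)
      then have "(1 - (norm w)\<^sup>2) / (2 * \<eta>) \<le> (2 * \<delta>) / (2 * \<eta>)" using \<eta> by (intro divide_right_mono) auto
      also have "(2 * \<delta>) / (2 * \<eta>) = \<eta> / 2" using \<eta> by (simp add: \<delta>_def power2_eq_square)
      finally have E: "E \<le> \<eta>"
        using mean_deviation_le[OF g(1,3) t(1,2) \<eta>(1)] unfolding E_def w_def[symmetric] by linarith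
      have hc: "continuous_on \<Omega> (\<lambda>z. g z - w)" and hh: "(\<lambda>z. g z - w) holomorphic_on interior \<Omega>"
        by (intro continuous_intros g, intro holomorphic_intros g)
      have hb: "norm (g z - w) \<le> 2" if "z \<in> \<Omega>" for z
        using norm_triangle_ineq4[of "g z" w] g(3)[OF that] norm_w by linarith
      obtain s1 s2 where s: "t < s1" "s1 \<le> s2" "s2 < t + per"
        "\<And>s. \<lbrakk>s1 \<le> s; s \<le> s2\<rbrakk> \<Longrightarrow> r / (2 * diam\<^sup>2) \<le> dlog t s"
        "norm (g p - w) * exp N * w0
          \<le> 2 * (diam / (r * sin b)) * 2 + (1 / r) * (exp (N * (diam / r) ^ k) * integral {s1..s2} (\<lambda>s. norm (g (\<beta> s) - w)))"
        unfolding w0_def b_def using carleman_estimate[OF k N hc hh hb, of t] by blast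
      have "integral {s1..s2} (\<lambda>s. norm (g (\<beta> s) - w)) \<le> 2 * pi * diam\<^sup>2 / r * E"
        unfolding E_def by (rule arc_integral_le[OF hc t(1,2) s(1-4)])
      then have "(1 / r) * (exp (N * (diam / r) ^ k) * integral {s1..s2} (\<lambda>s. norm (g (\<beta> s) - w)))
          \<le> (1 / r) * (exp (N * (diam / r) ^ k) * (2 * pi * diam\<^sup>2 / r * E))"
        using r_pos by (intro mult_left_mono) auto
      also have "\<dots> = w0 * (D * E)" using w0 by (simp add: D_def)
      finally have "norm (g p - w) * exp N * w0 \<le> w0 * C1 + w0 * (D * E)"
        using s(5) w0 by (simp add: C1_def)
      then have "w0 * (norm (g p - w) * exp N) \<le> w0 * (C1 + D * E)" by (simp add: algebra_simps)
      then have "norm (g p - w) * exp N \<le> C1 + D * E" using w0 by simp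
      also have "D * E \<le> 1 / 8" using E D \<eta>(3) mult_left_mono[OF E D] by linarith
      also have "C1 + 1 / 8 = (1 / 8) * exp N" by (simp add: expN)
      finally have "norm (g p - w) * exp N \<le> (1 / 8) * exp N" by simp
      then have "norm (g p - w) \<le> 1 / 8" by (subst (asm) mult_le_cancel_right_pos) auto
      then show ?thesis unfolding Kw by (simp add: norm_minus_commute)
    qed (simp add: Kw)
  qed
qed

section \<open>From values of the operator to the quotient norm\<close>

lemma sup_norm_bdd:
  assumes "\<And>\<zeta>. \<zeta> \<in> frontier \<Omega> \<Longrightarrow> norm (G \<zeta> - c) \<le> q"
  shows "bdd_above ((\<lambda>\<zeta>. norm (G \<zeta> - d)) ` frontier \<Omega>)"
    and "bdd_below (range (\<lambda>d. SUP \<zeta>\<in>frontier \<Omega>. norm (G \<zeta> - d)))"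
proof -
  show bdd: "bdd_above ((\<lambda>\<zeta>. norm (G \<zeta> - d)) ` frontier \<Omega>)" for d
  proof (rule bdd_aboveI2)
    fix \<zeta> assume "\<zeta> \<in> frontier \<Omega>"
    then show "norm (G \<zeta> - d) \<le> q + norm (c - d)"
      using assms[of \<zeta>] norm_triangle_ineq[of "G \<zeta> - c" "c - d"] by simp
  qed
  have "0 \<le> (SUP \<zeta>\<in>frontier \<Omega>. norm (G \<zeta> - d))" for d
    by (rule cSUP_upper2[OF bdd \<gamma>_frontier norm_ge_zero])
  then show "bdd_below (range (\<lambda>d. SUP \<zeta>\<in>frontier \<Omega>. norm (G \<zeta> - d)))" by (intro bdd_belowI2[of _ 0])
qed

lemma quotient_norm_leI:
  assumes "\<And>\<zeta>. \<zeta> \<in> frontier \<Omega> \<Longrightarrow> norm (G \<zeta> - c) \<le> q"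
  shows "quotient_norm \<Omega> G \<le> q"
proof -
  have ne: "frontier \<Omega> \<noteq> {}" using \<gamma>_frontier by blast
  show ?thesis
    unfolding quotient_norm_def
    by (rule cINF_lower2[OF sup_norm_bdd(2)[of G c q, OF assms], of c]) (use assms ne in \<open>auto intro: cSUP_least\<close>)
qed

text \<open>The strict slack between q and q' replaces attainment of the infimum over
  constants.\<close>

lemma quotient_normD:
  assumes "quotient_norm \<Omega> G \<le> q" "q < q'" "\<And>\<zeta>. \<zeta> \<in> frontier \<Omega> \<Longrightarrow> norm (G \<zeta>) \<le> B"
  obtains c where "\<And>\<zeta>. \<zeta> \<in> frontier \<Omega> \<Longrightarrow> norm (G \<zeta> - c) \<le> q'"
proof -
  have B: "norm (G \<zeta> - 0) \<le> B" if "\<zeta> \<in> frontier \<Omega>" for \<zeta> using assms(3)[OF that] by simp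
  have "(INF d. SUP \<zeta>\<in>frontier \<Omega>. norm (G \<zeta> - d)) < q'"
    using assms unfolding quotient_norm_def by linarith
  then obtain c where c: "(SUP \<zeta>\<in>frontier \<Omega>. norm (G \<zeta> - c)) < q'"
    using cINF_less_iff[OF UNIV_not_empty sup_norm_bdd(2)[of G 0 B, OF B]] by blast
  show ?thesis
  proof (rule that[of c])
    fix \<zeta> assume "\<zeta> \<in> frontier \<Omega>"
    from cSUP_upper[OF this sup_norm_bdd(1)[of G 0 B, OF B]] c show "norm (G \<zeta> - c) \<le> q'"
      by (meson less_imp_le order_trans)
  qed
qed

lemma neumann_poincare_affine:
  assumes "continuous_on \<Omega> g" "\<zeta> \<in> frontier \<Omega>"
  shows "neumann_poincare \<Omega> (\<lambda>z. (g z - c) / d) \<zeta> = (neumann_poincare \<Omega> g \<zeta> - c) / d"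
proof -
  obtain t where t: "0 \<le> t" "t < per" "\<beta> t = \<zeta>" using boundary_time_frontier[OF assms(2)] by blast
  have i: "integrable (\<mu> t) g" by (rule continuous_integrable_\<mu>[OF assms(1) t(1,2)])
  have ic: "integrable (\<mu> t) (\<lambda>z. c)" by (rule continuous_integrable_\<mu>[OF continuous_on_const t(1,2)])
  show ?thesis
    using neumann_poincare_curve[of _ t] t(3) i ic measure_\<mu>_space[OF t(1,2)] by simp
qed

text \<open>All values of modulus above 1 - \<delta> cluster around a, so moving the centre by
  \<delta> / 2 towards a helps them. The remaining values lose at most \<delta> / 2 of their margin
  \<delta>.\<close>

lemma shrinks_to_smaller_disc:
  assumes \<delta>: "0 < \<delta>" "\<delta> \<le> 1 / 128" and a: "norm a \<le> 1"
    and G: "\<And>\<zeta>. \<zeta> \<in> S \<Longrightarrow> norm (G \<zeta>) \<le> 1"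
      "\<And>\<zeta>. \<zeta> \<in> S \<Longrightarrow> norm (G \<zeta>) \<le> 1 - \<delta> \<or> norm (G \<zeta> - a) \<le> 1 / 4"
  shows "\<exists>c :: complex. \<forall>\<zeta>\<in>S. norm (G \<zeta> - c) \<le> 1 - \<delta> / 8"
proof (cases "\<exists>\<zeta>\<in>S. 1 - \<delta> < norm (G \<zeta>)")
  case False
  then show ?thesis using \<delta> by (intro exI[of _ 0]) (auto simp: not_less intro: order_trans)
next
  case True
  then obtain \<zeta>\<^sub>0 where "\<zeta>\<^sub>0 \<in> S" "1 - \<delta> < norm (G \<zeta>\<^sub>0)" by blast
  \<comment> \<open>A value near the unit circle is within 1 / 4 of a, which bounds a away from 0
    and makes its direction u meaningful.\<close>
  then have na: "3 / 4 - \<delta> \<le> norm a" using G(2)[of \<zeta>\<^sub>0] norm_triangle_ineq2[of "G \<zeta>\<^sub>0" a] by auto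
  then have a0: "0 < norm a" using \<delta> by linarith
  define u where "u = a /\<^sub>R norm a"
  have u: "norm u = 1" using a0 by (simp add: u_def)
  have au: "u \<bullet> a = norm a" using a0 by (simp add: u_def dot_square_norm power2_eq_square)
  have "norm (G \<zeta> - (\<delta> / 2) *\<^sub>R u) \<le> 1 - \<delta> / 8" if "\<zeta> \<in> S" for \<zeta>
    using G(2)[OF that]
  proof
    assume "norm (G \<zeta>) \<le> 1 - \<delta>"
    then show ?thesis using norm_triangle_ineq4[of "G \<zeta>" "(\<delta> / 2) *\<^sub>R u"] u \<delta> by simp
  next
    assume near: "norm (G \<zeta> - a) \<le> 1 / 4"
    have "- norm (G \<zeta> - a) \<le> u \<bullet> (G \<zeta> - a)" using Cauchy_Schwarz_ineq2[of u "G \<zeta> - a"] u by simp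
    \<comment> \<open>The component along u is at least (3 / 4 - \<delta>) - 1 / 4. Moving the
      centre therefore lowers the squared distance by about \<delta> / 2, and \<delta> at most 1 /
      128 absorbs the quadratic terms.\<close>
    then have inner: "1 / 2 - \<delta> \<le> u \<bullet> G \<zeta>" using near na au by (simp add: inner_diff_right)
    have "(norm (G \<zeta> - (\<delta> / 2) *\<^sub>R u))\<^sup>2 = (norm (G \<zeta>))\<^sup>2 - \<delta> * (u \<bullet> G \<zeta>) + (\<delta> / 2)\<^sup>2 * (norm u)\<^sup>2"
    proof -
      have "(norm (x - y))\<^sup>2 = (norm x)\<^sup>2 - 2 * (y \<bullet> x) + (norm y)\<^sup>2" for x y :: complex
        by (simp add: power2_norm_eq_inner inner_diff_left inner_diff_right inner_commute)
      from this[of "G \<zeta>" "(\<delta> / 2) *\<^sub>R u"] show ?thesis by (simp add: power_mult_distrib power_divide)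
    qed
    also have "\<dots> \<le> 1 - \<delta> * (1 / 2 - \<delta>) + (\<delta> / 2)\<^sup>2 * 1"
      using G(1)[OF that] inner u \<delta> by (intro add_mono diff_mono mult_left_mono) (auto simp: power_le_one)
    also have "\<dots> \<le> (1 - \<delta> / 8)\<^sup>2"
    proof -
      have "\<delta> * \<delta> \<le> \<delta> * (1 / 128)" using \<delta> by (intro mult_left_mono) auto
      moreover have "0 \<le> \<delta> * \<delta>" by simp
      moreover have "1 - \<delta> * (1 / 2 - \<delta>) + (\<delta> / 2)\<^sup>2 * 1 = 1 - \<delta> / 2 + 5 / 4 * (\<delta> * \<delta>)"
        "(1 - \<delta> / 8)\<^sup>2 = 1 - \<delta> / 4 + (\<delta> * \<delta>) / 64"
        by (simp_all add: power2_eq_square algebra_simps)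
      ultimately show ?thesis by linarith
    qed
    finally show ?thesis by (rule power2_le_imp_le) (use \<delta> in simp)
  qed
  then show ?thesis by blast
qed

lemma analytic_config_const_less_1: "analytic_config_const \<Omega> < 1"
proof -
  obtain \<delta> where \<delta>: "0 < \<delta>" "\<delta> \<le> 1 / 128"
    and dich: "\<And>g \<zeta>. \<lbrakk>continuous_on \<Omega> g; g holomorphic_on interior \<Omega>; \<And>z. z \<in> \<Omega> \<Longrightarrow> norm (g z) \<le> 1; \<zeta> \<in> frontier \<Omega>\<rbrakk>
      \<Longrightarrow> norm (neumann_poincare \<Omega> g \<zeta>) \<le> 1 - \<delta> \<or> norm (neumann_poincare \<Omega> g \<zeta> - g p) \<le> 1 / 4"
    using dichotomy by blast
  define q where "q = 1 - \<delta> / 8"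
  have q: "0 < q" "q < 1" using \<delta> by (auto simp: q_def)
  have unit: "\<exists>c. \<forall>\<zeta>\<in>frontier \<Omega>. norm (neumann_poincare \<Omega> g \<zeta> - c) \<le> q"
    if g: "continuous_on \<Omega> g" "g holomorphic_on interior \<Omega>" "\<And>z. z \<in> \<Omega> \<Longrightarrow> norm (g z) \<le> 1" for g
    unfolding q_def
  proof (rule shrinks_to_smaller_disc[OF \<delta> g(3)[OF p_mem]])
    fix \<zeta> assume \<zeta>: "\<zeta> \<in> frontier \<Omega>"
    show "norm (neumann_poincare \<Omega> g \<zeta>) \<le> 1 - \<delta> \<or> norm (neumann_poincare \<Omega> g \<zeta> - g p) \<le> 1 / 4"
      by (rule dich[OF g \<zeta>])
    obtain t where t: "0 \<le> t" "t < per" "\<beta> t = \<zeta>" using boundary_time_frontier[OF \<zeta>] by blast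
    show "norm (neumann_poincare \<Omega> g \<zeta>) \<le> 1"
      using norm_mean_le_1[OF g(1,3) t(1,2)] neumann_poincare_curve[of g t] t(3) by simp
  qed
  have bound: "quotient_norm \<Omega> (neumann_poincare \<Omega> g) \<le> q"
    if g: "g \<in> analytic_algebra \<Omega>" "quotient_norm \<Omega> g \<le> 1" for g
  proof -
    have gc: "continuous_on \<Omega> g" and gh: "g holomorphic_on interior \<Omega>"
      using g(1) by (auto simp: analytic_algebra_def)
    have "bounded (g ` \<Omega>)" using compact_continuous_image[OF gc compact] compact_imp_bounded by blast
    then obtain B where "\<forall>y\<in>g ` \<Omega>. norm y \<le> B" unfolding bounded_iff by blast
    then have B: "norm (g \<zeta>) \<le> B" if "\<zeta> \<in> frontier \<Omega>" for \<zeta> using that frontier_subset by blast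
    have "quotient_norm \<Omega> (neumann_poincare \<Omega> g) \<le> q + e" if e: "0 < e" for e
    proof -
      \<comment> \<open>Chosen so that (1 + \<epsilon>) q = q + e when the normalisation of g is
        undone.\<close>
      define \<epsilon> where "\<epsilon> = e / q"
      have \<epsilon>: "0 < \<epsilon>" using e q by (simp add: \<epsilon>_def)
      obtain c where c: "\<And>\<zeta>. \<zeta> \<in> frontier \<Omega> \<Longrightarrow> norm (g \<zeta> - c) \<le> 1 + \<epsilon>"
        by (rule quotient_normD[OF g(2) _ B]) (use \<epsilon> in auto)
      define f where "f z = (g z - c) / of_real (1 + \<epsilon>)" for z
      have \<epsilon>0: "of_real (1 + \<epsilon>) \<noteq> (0 :: complex)" using \<epsilon> by (simp del: of_real_add)
      have fc: "continuous_on \<Omega> f" and fh: "f holomorphic_on interior \<Omega>"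
        unfolding f_def using \<epsilon>0 by (intro continuous_intros gc, simp, intro holomorphic_intros gh, simp)
      have fn: "norm (f z) = norm (g z - c) / (1 + \<epsilon>)" for z
        using \<epsilon> by (simp add: f_def norm_divide del: of_real_add)
      \<comment> \<open>The quotient norm controls g only on the boundary, but the value at the
        interior point p enters the argument; the maximum modulus principle carries the bound
        inside.\<close>
      have f1: "norm (f z) \<le> 1" if "z \<in> \<Omega>" for z
      proof (rule maximum_modulus_frontier[OF fh])
        show "continuous_on (closure \<Omega>) f" using fc closed by simp
        show "norm (f w) \<le> 1" if "w \<in> frontier \<Omega>" for w
          unfolding fn using c[OF that] \<epsilon> by simp
      qed (use compact compact_imp_bounded that in auto)
      obtain d where d: "\<And>\<zeta>. \<zeta> \<in> frontier \<Omega> \<Longrightarrow> norm (neumann_poincare \<Omega> f \<zeta> - d) \<le> q"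
        using unit[OF fc fh f1] by blast
      show ?thesis
      proof (rule quotient_norm_leI[of _ "c + of_real (1 + \<epsilon>) * d"])
        fix \<zeta> assume \<zeta>: "\<zeta> \<in> frontier \<Omega>"
        have "neumann_poincare \<Omega> f \<zeta> = (neumann_poincare \<Omega> g \<zeta> - c) / of_real (1 + \<epsilon>)"
          unfolding f_def[abs_def] by (rule neumann_poincare_affine[OF gc \<zeta>])
        then have "of_real (1 + \<epsilon>) * neumann_poincare \<Omega> f \<zeta> = neumann_poincare \<Omega> g \<zeta> - c"
          by (simp only: nonzero_eq_divide_eq[OF \<epsilon>0] mult.commute)
        then have "neumann_poincare \<Omega> g \<zeta> - (c + of_real (1 + \<epsilon>) * d)
            = of_real (1 + \<epsilon>) * (neumann_poincare \<Omega> f \<zeta> - d)"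
          unfolding right_diff_distrib by (simp only: diff_diff_add)
        then have "norm (neumann_poincare \<Omega> g \<zeta> - (c + of_real (1 + \<epsilon>) * d))
            = (1 + \<epsilon>) * norm (neumann_poincare \<Omega> f \<zeta> - d)"
          using \<epsilon> by (simp add: norm_mult del: of_real_add)
        also have "\<dots> \<le> (1 + \<epsilon>) * q" using d[OF \<zeta>] \<epsilon> by (intro mult_left_mono) auto
        also have "\<dots> = q + e" using q by (simp add: \<epsilon>_def algebra_simps)
        finally show "norm (neumann_poincare \<Omega> g \<zeta> - (c + of_real (1 + \<epsilon>) * d)) \<le> q + e" .
      qed
    qed
    then show ?thesis by (rule field_le_epsilon)
  qed
  have "analytic_config_const \<Omega> \<le> q"
    unfolding analytic_config_const_def
  proof (rule cSUP_least)
    \<comment> \<open>A supremum of reals is bounded by its upper bounds only over a nonempty set;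
      the zero function is a member.\<close>
    have "quotient_norm \<Omega> (\<lambda>_. 0) \<le> 1" by (rule quotient_norm_leI[of _ 0]) simp
    then have "(\<lambda>_. 0) \<in> {g \<in> analytic_algebra \<Omega>. quotient_norm \<Omega> g \<le> 1}"
      by (simp add: analytic_algebra_def)
    then show "{g \<in> analytic_algebra \<Omega>. quotient_norm \<Omega> g \<le> 1} \<noteq> {}" by blast
  qed (use bound in blast)
  then show ?thesis using q by simp
qed

end

theorem theorem2:
  fixes \<Omega> :: "complex set"
  assumes "compact \<Omega>" and "convex \<Omega>" and "interior \<Omega> \<noteq> {}"
  shows "analytic_config_const \<Omega> < 1"
proof -
  obtain p r where "0 < r" "cball p r \<subseteq> \<Omega>" using assms(3) mem_interior_cball by blast
  then have "convex_body \<Omega> p r" using assms(1,2) by unfold_locales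
  then interpret boundary_body \<Omega> p r by (rule convex_body.boundary_body)
  show ?thesis by (rule analytic_config_const_less_1)
qed

end
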